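(* Let $(X,\tau)$ be a compatible decoration of $A$. The pair $(\widetilde W,\{\widetilde s_i\}_{i\in\widetilde I})$ is a Coxeter system if and only if $(X,\tau)$ is a generalized Satake diagram. In this case, with $\widetilde\ell$ denoting the length function of this Coxeter system and $\ell$ the length function of $(W,\{s_i\}_{i\in I})$, for all $w,w'\in\widetilde W$ one has $$\widetilde\ell(ww')=\widetilde\ell(w)+\widetilde\ell(w')\iff\ell(ww')=\ell(w)+\ell(w').$$
   Context: $I$ is a finite set and $A=(a_{ij})_{i,j\in I}$ is an indecomposable symmetrizable generalized Cartan matrix: $a_{ii}=2$, $a_{ij}\in\mathbb Z_{\le0}$ for $i\neq j$, $a_{ij}=0\iff a_{ji}=0$, with positive setwise-coprime integers $\epsilon_i$ such that $\epsilon_ia_{ij}=\epsilon_ja_{ji}$. $\mathrm{Aut}(A)$ is the group of bijections $\tau:I\to I$ with $a_{\tau(i)\tau(j)}=a_{ij}$. $W$ is the Weyl group of $A$, acting faithfully on the $\mathbb Q$-vector space $V$ with basis the simple roots $\{\alpha_i\}_{i\in I}$, generated by $s_i(\alpha_j)=\alpha_j-a_{ij}\alpha_i$; $(W,\{s_i\}_{i\in I})$ is a Coxeter system. For $X\subseteq I$, $W_X=\langle s_i\rangle_{i\in X}$; $X$ is of finite type if $W_X$ is finite; then $w_X$ denotes its longest element and $\mathrm{oi}_X$ the diagram automorphism of $(a_{ij})_{i,j\in X}$ with $w_X(\alpha_i)=-\alpha_{\mathrm{oi}_X(i)}$ ($i\in X$). A compatible decoration is a pair $(X,\tau)$ with $X\subseteq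 I$ of finite type, $\tau\in\mathrm{Aut}(A)$, $\tau(X)\subseteq X$, $\tau^2=\mathrm{id}_I$, $\tau|_X=\mathrm{oi}_X$. For $i\in I\setminus X$ put $X[i]=X\cup\{i,\tau(i)\}$. $(X,\tau)$ is a generalized Satake diagram if for all $i\in I\setminus X$ with $\tau(i)=i$ the connected component of $X[i]$ (as a subdiagram) containing $i$ is not of type $\mathsf A_2$. $I^*\subset I\setminus X$ is a fixed subset containing exactly one element of each $\tau$-orbit in $I\setminus X$, and $\widetilde I=\{i\in I^*:X[i]\text{ is of finite type}\}$. For $i\in\widetilde I$, $\widetilde s_i=w_X\cdot w_{X[i]}\in W_{X[i]}$, and $\widetilde W=\langle\widetilde s_i\rangle_{i\in\widetilde I}\le W$. *)

theory Defs
  imports "HOL-Analysis.Analysis" "HOL-Algebra.Generated_Groups"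
begin

section \<open>Group presentations and Coxeter systems\<close>

text \<open>Words in a free group: the letter \<open>(j, True)\<close> stands for the generator with index \<open>j\<close> and
  \<open>(j, False)\<close> for its formal inverse.\<close>

type_synonym 'j gword = "('j \<times> bool) list"

fun gword_val :: "('g, 'x) monoid_scheme \<Rightarrow> ('j \<Rightarrow> 'g) \<Rightarrow> 'j gword \<Rightarrow> 'g" where
  "gword_val G s [] = \<one>\<^bsub>G\<^esub>"
| "gword_val G s ((j, b) # w) = (if b then s j else inv\<^bsub>G\<^esub> (s j)) \<otimes>\<^bsub>G\<^esub> gword_val G s w"

inductive pres_eq :: "'j set \<Rightarrow> 'j gword set \<Rightarrow> 'j gword \<Rightarrow> 'j gword \<Rightarrow> bool"
  for J :: "'j set" and R :: "'j gword set" where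
  refl: "w \<in> lists (J \<times> UNIV) \<Longrightarrow> pres_eq J R w w"
| sym: "pres_eq J R v w \<Longrightarrow> pres_eq J R w v"
| trans: "pres_eq J R u v \<Longrightarrow> pres_eq J R v w \<Longrightarrow> pres_eq J R u w"
| cancel: "u \<in> lists (J \<times> UNIV) \<Longrightarrow> v \<in> lists (J \<times> UNIV) \<Longrightarrow> j \<in> J \<Longrightarrow>
    pres_eq J R (u @ [(j, b), (j, \<not> b)] @ v) (u @ v)"
| rel: "u \<in> lists (J \<times> UNIV) \<Longrightarrow> v \<in> lists (J \<times> UNIV) \<Longrightarrow> r \<in> R \<Longrightarrow> r \<in> lists (J \<times> UNIV) \<Longrightarrow>
    pres_eq J R (u @ r @ v) (u @ v)"

text \<open>The canonical homomorphism from the group with generators \<open>J\<close> and relators \<open>R\<close> to \<open>G\<close>,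
  sending the generator \<open>j\<close> to \<open>s j\<close>, is well defined and an isomorphism.\<close>

definition has_presentation ::
    "('g, 'x) monoid_scheme \<Rightarrow> 'j set \<Rightarrow> ('j \<Rightarrow> 'g) \<Rightarrow> 'j gword set \<Rightarrow> bool" where
  "has_presentation G J s R \<longleftrightarrow>
     group G \<and> s ` J \<subseteq> carrier G \<and> generate G (s ` J) = carrier G \<and>
     (\<forall>w \<in> lists (J \<times> UNIV). gword_val G s w = \<one>\<^bsub>G\<^esub> \<longleftrightarrow> pres_eq J R w [])"

text \<open>The entry \<open>0\<close> of a Coxeter matrix encodes \<open>\<infinity>\<close>; the corresponding relator below
  is the empty word, that is, no relation is imposed.\<close>

definition coxeter_matrix :: "'j set \<Rightarrow> ('j \<Rightarrow> 'j \<Rightarrow> nat) \<Rightarrow> bool" where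
  "coxeter_matrix J m \<longleftrightarrow> (\<forall>j\<in>J. \<forall>k\<in>J. m j k = m k j \<and> (m j k = 1 \<longleftrightarrow> j = k))"

definition coxeter_relators :: "'j set \<Rightarrow> ('j \<Rightarrow> 'j \<Rightarrow> nat) \<Rightarrow> 'j gword set" where
  "coxeter_relators J m =
     {concat (replicate (m j k) [(j, True), (k, True)]) |j k. j \<in> J \<and> k \<in> J}"

definition coxeter_system :: "('g, 'x) monoid_scheme \<Rightarrow> 'j set \<Rightarrow> ('j \<Rightarrow> 'g) \<Rightarrow> bool" where
  "coxeter_system G J s \<longleftrightarrow>
     (\<exists>m. coxeter_matrix J m \<and> has_presentation G J s (coxeter_relators J m))"

text \<open>Least length of an expression as a product of the \<open>s j\<close> with \<open>j \<in> J\<close>. It is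
  used only where the \<open>s j\<close> are involutions, so inverse letters are not needed.\<close>

definition word_length :: "('g, 'x) monoid_scheme \<Rightarrow> 'j set \<Rightarrow> ('j \<Rightarrow> 'g) \<Rightarrow> 'g \<Rightarrow> nat" where
  "word_length G J s g =
     (LEAST n. \<exists>w \<in> lists J. length w = n \<and> foldr (\<otimes>\<^bsub>G\<^esub>) (map s w) \<one>\<^bsub>G\<^esub> = g)"

section \<open>Generalized Cartan matrices\<close>

definition gen_cartan_matrix :: "int^'i^'i::finite \<Rightarrow> bool" where
  "gen_cartan_matrix A \<longleftrightarrow>
     (\<forall>i. A $ i $ i = 2) \<and>
     (\<forall>i j. i \<noteq> j \<longrightarrow> A $ i $ j \<le> 0) \<and>
     (\<forall>i j. A $ i $ j = 0 \<longleftrightarrow> A $ j $ i = 0)"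

definition symmetrizable :: "int^'i^'i::finite \<Rightarrow> bool" where
  "symmetrizable A \<longleftrightarrow>
     (\<exists>\<epsilon> :: 'i \<Rightarrow> int. (\<forall>i. \<epsilon> i > 0) \<and> Gcd (range \<epsilon>) = 1 \<and>
        (\<forall>i j. \<epsilon> i * A $ i $ j = \<epsilon> j * A $ j $ i))"

definition indecomposable :: "int^'i^'i::finite \<Rightarrow> bool" where
  "indecomposable A \<longleftrightarrow>
     \<not> (\<exists>J. J \<noteq> {} \<and> J \<noteq> UNIV \<and> (\<forall>j \<in> J. \<forall>k \<in> - J. A $ j $ k = 0 \<and> A $ k $ j = 0))"

definition diagram_auts :: "int^'i^'i::finite \<Rightarrow> ('i \<Rightarrow> 'i) set" where
  "diagram_auts A = {\<tau>. bij \<tau> \<and> (\<forall>i j. A $ \<tau> i $ \<tau> j = A $ i $ j)}"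

definition diagram_component :: "int^'i^'i::finite \<Rightarrow> 'i set \<Rightarrow> 'i \<Rightarrow> 'i set" where
  "diagram_component A Y i =
     {j. (i, j) \<in> {(k, l). k \<in> Y \<and> l \<in> Y \<and> k \<noteq> l \<and> A $ k $ l \<noteq> 0}\<^sup>*}"

definition type_A2 :: "int^'i^'i::finite \<Rightarrow> 'i set \<Rightarrow> bool" where
  "type_A2 A Y \<longleftrightarrow>
     (\<exists>j k. j \<noteq> k \<and> Y = {j, k} \<and>
        A $ j $ j = 2 \<and> A $ j $ k = -1 \<and> A $ k $ j = -1 \<and> A $ k $ k = 2)"

section \<open>The Weyl group\<close>

definition simple_root :: "'i::finite \<Rightarrow> rat^'i" where
  "simple_root i = axis i 1"

definition GL_V :: "(rat^'i::finite \<Rightarrow> rat^'i) monoid" where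
  "GL_V = \<lparr>carrier = {f. Vector_Spaces.linear (*s) (*s) f \<and> bij f}, mult = (\<circ>), one = id\<rparr>"

text \<open>Linear extension of \<open>s\<^sub>i(\<alpha>\<^sub>j) = \<alpha>\<^sub>j - a\<^sub>i\<^sub>j \<alpha>\<^sub>i\<close>; see \<open>simple_refl_simple_root\<close> and
  \<open>simple_refl_GL_V\<close>.\<close>

definition simple_refl :: "int^'i^'i::finite \<Rightarrow> 'i \<Rightarrow> rat^'i \<Rightarrow> rat^'i" where
  "simple_refl A i v = v - (\<Sum>j\<in>UNIV. v $ j * of_int (A $ i $ j)) *s simple_root i"

definition parabolic :: "int^'i^'i::finite \<Rightarrow> 'i set \<Rightarrow> (rat^'i \<Rightarrow> rat^'i) monoid" where
  "parabolic A Y = GL_V\<lparr>carrier := generate GL_V (simple_refl A ` Y)\<rparr>"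

abbreviation weyl_group :: "int^'i^'i::finite \<Rightarrow> (rat^'i \<Rightarrow> rat^'i) monoid" where
  "weyl_group A \<equiv> parabolic A UNIV"

definition weyl_length :: "int^'i^'i::finite \<Rightarrow> (rat^'i \<Rightarrow> rat^'i) \<Rightarrow> nat" where
  "weyl_length A = word_length (weyl_group A) UNIV (simple_refl A)"

definition finite_type :: "int^'i^'i::finite \<Rightarrow> 'i set \<Rightarrow> bool" where
  "finite_type A Y \<longleftrightarrow> finite (carrier (parabolic A Y))"

text \<open>The element of maximal length in the Coxeter system \<open>(W\<^sub>Y, {s\<^sub>i}\<^sub>i\<^sub>\<in>\<^sub>Y)\<close>; meaningful
  for \<open>Y\<close> of finite type.\<close>

definition longest_elt :: "int^'i^'i::finite \<Rightarrow> 'i set \<Rightarrow> rat^'i \<Rightarrow> rat^'i" where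
  "longest_elt A Y =
     (THE w. w \<in> carrier (parabolic A Y) \<and>
        (\<forall>u \<in> carrier (parabolic A Y).
           word_length (parabolic A Y) Y (simple_refl A) u
             \<le> word_length (parabolic A Y) Y (simple_refl A) w))"

definition opp_inv :: "int^'i^'i::finite \<Rightarrow> 'i set \<Rightarrow> 'i \<Rightarrow> 'i" where
  "opp_inv A Y i = (THE j. j \<in> Y \<and> longest_elt A Y (simple_root i) = - simple_root j)"

lemma simple_refl_simple_root:
  "simple_refl A i (simple_root j) = simple_root j - of_int (A $ i $ j) *s simple_root i"
proof -
  have "(\<Sum>k\<in>UNIV. axis j 1 $ k * rat_of_int (A $ i $ k)) = of_int (A $ i $ j)"
    by (subst sum.remove[of _ j]) (auto simp: axis_def)
  then show ?thesis by (simp add: simple_refl_def simple_root_def)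
qed

lemma simple_refl_GL_V:
  fixes A :: "int^'i^'i::finite"
  assumes "gen_cartan_matrix A"
  shows "simple_refl A i \<in> carrier GL_V"
proof -
  let ?c = "\<lambda>v::rat^'i. \<Sum>j\<in>UNIV. v $ j * of_int (A $ i $ j)"
  have add: "?c (v + w) = ?c v + ?c w" for v w
    by (simp add: algebra_simps sum.distrib)
  have scale: "?c (r *s v) = r * ?c v" for r v
    by (simp add: sum_distrib_left algebra_simps)
  have lin: "Vector_Spaces.linear (*s) (*s) (simple_refl A i)"
    by unfold_locales
      (simp_all only: simple_refl_def add scale vec.scale_left_distrib vec.scale_right_diff_distrib
        vector_smult_assoc, simp_all add: algebra_simps vector_smult_assoc)
  have root: "?c (simple_root i) = 2"
    using assms unfolding simple_root_def gen_cartan_matrix_def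
    by (subst sum.remove[of _ i]) (auto simp: axis_def)
  have diff: "?c (v - w) = ?c v - ?c w" for v w
    by (simp add: algebra_simps sum_subtractf)
  have "simple_refl A i (simple_refl A i v) = v" for v
    unfolding simple_refl_def diff scale root by (simp add: vec_eq_iff algebra_simps)
  then have "bij (simple_refl A i)"
    by (metis involuntory_imp_bij)
  with lin show ?thesis by (simp add: GL_V_def)
qed

lemma group_GL_V: "group (GL_V :: (rat^'i::finite \<Rightarrow> rat^'i) monoid)"
proof (rule groupI)
  fix f :: "rat^'i \<Rightarrow> rat^'i" assume f: "f \<in> carrier GL_V"
  then have lin: "Vector_Spaces.linear (*s) (*s) f" and bij: "bij f" by (auto simp: GL_V_def)
  obtain g where g: "Vector_Spaces.linear (*s) (*s) g" "g \<circ> f = id"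
    using vec.linear_injective_left_inverse[OF lin bij_is_inj[OF bij]] by blast
  then have "bij g" using bij by (metis bij_betw_id bij_betw_comp_iff)
  with g show "\<exists>g\<in>carrier GL_V. g \<otimes>\<^bsub>GL_V\<^esub> f = \<one>\<^bsub>GL_V\<^esub>"
    by (auto simp: GL_V_def)
qed (auto simp: GL_V_def bij_comp comp_assoc vec.linear_id intro: Vector_Spaces.linear_compose)

section \<open>Compatible decorations and generalized Satake diagrams\<close>

definition compatible_decoration :: "int^'i^'i::finite \<Rightarrow> 'i set \<Rightarrow> ('i \<Rightarrow> 'i) \<Rightarrow> bool" where
  "compatible_decoration A X \<tau> \<longleftrightarrow>
     finite_type A X \<and> \<tau> \<in> diagram_auts A \<and> \<tau> ` X \<subseteq> X \<and> \<tau> \<circ> \<tau> = id \<and>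
     (\<forall>i \<in> X. \<tau> i = opp_inv A X i)"

definition dec_ext :: "'i set \<Rightarrow> ('i \<Rightarrow> 'i) \<Rightarrow> 'i \<Rightarrow> 'i set" where
  "dec_ext X \<tau> i = X \<union> {i, \<tau> i}"

definition gen_satake_diagram :: "int^'i^'i::finite \<Rightarrow> 'i set \<Rightarrow> ('i \<Rightarrow> 'i) \<Rightarrow> bool" where
  "gen_satake_diagram A X \<tau> \<longleftrightarrow>
     compatible_decoration A X \<tau> \<and>
     (\<forall>i \<in> - X. \<tau> i = i \<longrightarrow> \<not> type_A2 A (diagram_component A (dec_ext X \<tau> i) i))"

text \<open>For an involution \<open>\<tau>\<close> the orbit of \<open>i\<close> is \<open>{i, \<tau> i}\<close>.\<close>

definition orbit_reps :: "'i set \<Rightarrow> ('i \<Rightarrow> 'i) \<Rightarrow> 'i set \<Rightarrow> bool" where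
  "orbit_reps X \<tau> Istar \<longleftrightarrow> Istar \<subseteq> - X \<and> (\<forall>i \<in> - X. \<exists>!j. j \<in> Istar \<and> j \<in> {i, \<tau> i})"

definition I_tilde :: "int^'i^'i::finite \<Rightarrow> 'i set \<Rightarrow> ('i \<Rightarrow> 'i) \<Rightarrow> 'i set \<Rightarrow> 'i set" where
  "I_tilde A X \<tau> Istar = {i \<in> Istar. finite_type A (dec_ext X \<tau> i)}"

definition s_tilde :: "int^'i^'i::finite \<Rightarrow> 'i set \<Rightarrow> ('i \<Rightarrow> 'i) \<Rightarrow> 'i \<Rightarrow> rat^'i \<Rightarrow> rat^'i" where
  "s_tilde A X \<tau> i = longest_elt A X \<circ> longest_elt A (dec_ext X \<tau> i)"

definition W_tilde ::
    "int^'i^'i::finite \<Rightarrow> 'i set \<Rightarrow> ('i \<Rightarrow> 'i) \<Rightarrow> 'i set \<Rightarrow> (rat^'i \<Rightarrow> rat^'i) monoid" where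
  "W_tilde A X \<tau> Istar =
     GL_V\<lparr>carrier := generate GL_V (s_tilde A X \<tau> ` I_tilde A X \<tau> Istar)\<rparr>"

definition length_tilde ::
    "int^'i^'i::finite \<Rightarrow> 'i set \<Rightarrow> ('i \<Rightarrow> 'i) \<Rightarrow> 'i set \<Rightarrow> (rat^'i \<Rightarrow> rat^'i) \<Rightarrow> nat" where
  "length_tilde A X \<tau> Istar =
     word_length (W_tilde A X \<tau> Istar) (I_tilde A X \<tau> Istar) (s_tilde A X \<tau>)"

end

theory Submission
  imports Defs "HOL-Algebra.Multiplicative_Group"
begin

text \<open>Write \<open>X[i]\<close> for \<open>X \<union> {i, \<tau> i}\<close>, \<open>w\<^sub>Y\<close> for the longest element of \<open>W\<^sub>Y\<close> and
  \<open>st i = w\<^sub>X w\<^bsub>X[i]\<^esub>\<close>.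

  Necessity. If the component of \<open>i = \<tau> i\<close> in \<open>X[i]\<close> has type \<open>A\<^sub>2\<close> with second vertex \<open>k \<in> X\<close>, the
  longest elements of the other components cancel and \<open>st i = s\<^sub>i s\<^sub>k\<close> has order 3
  (\<open>A2_not_involution\<close>), whereas the generators of a Coxeter system square to the identity.

  Sufficiency rests on \<open>rank_one_opposition\<close>: apart from the excluded diagrams the opposition involution of
  \<open>X[i]\<close> preserves \<open>{i, \<tau> i}\<close>, so that \<open>w\<^bsub>X[i]\<^esub>\<close> commutes with \<open>w\<^sub>X\<close>. This is proved without the
  classification of finite types. On the span of the roots of \<open>X[i]\<close> the isometry \<open>- w\<^sub>X \<tau>\<close> is the
  reflection in a vector \<open>\<omega>\<close>, and its conjugate under \<open>- w\<^bsub>X[i]\<^esub>\<close> is the reflection in another vector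
  \<open>\<omega>'\<close>. If the opposition involution moved \<open>i\<close> to \<open>k \<in> X\<close>, integrality and the Cauchy-Schwarz
  inequality would force \<open>\<tau> i = i\<close> and an angle of 60 degrees between \<open>\<omega>\<close> and \<open>\<omega>'\<close>. The product of the
  two reflections is an element of the Weyl group that maps \<open>\<alpha>\<^sub>k\<close> to \<open>\<alpha>\<^sub>i\<close>
  and fixes the other simple roots of \<open>X\<close>. As it must act trivially on weights modulo roots, \<open>i\<close> and \<open>k\<close> are adjacent, and the
  orthogonality of \<open>\<omega>\<close> to the roots of \<open>X\<close> leaves only type \<open>A\<^sub>2\<close>.

  Once the \<open>st i\<close> are involutions permuting the simple roots of \<open>X\<close>, each \<open>st i\<close> makes negative exactly the
  positive roots of \<open>X[i]\<close> outside the span of \<open>X\<close>, and every element of the restricted group is of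
  one sign on all of these roots (\<open>K_Pos\<close>, \<open>sign_change\<close>). Hence the sets of all \<open>w\<close> with
  \<open>w\<^sup>-\<^sup>1 \<alpha>\<^sub>i > 0\<close> behave like half-spaces: they contain the identity, \<open>st i\<close> takes their elements to
  their complements, and crossing their boundary amounts to multiplying by \<open>st i\<close> (\<open>wall\<close>). By a criterion
  of Tits such half-spaces imply the exchange condition, hence Matsumoto's theorem and the Coxeter presentation
  (\<open>coxeter_system_half_spaces\<close>). The same sign rule shows that left multiplication by \<open>st i\<close> adds
  \<open>\<ell> (st i)\<close> to \<open>\<ell>\<close> exactly when it adds 1 to the restricted length (\<open>wlen_st\<close>), which gives the
  comparison of lengths by induction (\<open>additive_iff_len_additive\<close>).

  Underneath lies the fact that every real root is positive or negative (\<open>Pos_of_wlen_le\<close>), so that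
  lengths count inversions and longest elements are characterized by their signs.\<close>

(* Words over J are handled through membership in lists J, not letter by letter. *)
declare in_listsD [rule del] in_listsI [rule del]

lemma rev_in_lists [simp]: "rev x \<in> lists J \<longleftrightarrow> x \<in> lists J"
  by (simp add: in_lists_conv_set)

lemma map_True_in_lists [simp]: "map (\<lambda>j. (j, True)) x \<in> lists (J \<times> UNIV) \<longleftrightarrow> x \<in> lists J"
  by (auto simp: in_lists_conv_set)

lemma map_fst_in_lists [simp]: "x \<in> lists (J \<times> UNIV) \<Longrightarrow> map fst x \<in> lists J"
  by (auto simp: in_lists_conv_set)

lemma concat_replicate_in_lists [simp]: "x \<in> lists J \<Longrightarrow> concat (replicate n x) \<in> lists J"
  by (induction n) auto

section \<open>Groups generated by involutions\<close>

locale involution_generated = group G for G (structure) +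
  fixes J :: "'j set" and s :: "'j \<Rightarrow> 'a"
  assumes gens_closed: "s ` J \<subseteq> carrier G"
    and invol: "j \<in> J \<Longrightarrow> s j \<otimes> s j = \<one>"
    and gens_generate: "generate G (s ` J) = carrier G"
begin

definition word_prod :: "'j list \<Rightarrow> 'a" where
  "word_prod x = foldr (\<otimes>) (map s x) \<one>"

abbreviation len :: "'a \<Rightarrow> nat" where
  "len \<equiv> word_length G J s"

lemma gen_closed [simp]: "j \<in> J \<Longrightarrow> s j \<in> carrier G"
  using gens_closed by auto

lemma word_prod_simps [simp]:
  "word_prod [] = \<one>" "word_prod (j # x) = s j \<otimes> word_prod x"
  by (simp_all add: word_prod_def)

lemma word_prod_closed [simp]: "x \<in> lists J \<Longrightarrow> word_prod x \<in> carrier G"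
  by (induction x) auto

lemma word_prod_append:
  "x \<in> lists J \<Longrightarrow> y \<in> lists J \<Longrightarrow> word_prod (x @ y) = word_prod x \<otimes> word_prod y"
  by (induction x) (auto simp: m_assoc)

lemma gen_inv: "j \<in> J \<Longrightarrow> inv (s j) = s j"
  using invol inv_equality gen_closed by metis

lemma gen_cancel: "j \<in> J \<Longrightarrow> g \<in> carrier G \<Longrightarrow> s j \<otimes> (s j \<otimes> g) = g"
  by (metis gen_closed invol l_one m_assoc)

lemma word_prod_rev: "x \<in> lists J \<Longrightarrow> word_prod (rev x) = inv (word_prod x)"
  by (induction x) (auto simp: word_prod_append inv_mult_group gen_inv)

lemma carrier_word_prod: "carrier G = word_prod ` lists J"
proof
  show "carrier G \<subseteq> word_prod ` lists J"
  proof
    fix g assume "g \<in> carrier G"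
    then have "g \<in> generate G (s ` J)" by (simp add: gens_generate)
    then show "g \<in> word_prod ` lists J"
    proof (induction rule: generate.induct)
      case one
      then show ?case by (auto intro!: image_eqI[of _ _ "[]"])
    next
      case (incl h)
      then obtain j where "j \<in> J" "h = s j" by auto
      then show ?case by (auto intro!: image_eqI[of _ _ "[j]"])
    next
      case (inv h)
      then obtain j where "j \<in> J" "h = s j" by auto
      then show ?case by (auto intro!: image_eqI[of _ _ "[j]"] simp: gen_inv)
    next
      case (eng h1 h2)
      then obtain x y where "x \<in> lists J" "y \<in> lists J" "h1 = word_prod x" "h2 = word_prod y"
        by auto
      then show ?case by (auto intro!: image_eqI[of _ _ "x @ y"] simp: word_prod_append)
    qed
  qed
qed auto

lemma len_word_prod_le: "x \<in> lists J \<Longrightarrow> len (word_prod x) \<le> length x"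
  unfolding word_length_def word_prod_def by (rule Least_le) auto

lemma obtain_reduced_word:
  assumes "g \<in> carrier G"
  obtains x where "x \<in> lists J" "word_prod x = g" "length x = len g"
proof -
  let ?Q = "\<lambda>n. \<exists>w \<in> lists J. length w = n \<and> foldr (\<otimes>) (map s w) \<one> = g"
  have "\<exists>n. ?Q n"
    using assms unfolding carrier_word_prod word_prod_def by auto
  then have "?Q (LEAST n. ?Q n)" by (rule LeastI_ex)
  then show thesis using that by (auto simp: word_length_def word_prod_def)
qed

lemma len_one [simp]: "len \<one> = 0"
  using len_word_prod_le[of "[]"] by simp

lemma len_mult_le:
  assumes "g \<in> carrier G" "h \<in> carrier G"
  shows "len (g \<otimes> h) \<le> len g + len h"
proof -
  obtain x where x: "x \<in> lists J" "word_prod x = g" "length x = len g"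
    using assms(1) by (rule obtain_reduced_word)
  obtain y where y: "y \<in> lists J" "word_prod y = h" "length y = len h"
    using assms(2) by (rule obtain_reduced_word)
  show ?thesis using len_word_prod_le[of "x @ y"] x y by (simp add: word_prod_append)
qed

lemma len_gen_le: "j \<in> J \<Longrightarrow> len (s j) \<le> 1"
  using len_word_prod_le[of "[j]"] by simp

lemma len_gen_mult_le: "j \<in> J \<Longrightarrow> g \<in> carrier G \<Longrightarrow> len (s j \<otimes> g) \<le> Suc (len g)"
  using len_mult_le[of "s j" g] len_gen_le[of j] by simp

lemma len_inv_le: "g \<in> carrier G \<Longrightarrow> len (inv g) \<le> len g"
proof -
  assume "g \<in> carrier G"
  then obtain x where "x \<in> lists J" "word_prod x = g" "length x = len g"
    by (rule obtain_reduced_word)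
  then show ?thesis using len_word_prod_le[of "rev x"] word_prod_rev[of x] by simp
qed

lemma len_inv: "g \<in> carrier G \<Longrightarrow> len (inv g) = len g"
  by (metis len_inv_le inv_inv inv_closed le_antisym)

lemma obtain_left_descent:
  assumes "g \<in> carrier G" "g \<noteq> \<one>"
  obtains j h where "j \<in> J" "h \<in> carrier G" "g = s j \<otimes> h" "len g = Suc (len h)"
proof -
  obtain x where x: "x \<in> lists J" "word_prod x = g" "length x = len g"
    using assms(1) by (rule obtain_reduced_word)
  with assms(2) obtain j y where y: "x = j # y" by (cases x) auto
  then have jy: "j \<in> J" "y \<in> lists J" using x by auto
  have "len (word_prod y) \<le> length y" using jy by (simp add: len_word_prod_le)
  moreover have "len g \<le> Suc (len (word_prod y))"
    using len_gen_mult_le[of j "word_prod y"] jy x y by auto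
  ultimately show thesis using that[of j "word_prod y"] x y jy by auto
qed

lemma obtain_right_descent:
  assumes "g \<in> carrier G" "g \<noteq> \<one>"
  obtains j h where "j \<in> J" "h \<in> carrier G" "g = h \<otimes> s j" "len g = Suc (len h)"
proof -
  have "inv g \<in> carrier G" "inv g \<noteq> \<one>" using assms by (auto simp: inv_eq_1_iff)
  then obtain j h where h: "j \<in> J" "h \<in> carrier G" "inv g = s j \<otimes> h" "len (inv g) = Suc (len h)"
    by (rule obtain_left_descent)
  have "g = inv (s j \<otimes> h)" using assms h by (metis inv_inv)
  then have "g = inv h \<otimes> s j" using h by (simp add: inv_mult_group gen_inv)
  moreover have "len g = Suc (len (inv h))"
    using h assms len_inv[of g] len_inv[of h] by metis
  ultimately show thesis using that[of j "inv h"] h by blast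
qed

lemma presentation_val:
  "x \<in> lists (J \<times> UNIV) \<Longrightarrow> gword_val G s x = word_prod (map fst x)"
  by (induction x) (auto simp: gen_inv)

end

section \<open>Alternating words\<close>

fun alt_word :: "'j \<Rightarrow> 'j \<Rightarrow> nat \<Rightarrow> 'j list" where
  "alt_word j k 0 = []"
| "alt_word j k (Suc n) = j # alt_word k j n"

lemma length_alt_word [simp]: "length (alt_word j k n) = n"
  by (induction j k n rule: alt_word.induct) auto

lemma alt_word_lists [simp]: "j \<in> J \<Longrightarrow> k \<in> J \<Longrightarrow> alt_word j k n \<in> lists J"
  by (induction j k n rule: alt_word.induct) auto

lemma alt_word_add:
  "alt_word j k (m + n) = alt_word j k m @ (if even m then alt_word j k n else alt_word k j n)"
  by (induction j k m rule: alt_word.induct) auto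

lemma Cons_concat_replicate:
  "j # concat (replicate n [k, j]) @ [k] = concat (replicate n [j, k]) @ [j, k]"
  by (induction n) auto

lemma concat_replicate_snoc: "concat (replicate n x) @ x = x @ concat (replicate n x)"
  by (induction n) auto

lemma alt_word_append_rev:
  "alt_word j k n @ rev (alt_word k j n) = concat (replicate n [j, k])"
proof (induction n arbitrary: j k)
  case (Suc n)
  have "alt_word j k (Suc n) @ rev (alt_word k j (Suc n)) =
        j # (alt_word k j n @ rev (alt_word j k n)) @ [k]" by simp
  also have "\<dots> = j # concat (replicate n [k, j]) @ [k]" using Suc by simp
  also have "\<dots> = concat (replicate (Suc n) [j, k])"
    by (simp only: Cons_concat_replicate concat_replicate_snoc) simp
  finally show ?case .
qed simp

section \<open>Words in a Coxeter presentation\<close>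

lemma pres_eq_cong:
  assumes "pres_eq J R u v" "a \<in> lists (J \<times> UNIV)" "b \<in> lists (J \<times> UNIV)"
  shows "pres_eq J R (a @ u @ b) (a @ v @ b)"
  using assms
proof (induction)
  case (refl w)
  then show ?case by (intro pres_eq.refl) auto
next
  case (sym v w)
  then show ?case by (blast intro: pres_eq.sym)
next
  case (trans u v w)
  then show ?case by (blast intro: pres_eq.trans)
next
  case (cancel u v j c)
  then show ?case using pres_eq.cancel[of "a @ u" J "v @ b" j R c] by simp
next
  case (rel u v r)
  then show ?case using pres_eq.rel[of "a @ u" J "v @ b" r R] by simp
qed

definition cox_eq :: "'j set \<Rightarrow> ('j \<Rightarrow> 'j \<Rightarrow> nat) \<Rightarrow> 'j list \<Rightarrow> 'j list \<Rightarrow> bool" where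
  "cox_eq J m x y \<longleftrightarrow>
     pres_eq J (coxeter_relators J m) (map (\<lambda>j. (j, True)) x) (map (\<lambda>j. (j, True)) y)"

lemma cox_eq_refl: "x \<in> lists J \<Longrightarrow> cox_eq J m x x"
  unfolding cox_eq_def by (intro pres_eq.refl) auto

lemma cox_eq_sym: "cox_eq J m x y \<Longrightarrow> cox_eq J m y x"
  unfolding cox_eq_def by (rule pres_eq.sym)

lemma cox_eq_trans [trans]: "cox_eq J m x y \<Longrightarrow> cox_eq J m y z \<Longrightarrow> cox_eq J m x z"
  unfolding cox_eq_def by (rule pres_eq.trans)

lemma cox_eq_cong:
  assumes "cox_eq J m x y" "a \<in> lists J" "b \<in> lists J"
  shows "cox_eq J m (a @ x @ b) (a @ y @ b)"
  using pres_eq_cong[OF assms(1)[unfolded cox_eq_def], of "map (\<lambda>j. (j, True)) a"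
      "map (\<lambda>j. (j, True)) b"] assms(2,3)
  unfolding cox_eq_def by auto

lemma cox_eq_relator:
  assumes "j \<in> J" "k \<in> J"
  shows "cox_eq J m (concat (replicate (m j k) [j, k])) []"
proof -
  let ?r = "concat (replicate (m j k) [(j, True), (k, True)])"
  have "?r \<in> coxeter_relators J m" using assms by (auto simp: coxeter_relators_def)
  moreover have "?r \<in> lists (J \<times> UNIV)" using assms by auto
  ultimately have "pres_eq J (coxeter_relators J m) ([] @ ?r @ []) ([] @ [])"
    by (intro pres_eq.rel) auto
  moreover have "map (\<lambda>j. (j, True)) (concat (replicate n [j, k])) =
      concat (replicate n [(j, True), (k, True)])" for n
    by (induction n) auto
  ultimately show ?thesis by (simp add: cox_eq_def)
qed

lemma cox_eq_relator_power:
  assumes "j \<in> J" "k \<in> J"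
  shows "cox_eq J m (concat (replicate (m j k * q) [j, k])) []"
proof (induction q)
  case 0
  then show ?case using cox_eq_refl[of "[]"] by simp
next
  case (Suc q)
  have l: "concat (replicate n [j, k]) \<in> lists J" for n using assms by (induction n) auto
  have "cox_eq J m ([] @ concat (replicate (m j k) [j, k]) @ concat (replicate (m j k * q) [j, k]))
     ([] @ [] @ concat (replicate (m j k * q) [j, k]))"
    by (intro cox_eq_cong cox_eq_relator l) (use assms in auto)
  then have "cox_eq J m (concat (replicate (m j k * Suc q) [j, k]))
      (concat (replicate (m j k * q) [j, k]))"
    by (simp add: replicate_add)
  then show ?case using Suc by (rule cox_eq_trans)
qed

lemma cox_eq_square:
  assumes "coxeter_matrix J m" "j \<in> J"
  shows "cox_eq J m [j, j] []"
proof -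
  have "m j j = 1" using assms by (auto simp: coxeter_matrix_def)
  then show ?thesis using cox_eq_relator[of j J j m] assms by simp
qed

lemma cox_eq_rev_append:
  assumes "coxeter_matrix J m" "x \<in> lists J"
  shows "cox_eq J m (rev x @ x) []"
  using assms(2)
proof (induction x)
  case Nil
  then show ?case using cox_eq_refl[of "[]"] by simp
next
  case (Cons j x)
  have "cox_eq J m (rev x @ [j, j] @ x) (rev x @ [] @ x)"
    using Cons assms(1) by (intro cox_eq_cong cox_eq_square) auto
  then show ?case using Cons by (auto intro: cox_eq_trans)
qed

text \<open>Multiplying the relator \<open>(j k)\<^sup>n\<close> on the right by the alternating word of length \<open>n\<close>
  starting with \<open>k\<close> cancels its second half.\<close>

lemma cox_eq_braid:
  assumes "coxeter_matrix J m" "j \<in> J" "k \<in> J" "m j k dvd n"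
  shows "cox_eq J m (alt_word j k n) (alt_word k j n)"
proof -
  let ?x = "alt_word j k n" and ?y = "alt_word k j n"
  have l: "?x \<in> lists J" "?y \<in> lists J" "rev ?y \<in> lists J"
    using assms by (auto simp: alt_word_lists)
  obtain q where "n = m j k * q" using assms(4) by auto
  then have *: "cox_eq J m (?x @ rev ?y) []"
    using cox_eq_relator_power[of j J k m q] assms by (simp add: alt_word_append_rev)
  have "cox_eq J m (?x @ (rev ?y @ ?y) @ []) (?x @ [] @ [])"
    using assms l by (intro cox_eq_cong cox_eq_rev_append) auto
  moreover have "cox_eq J m ([] @ (?x @ rev ?y) @ ?y) ([] @ [] @ ?y)"
    using * l by (intro cox_eq_cong) auto
  ultimately show ?thesis by (auto intro: cox_eq_trans cox_eq_sym)
qed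

text \<open>Every letter is its own inverse modulo the relators \<open>j j\<close>, so signs of letters may be dropped.\<close>

lemma pres_eq_drop_signs:
  assumes "coxeter_matrix J m" "w \<in> lists (J \<times> UNIV)"
  shows "pres_eq J (coxeter_relators J m) w (map (\<lambda>j. (j, True)) (map fst w))"
  using assms(2)
proof (induction w)
  case Nil
  then show ?case by (auto intro: pres_eq.refl)
next
  case (Cons p w)
  let ?R = "coxeter_relators J m"
  let ?t = "map (\<lambda>j. (j, True)) (map fst w)"
  obtain j b where p: "p = (j, b)" by force
  have j: "j \<in> J" and w: "w \<in> lists (J \<times> UNIV)" using Cons p by auto
  have jj: "pres_eq J ?R [(j, True), (j, True)] []"
    using cox_eq_square[OF assms(1) j] by (simp add: cox_eq_def)
  have *: "pres_eq J ?R [(j, b)] [(j, True)]"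
  proof (cases b)
    case True
    then show ?thesis using j by (auto intro: pres_eq.refl)
  next
    case False
    have 1: "pres_eq J ?R ([(j, False)] @ [(j, True), (j, True)] @ []) ([(j, False)] @ [] @ [])"
      using jj j by (intro pres_eq_cong) auto
    have 2: "pres_eq J ?R ([] @ [(j, False), (j, \<not> False)] @ [(j, True)]) ([] @ [(j, True)])"
      using j by (intro pres_eq.cancel) auto
    show ?thesis using 1 2 False by (auto intro: pres_eq.trans pres_eq.sym)
  qed
  have "pres_eq J ?R ([] @ [(j, b)] @ w) ([] @ [(j, True)] @ w)"
    using * w by (intro pres_eq_cong) auto
  moreover have "pres_eq J ?R ([(j, True)] @ w @ []) ([(j, True)] @ ?t @ [])"
    using Cons w j by (intro pres_eq_cong) auto
  ultimately show ?case using p by (auto intro: pres_eq.trans)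
qed

lemma coxeter_system_square:
  assumes "coxeter_system G J s" "j \<in> J"
  shows "s j \<otimes>\<^bsub>G\<^esub> s j = \<one>\<^bsub>G\<^esub>"
proof -
  obtain m where m: "coxeter_matrix J m" "has_presentation G J s (coxeter_relators J m)"
    using assms(1) by (auto simp: coxeter_system_def)
  then interpret group G by (simp add: has_presentation_def)
  have "pres_eq J (coxeter_relators J m) [(j, True), (j, True)] []"
    using cox_eq_square[OF m(1) assms(2)] by (simp add: cox_eq_def)
  moreover have "[(j, True), (j, True)] \<in> lists (J \<times> UNIV)" using assms(2) by simp
  ultimately have "gword_val G s [(j, True), (j, True)] = \<one>\<^bsub>G\<^esub>"
    using m(2) unfolding has_presentation_def by blast
  moreover have "s j \<in> carrier G" using m(2) assms(2) by (auto simp: has_presentation_def)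
  ultimately show ?thesis by simp
qed

section \<open>Half-spaces and the exchange condition\<close>

text \<open>The model for \<open>P j g\<close> is that \<open>g\<^sup>-\<^sup>1\<close> maps the simple root of \<open>j\<close> to a positive root: the chamber of
  \<open>g\<close> lies on the same side of the wall of \<open>j\<close> as the fundamental chamber. The last axiom says that
  \<open>s\<^sub>j\<close> interchanges two adjacent chambers that this wall separates.\<close>

locale half_space_system = involution_generated +
  fixes P :: "'c \<Rightarrow> 'a \<Rightarrow> bool"
  assumes gens_inj: "inj_on s J"
    and half_space_one: "j \<in> J \<Longrightarrow> P j \<one>"
    and half_space_flip: "j \<in> J \<Longrightarrow> g \<in> carrier G \<Longrightarrow> P j g \<Longrightarrow> \<not> P j (s j \<otimes> g)"
    and half_space_wall: "j \<in> J \<Longrightarrow> k \<in> J \<Longrightarrow> g \<in> carrier G \<Longrightarrow> P j g \<Longrightarrow> \<not> P j (g \<otimes> s k)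
        \<Longrightarrow> s j \<otimes> g = g \<otimes> s k"
begin

text \<open>A gallery from \<open>\<one>\<close> to an element outside the half-space of \<open>j\<close> must cross the wall of \<open>j\<close>;
  the letter at the crossing is the one that can be exchanged.\<close>

lemma exchange:
  assumes "x \<in> lists J" "j \<in> J" "\<not> P j (word_prod x)"
  shows "\<exists>y k z. x = y @ k # z \<and> s j \<otimes> word_prod y = word_prod y \<otimes> s k"
  using assms
proof (induction x rule: rev_induct)
  case Nil
  then show ?case by (simp add: half_space_one)
next
  case (snoc k x)
  show ?case
  proof (cases "P j (word_prod x)")
    case True
    then have "s j \<otimes> word_prod x = word_prod x \<otimes> s k"
      using snoc by (intro half_space_wall) (auto simp: word_prod_append)
    then show ?thesis by blast
  next
    case False
    then obtain y k' z where "x = y @ k' # z" "s j \<otimes> word_prod y = word_prod y \<otimes> s k'"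
      using snoc by auto
    then show ?thesis by (intro exI[of _ y] exI[of _ k'] exI[of _ "z @ [k]"]) simp
  qed
qed

lemma exchange_word_prod:
  assumes "y \<in> lists J" "z \<in> lists J" "k \<in> J" "j \<in> J"
    and "s j \<otimes> word_prod y = word_prod y \<otimes> s k"
  shows "word_prod (j # y @ z) = word_prod (y @ k # z)"
  using assms by (simp add: word_prod_append m_assoc[symmetric])

text \<open>The word with the exchanged letter deleted represents \<open>s\<^sub>j g\<close>.\<close>

lemma outside_half_space_len:
  assumes "j \<in> J" "g \<in> carrier G" "\<not> P j g"
  shows "len g = Suc (len (s j \<otimes> g))"
proof -
  obtain x where x: "x \<in> lists J" "word_prod x = g" "length x = len g"
    using assms(2) by (rule obtain_reduced_word)
  then obtain y k z where y: "x = y @ k # z" "s j \<otimes> word_prod y = word_prod y \<otimes> s k"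
    using exchange[of x j] assms by auto
  then have l: "y \<in> lists J" "z \<in> lists J" "k \<in> J" using x by auto
  have "s j \<otimes> word_prod (y @ z) = g"
    using exchange_word_prod[OF l assms(1) y(2)] x y by simp
  then have "s j \<otimes> g = word_prod (y @ z)" using gen_cancel assms(1) l by auto
  then have "len (s j \<otimes> g) \<le> length (y @ z)"
    using len_word_prod_le[of "y @ z"] l by simp
  moreover have "len g \<le> Suc (len (s j \<otimes> g))"
    using len_gen_mult_le[of j "s j \<otimes> g"] assms gen_cancel by simp
  ultimately show ?thesis using x y by auto
qed

lemma half_space_iff_len:
  assumes "j \<in> J" "g \<in> carrier G"
  shows "P j g \<longleftrightarrow> len (s j \<otimes> g) = Suc (len g)"
proof
  assume "P j g"
  then have "\<not> P j (s j \<otimes> g)" using half_space_flip assms by blast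
  then have "len (s j \<otimes> g) = Suc (len (s j \<otimes> (s j \<otimes> g)))"
    using outside_half_space_len[of j "s j \<otimes> g"] assms by simp
  then show "len (s j \<otimes> g) = Suc (len g)" using gen_cancel assms by simp
next
  assume "len (s j \<otimes> g) = Suc (len g)"
  then show "P j g" using outside_half_space_len[of j g] assms by fastforce
qed

text \<open>If the element \<open>g\<close> can be shortened from the left by both \<open>j\<close> and \<open>k\<close>, exchange lengthens the alternating
  prefix of a reduced word of \<open>g\<close> until both alternating words in \<open>j\<close> and \<open>k\<close> have the same product.\<close>

lemma common_alternating_prefix:
  assumes jk: "j \<in> J" "k \<in> J" "j \<noteq> k" and g: "g \<in> carrier G" "\<not> P j g" "\<not> P k g"
  obtains n c where "n > 0" "c \<in> lists J" "word_prod (alt_word j k n) = word_prod (alt_word k j n)"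
    "word_prod (alt_word j k n @ c) = g" "n + length c = len g"
proof -
  define Q where "Q n \<longleftrightarrow> (\<exists>a b c. {a, b} = {j, k} \<and> c \<in> lists J \<and> n + length c = len g \<and>
     word_prod (alt_word a b n @ c) = g)" for n
  obtain x where "x \<in> lists J" "word_prod x = g" "length x = len g"
    using g(1) by (rule obtain_reduced_word)
  then have "Q 0" unfolding Q_def by (intro exI[of _ j] exI[of _ k] exI[of _ x]) simp
  moreover have bound: "\<forall>n. Q n \<longrightarrow> n \<le> len g" by (auto simp: Q_def)
  ultimately obtain n where n: "Q n" "\<And>n'. Q n' \<Longrightarrow> n' \<le> n"
    using Greatest_le_nat[of Q _ "len g"] GreatestI_nat[of Q 0 "len g"] by metis
  then obtain a b c where abc: "{a, b} = {j, k}" "c \<in> lists J" "n + length c = len g"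
     "word_prod (alt_word a b n @ c) = g" by (auto simp: Q_def)
  have ab: "a \<in> J" "b \<in> J" "a \<noteq> b" "\<not> P b g" using abc(1) jk g by (auto simp: doubleton_eq_iff)
  have altJ: "alt_word a b i \<in> lists J" "alt_word b a i \<in> lists J" for i
    using ab by (auto simp: alt_word_lists)
  obtain y l z where ylz: "alt_word a b n @ c = y @ l # z"
      "s b \<otimes> word_prod y = word_prod y \<otimes> s l"
    using exchange[of "alt_word a b n @ c" b] abc ab altJ by auto
  have "y @ l # z \<in> lists J" using ylz altJ abc by (metis append_in_lists_conv)
  then have l: "y \<in> lists J" "z \<in> lists J" "l \<in> J" by auto
  have gval: "word_prod (b # y @ z) = g"
    using exchange_word_prod[OF l ab(2) ylz(2)] ylz(1) abc(4) by simp
  have len: "length (b # y @ z) = len g"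
    using arg_cong[OF ylz(1), of length] abc(3) by simp
  define p where "p = length y"
  have yz: "y = take p (alt_word a b n @ c)" "z = drop (Suc p) (alt_word a b n @ c)"
    "l = (alt_word a b n @ c) ! p"
    using ylz(1) by (simp_all add: p_def)
  consider "p \<ge> n" | "Suc p = n" | "Suc p < n" by linarith
  then show thesis
  proof cases
    case 1
    define c' where "c' = take (p - n) c @ drop (Suc p - n) c"
    have split: "b # y @ z = alt_word b a (Suc n) @ c'"
      using 1 by (simp add: yz c'_def)
    have "set c' \<subseteq> set c"
      unfolding c'_def by (auto dest: in_set_takeD in_set_dropD)
    then have "c' \<in> lists J"
      using abc(2) unfolding in_lists_conv_set by blast
    moreover have "Suc n + length c' = len g" using len unfolding split by simp
    moreover have "word_prod (alt_word b a (Suc n) @ c') = g" using gval unfolding split .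
    moreover have "{b, a} = {j, k}" using abc(1) by blast
    ultimately have "Q (Suc n)" unfolding Q_def by blast
    then show thesis using n(2)[of "Suc n"] by simp
  next
    case 2
    have ab_split: "alt_word a b n = alt_word a b p @ [if even p then a else b]"
      using 2 alt_word_add[of a b p 1] by simp
    then have y: "y = alt_word a b p" unfolding yz(1) by simp
    have "alt_word a b n @ c = alt_word a b p @ l # z" using ylz(1) y by simp
    then have yl: "alt_word a b n = y @ [l]" unfolding ab_split y by simp
    have "word_prod (alt_word b a n) = word_prod (b # y)" unfolding y 2[symmetric] by simp
    also have "\<dots> = word_prod (y @ [l])" using ylz(2) l by (simp add: word_prod_append)
    finally have eq: "word_prod (alt_word b a n) = word_prod (alt_word a b n)" using yl by simp
    have "word_prod (alt_word b a n @ c) = g"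
      using eq abc altJ by (simp add: word_prod_append)
    moreover have "a = j \<and> b = k \<or> a = k \<and> b = j" using abc(1) by (auto simp: doubleton_eq_iff)
    ultimately show thesis using that[of n c] abc eq 2 by auto
  next
    case 3
    \<comment> \<open>Deleting an inner letter of an alternating word makes two equal letters adjacent.\<close>
    define q where "q = n - Suc (Suc p)"
    have nq: "n = p + Suc (Suc q)" using 3 by (simp add: q_def)
    define d where "d = (if even p then b else a)"
    define d' where "d' = (if even p then a else b)"
    have ab_split: "alt_word a b n = alt_word a b p @ d' # d # alt_word d' d q"
      unfolding nq alt_word_add d_def d'_def by simp
    then have y: "y = alt_word a b p" unfolding yz(1) by simp
    have z: "z = d # alt_word d' d q @ c"
      using ylz(1) unfolding ab_split y by auto
    have d: "d \<in> J" "d' \<in> J" using ab by (auto simp: d_def d'_def)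
    have "b # y = alt_word b a (Suc p)" using y by simp
    also have "\<dots> = alt_word b a p @ [d]"
      using alt_word_add[of b a p 1] by (simp add: d_def)
    finally have "b # y @ z = alt_word b a p @ d # d # alt_word d' d q @ c" using z
      by (metis append.assoc append_Cons append_Nil)
    then have "g = word_prod (alt_word b a p @ alt_word d' d q @ c)"
      using gval altJ d abc by (simp add: word_prod_append gen_cancel alt_word_lists)
    then have "len g \<le> p + q + length c"
      using len_word_prod_le[of "alt_word b a p @ alt_word d' d q @ c"] altJ d abc
      by (simp add: alt_word_lists)
    then show thesis using abc(3) nq by simp
  qed
qed

definition cox_order :: "'c \<Rightarrow> 'c \<Rightarrow> nat" where
  "cox_order j k = ord (s j \<otimes> s k)"

lemma cox_order_matrix: "coxeter_matrix J cox_order"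
  unfolding coxeter_matrix_def
proof (intro ballI conjI)
  fix j k assume jk: "j \<in> J" "k \<in> J"
  have "inv (s j \<otimes> s k) = s k \<otimes> s j" using jk by (simp add: inv_mult_group gen_inv)
  then show "cox_order j k = cox_order k j"
    using jk ord_inv[of "s j \<otimes> s k"] by (simp add: cox_order_def)
  have "ord (s j \<otimes> s k) = 1 \<longleftrightarrow> s j \<otimes> s k = \<one>" using jk ord_eq_1[of "s j \<otimes> s k"] by simp
  also have "\<dots> \<longleftrightarrow> s j = s k"
    using jk by (metis gen_closed gen_inv inv_equality inv_inv invol)
  also have "\<dots> \<longleftrightarrow> j = k" using gens_inj jk by (auto dest: inj_onD)
  finally show "(cox_order j k = 1) = (j = k)" by (simp add: cox_order_def)
qed

lemma word_prod_replicate: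
  "j \<in> J \<Longrightarrow> k \<in> J \<Longrightarrow> word_prod (concat (replicate n [j, k])) = (s j \<otimes> s k) [^] n"
proof (induction n)
  case (Suc n)
  then have l: "concat (replicate n [j, k]) \<in> lists J" by auto
  have "word_prod (concat (replicate (Suc n) [j, k])) =
     (s j \<otimes> s k) \<otimes> (s j \<otimes> s k) [^] n"
    using Suc l by (simp add: m_assoc)
  then show ?case using Suc by (metis gen_closed m_closed nat_pow_Suc2)
qed simp

lemma cox_order_dvd:
  assumes "j \<in> J" "k \<in> J" "word_prod (alt_word j k n) = word_prod (alt_word k j n)"
  shows "cox_order j k dvd n"
proof -
  have l: "alt_word j k n \<in> lists J" "alt_word k j n \<in> lists J"
    using assms by (auto simp: alt_word_lists)
  have "(s j \<otimes> s k) [^] n = word_prod (alt_word j k n @ rev (alt_word k j n))"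
    using assms by (simp add: alt_word_append_rev word_prod_replicate)
  also have "\<dots> = \<one>" using assms l by (simp add: word_prod_append word_prod_rev)
  finally show ?thesis using assms pow_eq_id[of "s j \<otimes> s k" n] by (simp add: cox_order_def)
qed

text \<open>Matsumoto's theorem. For reduced words with different first letters \<open>j\<close> and \<open>k\<close>, each is compared, by
  induction on the tails, with a reduced word that starts with a long alternating word in \<open>j\<close> and
  \<open>k\<close>; those two words differ by a braid relation.\<close>

lemma reduced_words_cox_eq:
  assumes "x \<in> lists J" "y \<in> lists J" "word_prod x = word_prod y"
    "length x = len (word_prod x)" "length y = len (word_prod y)"
  shows "cox_eq J cox_order x y"
  using assms
proof (induction "length x" arbitrary: x y rule: less_induct)
  case less
  have reduced_tl: "length a = len (word_prod a)"
    if "j # a \<in> lists J" "length (j # a) = len (word_prod (j # a))" for j a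
  proof -
    have "len (word_prod (j # a)) \<le> Suc (len (word_prod a))"
      using that len_gen_mult_le[of j "word_prod a"] by auto
    then show ?thesis using that len_word_prod_le[of a] by auto
  qed
  \<comment> \<open>Reduced words with a common first letter: apply the induction hypothesis to the tails.\<close>
  have same_hd: "cox_eq J cox_order (j # a) (j # b)"
    if ab: "j # a \<in> lists J" "j # b \<in> lists J" "word_prod (j # a) = word_prod (j # b)"
      "length (j # a) = length x" "length (j # b) = length x"
      "word_prod (j # a) = word_prod x" for j a b
  proof -
    have l: "j \<in> J" "a \<in> lists J" "b \<in> lists J" using ab by auto
    have ra: "length (j # a) = len (word_prod (j # a))" "length (j # b) = len (word_prod (j # b))"
      using ab less.prems by auto
    have "word_prod a = word_prod b"
      using ab(3) l by (metis gen_cancel word_prod_closed word_prod_simps(2))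
    moreover have "length a < length x" using ab by auto
    ultimately have "cox_eq J cox_order a b"
      using less.hyps[of a b] l reduced_tl[OF ab(1) ra(1)] reduced_tl[OF ab(2) ra(2)] by auto
    then have "cox_eq J cox_order ([j] @ a @ []) ([j] @ b @ [])"
      using l by (intro cox_eq_cong) auto
    then show ?thesis by simp
  qed
  have len_eq: "length x = length y" using less.prems by simp
  show ?case
  proof (cases x)
    case Nil
    then show ?thesis using len_eq cox_eq_refl[of "[]" J] by simp
  next
    case (Cons j a)
    with len_eq obtain k b where y: "y = k # b" by (cases y) auto
    have lj: "j \<in> J" "a \<in> lists J" and lk: "k \<in> J" "b \<in> lists J" using less.prems Cons y by auto
    show ?thesis
    proof (cases "j = k")
      case True
      then show ?thesis using same_hd[of j a b] less.prems Cons y by auto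
    next
      case False
      define g where "g = word_prod x"
      have g: "g \<in> carrier G" using less.prems by (simp add: g_def)
      have sj: "s j \<otimes> g = word_prod a" using Cons lj gen_cancel by (simp add: g_def)
      have sk: "s k \<otimes> g = word_prod b" using y lk less.prems gen_cancel by (simp add: g_def)
      have "\<not> P j g" using half_space_iff_len[of j g] lj g sj less.prems Cons
          len_word_prod_le[of a] by (auto simp: g_def)
      moreover have "\<not> P k g" using half_space_iff_len[of k g] lk g sk less.prems y
          len_word_prod_le[of b] by (auto simp: g_def)
      ultimately obtain n c where n: "n > 0" "c \<in> lists J"
         "word_prod (alt_word j k n) = word_prod (alt_word k j n)"
         "word_prod (alt_word j k n @ c) = g" "n + length c = len g"
        using common_alternating_prefix[of j k g] lj lk False g by metis
      have altJ: "alt_word j k i \<in> lists J" "alt_word k j i \<in> lists J" for i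
        using lj lk by (auto simp: alt_word_lists)
      obtain n' where n': "n = Suc n'" using n(1) by (cases n) auto
      have g2: "word_prod (alt_word k j n @ c) = g"
        using n altJ by (simp add: word_prod_append)
      have "cox_eq J cox_order (j # a) (j # alt_word k j n' @ c)"
        using n n' altJ less.prems Cons lj by (intro same_hd) (auto simp: g_def)
      moreover have "cox_eq J cox_order ([] @ alt_word j k n @ c) ([] @ alt_word k j n @ c)"
        using n lj lk by (intro cox_eq_cong cox_eq_braid cox_order_matrix cox_order_dvd) auto
      moreover have "cox_eq J cox_order (k # alt_word j k n' @ c) (k # b)"
        using n n' g2 altJ less.prems y lk by (intro same_hd) (auto simp: g_def)
      ultimately show ?thesis unfolding Cons y n' by (auto intro: cox_eq_trans)
    qed
  qed
qed

text \<open>If a letter put in front of a reduced word shortens the product, Matsumoto's theorem lets the word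
  start with that letter, and the two copies cancel.\<close>

lemma cox_eq_reduced_word:
  assumes "x \<in> lists J"
  shows "\<exists>y. y \<in> lists J \<and> word_prod y = word_prod x \<and> length y = len (word_prod x) \<and>
    cox_eq J cox_order x y"
  using assms
proof (induction x)
  case Nil
  then show ?case by (auto intro!: exI[of _ "[]"] cox_eq_refl)
next
  case (Cons j x)
  then obtain y where y: "y \<in> lists J" "word_prod y = word_prod x" "length y = len (word_prod x)"
      "cox_eq J cox_order x y" by auto
  have j: "j \<in> J" and x: "x \<in> lists J" using Cons by auto
  have "cox_eq J cox_order ([j] @ x @ []) ([j] @ y @ [])"
    using y j by (intro cox_eq_cong) auto
  then have jy: "cox_eq J cox_order (j # x) (j # y)" by simp
  show ?case
  proof (cases "P j (word_prod x)")
    case True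
    then have "len (word_prod (j # x)) = length (j # y)"
      using half_space_iff_len[of j "word_prod x"] j x y by simp
    then show ?thesis using jy y j by (intro exI[of _ "j # y"]) auto
  next
    case False
    define h where "h = s j \<otimes> word_prod x"
    have h: "h \<in> carrier G" using j x by (simp add: h_def)
    obtain z where z: "z \<in> lists J" "word_prod z = h" "length z = len h"
      using h by (rule obtain_reduced_word)
    have yz: "word_prod y = word_prod (j # z)" using z y j x by (simp add: h_def gen_cancel)
    have "length y = length (j # z)"
      using outside_half_space_len[of j "word_prod x"] False j x y z by (simp add: h_def)
    then have "cox_eq J cox_order y (j # z)"
      using y z j yz by (intro reduced_words_cox_eq) auto
    then have "cox_eq J cox_order ([j] @ y @ []) ([j] @ (j # z) @ [])"
      using j by (intro cox_eq_cong) auto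
    moreover have "cox_eq J cox_order ([] @ [j, j] @ z) ([] @ [] @ z)"
      using j z by (intro cox_eq_cong cox_eq_square cox_order_matrix) auto
    ultimately have "cox_eq J cox_order (j # x) z" using jy by (auto intro: cox_eq_trans)
    then show ?thesis using z by (intro exI[of _ z]) (auto simp: h_def)
  qed
qed

text \<open>A word with product \<open>\<one>\<close> is equivalent to a reduced one, which must be empty.\<close>

theorem coxeter_system_half_spaces: "coxeter_system G J s"
  unfolding coxeter_system_def has_presentation_def
proof (intro exI conjI ballI)
  show "coxeter_matrix J cox_order" by (rule cox_order_matrix)
  show "group G" by (rule is_group)
  show "s ` J \<subseteq> carrier G" by (rule gens_closed)
  show "generate G (s ` J) = carrier G" by (rule gens_generate)
  fix w :: "'c gword" assume w: "w \<in> lists (J \<times> UNIV)"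
  let ?R = "coxeter_relators J cox_order"
  have fst: "map fst w \<in> lists J" using w by (induction w) auto
  show "gword_val G s w = \<one> \<longleftrightarrow> pres_eq J ?R w []"
  proof
    assume "gword_val G s w = \<one>"
    then have "word_prod (map fst w) = \<one>" using presentation_val w by simp
    then have "cox_eq J cox_order (map fst w) []"
      using cox_eq_reduced_word[OF fst] by auto
    then show "pres_eq J ?R w []"
      using pres_eq_drop_signs[OF cox_order_matrix w] by (auto simp: cox_eq_def intro: pres_eq.trans)
  next
    assume pe: "pres_eq J ?R w []"
    have inv_eq: "gword_val G s u = gword_val G s v" if "pres_eq J ?R u v" for u v
      using that
    proof (induction)
      case (cancel u v j b)
      then have "map fst u \<in> lists J" "map fst v \<in> lists J" by (auto simp: in_lists_conv_set)
      then show ?case using cancel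
        by (subst (1 2) presentation_val) (auto simp: word_prod_append gen_cancel)
    next
      case (rel u v r)
      then have l: "map fst u \<in> lists J" "map fst v \<in> lists J" "map fst r \<in> lists J"
        by (auto simp: in_lists_conv_set)
      obtain j k where jk: "j \<in> J" "k \<in> J"
        "r = concat (replicate (cox_order j k) [(j, True), (k, True)])"
        using rel by (auto simp: coxeter_relators_def)
      have "map fst (concat (replicate n [(j, True), (k, True)])) = concat (replicate n [j, k])" for n
        by (induction n) auto
      then have "word_prod (map fst r) = \<one>"
        using jk by (simp add: word_prod_replicate cox_order_def)
      then show ?case using rel l
        by (subst (1 2) presentation_val) (auto simp: word_prod_append)
    qed auto
    from inv_eq[OF pe] show "gword_val G s w = \<one>" by simp
  qed
qed

end

section \<open>Additivity of two length functions\<close>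

text \<open>Letters are peeled off a reduced word of the left factor. As both lengths are subadditive, additivity for
  the whole product forces additivity at every letter, where the two notions agree.\<close>

lemma (in involution_generated) additive_iff_len_additive:
  fixes l :: "'a \<Rightarrow> nat"
  assumes sub: "\<And>g h. g \<in> carrier G \<Longrightarrow> h \<in> carrier G \<Longrightarrow> l (g \<otimes> h) \<le> l g + l h"
    and one: "l \<one> = 0"
    and gen: "\<And>j g. j \<in> J \<Longrightarrow> g \<in> carrier G \<Longrightarrow>
        l (s j \<otimes> g) = l (s j) + l g \<longleftrightarrow> len (s j \<otimes> g) = Suc (len g)"
    and "g \<in> carrier G" and h: "h \<in> carrier G"
  shows "len (g \<otimes> h) = len g + len h \<longleftrightarrow> l (g \<otimes> h) = l g + l h"
  using assms(4)
proof (induction "len g" arbitrary: g)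
  case 0
  then have "g = \<one>" by (metis obtain_left_descent nat.distinct(1))
  then show ?case using h one by simp
next
  case (Suc n)
  then have "g \<noteq> \<one>" by auto
  then obtain j g' where g': "j \<in> J" "g' \<in> carrier G" "g = s j \<otimes> g'" "len g = Suc (len g')"
    using Suc.prems obtain_left_descent by metis
  have IH: "len (g' \<otimes> h) = len g' + len h \<longleftrightarrow> l (g' \<otimes> h) = l g' + l h"
    using Suc.hyps g' by simp
  have gh: "g \<otimes> h = s j \<otimes> (g' \<otimes> h)" using g' h by (simp add: m_assoc)
  have lg: "l g = l (s j) + l g'" using gen[of j g'] g' by simp
  note le = len_gen_mult_le[of j "g' \<otimes> h"] len_mult_le[of g' h] sub[of "s j" "g' \<otimes> h"] sub[of g' h]
  show ?case using IH gen[of j "g' \<otimes> h"] le g' h lg unfolding gh by auto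
qed

abbreviation finv :: "('a \<Rightarrow> 'b) \<Rightarrow> 'b \<Rightarrow> 'a" where "finv \<equiv> inv_into UNIV"

section \<open>Linear maps on the root space\<close>

lemma involution_generated_GL_V:
  assumes "s ` J \<subseteq> carrier (GL_V :: (rat^'i::finite \<Rightarrow> rat^'i) monoid)"
    and "\<And>j. j \<in> J \<Longrightarrow> s j \<circ> s j = id"
  shows "involution_generated (GL_V\<lparr>carrier := generate GL_V (s ` J)\<rparr>) J s"
proof -
  interpret GL: group "GL_V :: (rat^'i \<Rightarrow> rat^'i) monoid" by (rule group_GL_V)
  have sub: "subgroup (generate GL_V (s ` J)) GL_V"
    using assms(1) by (rule GL.generate_is_subgroup)
  have inc: "s ` J \<subseteq> generate GL_V (s ` J)" by (auto intro: generate.incl)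
  interpret H: group "GL_V\<lparr>carrier := generate GL_V (s ` J)\<rparr>"
    using sub by (rule subgroup.subgroup_is_group) (rule group_GL_V)
  show ?thesis
  proof
    show "generate (GL_V\<lparr>carrier := generate GL_V (s ` J)\<rparr>) (s ` J) =
        carrier (GL_V\<lparr>carrier := generate GL_V (s ` J)\<rparr>)"
      using GL.generate_consistent[OF inc sub] by simp
  qed (use inc assms(2) in \<open>auto simp: GL_V_def\<close>)
qed

definition lin :: "(rat^'i::finite \<Rightarrow> rat^'i) \<Rightarrow> bool" where
  "lin f \<longleftrightarrow> (\<forall>u v. f (u + v) = f u + f v) \<and> (\<forall>c v. f (c *s v) = c *s f v)"

lemma lin_GL_V: "f \<in> carrier GL_V \<Longrightarrow> lin f"
  by (simp add: GL_V_def lin_def Vector_Spaces.linear_iff)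

lemma lin_add: "lin f \<Longrightarrow> f (u + v) = f u + f v" by (simp add: lin_def)
lemma lin_scale: "lin f \<Longrightarrow> f (c *s v) = c *s f v" by (simp add: lin_def)
lemma lin_zero: "lin f \<Longrightarrow> f 0 = 0" using lin_scale[of f 0 0] by simp
lemma lin_minus: "lin f \<Longrightarrow> f (- v) = - f v" using lin_scale[of f "-1" v] by simp
lemma lin_diff: "lin f \<Longrightarrow> f (u - v) = f u - f v"
  using lin_add[of f u "- v"] by (simp add: lin_minus)
lemma lin_sum: "lin f \<Longrightarrow> f (\<Sum>j\<in>S. g j) = (\<Sum>j\<in>S. f (g j))"
  by (induction S rule: infinite_finite_induct) (auto simp: lin_zero lin_add)
lemma lin_uminus: "lin f \<Longrightarrow> lin (\<lambda>v. - f v)"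
  by (simp add: lin_def vec_eq_iff)
lemmas lin_simps = lin_add lin_scale lin_zero lin_minus lin_diff

abbreviation \<alpha> :: "'i::finite \<Rightarrow> rat^'i" where "\<alpha> \<equiv> simple_root"

lemma simple_root_nth: "\<alpha> i $ j = (if i = j then 1 else 0)"
  by (simp add: simple_root_def axis_def)

lemma simple_root_inj [simp]: "\<alpha> i = \<alpha> j \<longleftrightarrow> i = j"
  by (metis simple_root_nth zero_neq_one)

lemma root_expansion: "v = (\<Sum>j\<in>UNIV. v $ j *s \<alpha> j)"
  by (simp add: simple_root_def basis_expansion)

lemma lin_expansion: "lin f \<Longrightarrow> f v = (\<Sum>j\<in>UNIV. v $ j *s f (\<alpha> j))"
  by (subst root_expansion[of v]) (simp add: lin_sum lin_scale)

lemma lin_nth: "lin f \<Longrightarrow> f v $ k = (\<Sum>j\<in>UNIV. v $ j * f (\<alpha> j) $ k)"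
  by (subst lin_expansion) (simp_all add: sum_component)

lemma lin_eqI:
  assumes "lin f" "lin g" "\<And>j. v $ j \<noteq> 0 \<Longrightarrow> f (\<alpha> j) = g (\<alpha> j)"
  shows "f v = g v"
proof -
  have "f v = (\<Sum>j\<in>UNIV. v $ j *s f (\<alpha> j))" using assms(1) by (rule lin_expansion)
  also have "\<dots> = (\<Sum>j\<in>UNIV. v $ j *s g (\<alpha> j))"
  proof (rule sum.cong[OF HOL.refl])
    fix j
    show "v $ j *s f (\<alpha> j) = v $ j *s g (\<alpha> j)" using assms(3)[of j] by (cases "v $ j = 0") auto
  qed
  also have "\<dots> = g v" using assms(2) by (rule lin_expansion[symmetric])
  finally show ?thesis .
qed

definition Pos :: "rat^'i::finite \<Rightarrow> bool" where
  "Pos v \<longleftrightarrow> (\<forall>j. 0 \<le> v $ j)"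

definition supported :: "'i::finite set \<Rightarrow> rat^'i \<Rightarrow> bool" where
  "supported Y v \<longleftrightarrow> (\<forall>j. j \<notin> Y \<longrightarrow> v $ j = 0)"

lemma Pos_nth: "Pos v \<Longrightarrow> 0 \<le> v $ j" by (simp add: Pos_def)
lemma Pos_simple_root [simp]: "Pos (\<alpha> i)" by (simp add: Pos_def simple_root_nth)
lemma not_Pos_uminus_simple_root [simp]: "\<not> Pos (- \<alpha> i)"
  by (auto simp: Pos_def simple_root_nth intro!: exI[of _ i])
lemma Pos_add: "Pos u \<Longrightarrow> Pos v \<Longrightarrow> Pos (u + v)" by (simp add: Pos_def)
lemma Pos_scale: "0 \<le> c \<Longrightarrow> Pos v \<Longrightarrow> Pos (c *s v)" by (simp add: Pos_def)
lemma Pos_uminus_zero: "Pos v \<Longrightarrow> Pos (- v) \<Longrightarrow> v = 0"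
  by (simp add: Pos_def vec_eq_iff) (metis antisym)

lemma supported_simple_root: "supported Y (\<alpha> i) \<longleftrightarrow> i \<in> Y"
  by (auto simp: supported_def simple_root_nth)
lemma supported_uminus [simp]: "supported Y (- v) \<longleftrightarrow> supported Y v"
  by (simp add: supported_def)

lemma lin_Pos:
  assumes "lin f" "Pos v" "\<And>j. v $ j \<noteq> 0 \<Longrightarrow> Pos (f (\<alpha> j))"
  shows "Pos (f v)"
  unfolding Pos_def
proof
  fix k
  have "0 \<le> v $ j * f (\<alpha> j) $ k" for j
    using assms(2,3) by (cases "v $ j = 0") (auto simp: Pos_def)
  then show "0 \<le> f v $ k" by (subst lin_nth[OF assms(1)]) (simp add: sum_nonneg)
qed

lemma lin_supported:
  assumes "lin f" "\<And>j. v $ j \<noteq> 0 \<Longrightarrow> supported Y (f (\<alpha> j))"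
  shows "supported Y (f v)"
  unfolding supported_def
proof (intro allI impI)
  fix k assume k: "k \<notin> Y"
  have "v $ j * f (\<alpha> j) $ k = 0" for j
    using assms(2)[of j] k by (cases "v $ j = 0") (auto simp: supported_def)
  then have "(\<Sum>j\<in>UNIV. v $ j * f (\<alpha> j) $ k) = 0" by (intro sum.neutral) blast
  then show "f v $ k = 0" by (subst lin_nth[OF assms(1)])
qed

section \<open>Simple reflections and parabolic subgroups\<close>

locale gcm =
  fixes A :: "int^'i^'i::finite"
  assumes gcm: "gen_cartan_matrix A"
begin

abbreviation r :: "'i \<Rightarrow> rat^'i \<Rightarrow> rat^'i" where "r \<equiv> simple_refl A"

definition coroot :: "'i \<Rightarrow> rat^'i \<Rightarrow> rat" where
  "coroot i v = (\<Sum>j\<in>UNIV. v $ j * of_int (A $ i $ j))"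

lemma refl_eq: "r i v = v - coroot i v *s \<alpha> i"
  by (simp add: simple_refl_def coroot_def)

lemma coroot_add: "coroot i (u + v) = coroot i u + coroot i v"
  by (simp add: coroot_def algebra_simps sum.distrib)
lemma coroot_scale: "coroot i (c *s v) = c * coroot i v"
  by (simp add: coroot_def sum_distrib_left algebra_simps)
lemma coroot_minus: "coroot i (- v) = - coroot i v"
  using coroot_scale[of i "-1" v] by simp
lemma coroot_diff: "coroot i (u - v) = coroot i u - coroot i v"
  using coroot_add[of i u "-v"] by (simp add: coroot_minus)
lemma coroot_zero [simp]: "coroot i 0 = 0"
  by (simp add: coroot_def)
lemma coroot_simple_root: "coroot i (\<alpha> j) = of_int (A $ i $ j)"
proof -
  have "coroot i (\<alpha> j) = (\<Sum>k\<in>UNIV. if j = k then of_int (A $ i $ k) else 0)"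
    unfolding coroot_def by (rule sum.cong) (auto simp: simple_root_nth)
  then show ?thesis by simp
qed
lemmas coroot_simps = coroot_add coroot_scale coroot_minus coroot_diff coroot_simple_root

lemma diag [simp]: "A $ i $ i = 2" using gcm by (simp add: gen_cartan_matrix_def)
lemma off_diag: "i \<noteq> j \<Longrightarrow> A $ i $ j \<le> 0" using gcm by (simp add: gen_cartan_matrix_def)
lemma zero_sym: "A $ i $ j = 0 \<longleftrightarrow> A $ j $ i = 0" using gcm by (simp add: gen_cartan_matrix_def)

lemma refl_GL_V: "r i \<in> carrier GL_V" using gcm by (rule simple_refl_GL_V)
lemma refl_self [simp]: "r i (\<alpha> i) = - \<alpha> i"
  by (simp add: refl_eq coroot_simple_root vec_eq_iff)
lemma refl_refl [simp]: "r i (r i v) = v"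
  by (simp add: refl_eq coroot_simps vec_eq_iff)
lemma refl_comp_refl: "r i \<circ> r i = id" by (simp add: fun_eq_iff)
lemma refl_nth: "k \<noteq> i \<Longrightarrow> r i v $ k = v $ k"
  by (simp add: refl_eq simple_root_nth)

definition refl_word :: "'i list \<Rightarrow> rat^'i \<Rightarrow> rat^'i" where
  "refl_word x = foldr (\<circ>) (map r x) id"

lemma refl_word_simps [simp]: "refl_word [] = id" "refl_word (i # x) = r i \<circ> refl_word x"
  by (simp_all add: refl_word_def)

lemma refl_word_append: "refl_word (x @ y) = refl_word x \<circ> refl_word y"
  by (induction x) (auto simp: comp_assoc)

definition W :: "'i set \<Rightarrow> (rat^'i \<Rightarrow> rat^'i) set" where
  "W Y = carrier (parabolic A Y)"

abbreviation wlen :: "'i set \<Rightarrow> (rat^'i \<Rightarrow> rat^'i) \<Rightarrow> nat" where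
  "wlen Y \<equiv> word_length (parabolic A Y) Y r"

lemma mult_parabolic: "mult (parabolic A Y) = (\<circ>)"
  and one_parabolic: "one (parabolic A Y) = id"
  by (simp_all add: parabolic_def GL_V_def)

lemma involution_generated_parabolic: "involution_generated (parabolic A Y) Y r"
  unfolding parabolic_def using refl_GL_V refl_comp_refl by (intro involution_generated_GL_V) auto

sublocale par: involution_generated "parabolic A Y" Y r
  rewrites "mult (parabolic A Y) = (\<circ>)" and "one (parabolic A Y) = id"
    and "carrier (parabolic A Y) = W Y"
    and "involution_generated.word_prod (parabolic A Y) r = refl_word" for Y
proof -
  show "involution_generated (parabolic A Y) Y r" by (rule involution_generated_parabolic)
  then interpret par: involution_generated "parabolic A Y" Y r .
  show "par.word_prod = refl_word"
    by (simp add: fun_eq_iff par.word_prod_def refl_word_def mult_parabolic one_parabolic)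
qed (simp_all add: mult_parabolic one_parabolic W_def)

lemma W_eq: "W Y = refl_word ` lists Y" by (rule par.carrier_word_prod)

lemma W_comp: "u \<in> W Y \<Longrightarrow> w \<in> W Y \<Longrightarrow> u \<circ> w \<in> W Y"
  using par.m_closed[of u Y w] by simp

lemma W_id [simp]: "id \<in> W Y" using par.one_closed[of Y] by simp

lemma W_refl [simp]: "i \<in> Y \<Longrightarrow> r i \<in> W Y" by (rule par.gen_closed)

lemma W_mono: "w \<in> W X \<Longrightarrow> X \<subseteq> Y \<Longrightarrow> w \<in> W Y"
  using lists_mono[of X Y] unfolding W_eq by auto

lemma W_GL_V: "w \<in> W Y \<Longrightarrow> w \<in> carrier GL_V"
proof -
  interpret GL: group "GL_V :: (rat^'i \<Rightarrow> rat^'i) monoid" by (rule group_GL_V)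
  show "w \<in> W Y \<Longrightarrow> w \<in> carrier GL_V"
    using GL.generate_incl[of "r ` Y"] refl_GL_V unfolding W_def parabolic_def by auto
qed

lemma W_lin: "w \<in> W Y \<Longrightarrow> lin w" by (rule lin_GL_V) (rule W_GL_V)

lemma W_bij: "w \<in> W Y \<Longrightarrow> bij w" using W_GL_V[of w Y] by (simp add: GL_V_def)

lemma W_inverse:
  assumes "w \<in> W Y"
  obtains w' where "w' \<in> W Y" "w \<circ> w' = id" "w' \<circ> w = id" "finv w = w'" "wlen Y w' = wlen Y w"
proof -
  let ?w' = "m_inv (parabolic A Y) w"
  have 1: "?w' \<in> W Y" using assms by (rule par.inv_closed)
  have 2: "w \<circ> ?w' = id" "?w' \<circ> w = id" using par.r_inv[of w Y] par.l_inv[of w Y] assms by auto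
  have 3: "wlen Y ?w' = wlen Y w" using assms by (rule par.len_inv)
  have "finv w = ?w'" using 2 by (intro inv_unique_comp)
  then show thesis using that 1 2 3 by blast
qed

lemma W_nth: "w \<in> W Y \<Longrightarrow> k \<notin> Y \<Longrightarrow> w v $ k = v $ k"
proof -
  have "x \<in> lists Y \<Longrightarrow> k \<notin> Y \<Longrightarrow> refl_word x v $ k = v $ k" for x
    by (induction x) (simp_all, metis refl_nth)
  then show "w \<in> W Y \<Longrightarrow> k \<notin> Y \<Longrightarrow> w v $ k = v $ k" by (auto simp: W_eq)
qed

lemma W_supported: "w \<in> W Y \<Longrightarrow> supported Y v \<Longrightarrow> supported Y (w v)"
  by (simp add: supported_def W_nth)

lemma wlen_mono:
  assumes "w \<in> W X" "X \<subseteq> Y"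
  shows "wlen Y w \<le> wlen X w"
proof -
  obtain x where x: "x \<in> lists X" "refl_word x = w" "length x = wlen X w"
    using assms(1) by (rule par.obtain_reduced_word)
  then have "x \<in> lists Y" using assms(2) lists_mono by blast
  then show ?thesis using par.len_word_prod_le[of x Y] x by simp
qed

section \<open>The sign of a root\<close>

text \<open>Keeping \<open>v + x \<alpha>\<^sub>i + y \<alpha>\<^sub>j\<close> folded turns the action of the two reflections into an affine action on
  the coefficients, which decides both braid relations and signs by computation.\<close>

definition comb :: "'i \<Rightarrow> 'i \<Rightarrow> rat^'i \<Rightarrow> rat \<Rightarrow> rat \<Rightarrow> rat^'i" where
  "comb i j v x y = v + x *s \<alpha> i + y *s \<alpha> j"

lemma refl_comb:
  "r i (comb i j v x y) = comb i j v (- x - of_int (A $ i $ j) * y - coroot i v) y"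
  "r j (comb i j v x y) = comb i j v x (- y - of_int (A $ j $ i) * x - coroot j v)"
  by (simp_all add: comb_def refl_eq coroot_simps vec_eq_iff algebra_simps)

lemma comb_zero: "comb i j v 0 0 = v" by (simp add: comb_def)

definition pos_comb :: "'i \<Rightarrow> 'i \<Rightarrow> rat^'i \<Rightarrow> bool" where
  "pos_comb i j v \<longleftrightarrow> (\<exists>x y. 0 \<le> x \<and> 0 \<le> y \<and> v = comb i j 0 x y)"

lemma pos_comb_comb [simp]: "0 \<le> x \<Longrightarrow> 0 \<le> y \<Longrightarrow> pos_comb i j (comb i j 0 x y)"
  by (auto simp: pos_comb_def)

lemma simple_root_comb: "\<alpha> i = comb i j 0 1 0" by (simp add: comb_def)

lemma rev_alt_word_Suc:
  "rev (alt_word j i (Suc n)) = (if even n then j else i) # rev (alt_word j i n)"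
  using alt_word_add[of j i n 1] by (simp del: alt_word.simps(2) add: alt_word.simps(2)[of _ _ 0])

text \<open>With \<open>a = - a\<^sub>i\<^sub>j\<close> and \<open>b = - a\<^sub>j\<^sub>i\<close>, a root \<open>x \<alpha>\<^sub>i + y \<alpha>\<^sub>j\<close> obtained by a last reflection in
  \<open>\<alpha>\<^sub>j\<close> satisfies \<open>2 y \<ge> b x\<close>, and symmetrically; this invariant survives the next reflection because
  \<open>a b \<ge> 4\<close>, and it keeps the coefficients nonnegative.\<close>

lemma rank_two_hyperbolic:
  assumes "i \<noteq> j" "A $ i $ j * A $ j $ i \<ge> 4"
  shows "pos_comb i j (refl_word (rev (alt_word j i n)) (\<alpha> i))"
proof -
  define a b where "a = - rat_of_int (A $ i $ j)" and "b = - rat_of_int (A $ j $ i)"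
  have "4 \<le> rat_of_int (A $ i $ j * A $ j $ i)" using assms(2) by linarith
  then have ab: "a * b \<ge> 4" by (simp add: a_def b_def)
  have a: "a \<ge> 0" and b: "b \<ge> 0" using off_diag assms(1) by (auto simp: a_def b_def)
  have "\<exists>x y. 0 \<le> x \<and> 0 \<le> y \<and> refl_word (rev (alt_word j i n)) (\<alpha> i) = comb i j 0 x y \<and>
     (if even n then 2 * x \<ge> a * y else 2 * y \<ge> b * x)"
  proof (induction n)
    case 0
    then show ?case
      by - (rule exI[of _ 1], rule exI[of _ 0], simp add: simple_root_comb[of i j])
  next
    case (Suc n)
    then obtain x y where xy: "0 \<le> x" "0 \<le> y"
       "refl_word (rev (alt_word j i n)) (\<alpha> i) = comb i j 0 x y"
       "if even n then 2 * x \<ge> a * y else 2 * y \<ge> b * x" by blast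
    show ?case
    proof (cases "even n")
      case True
      have "b * (2 * x) \<ge> b * (a * y)" using True xy b by (intro mult_left_mono) auto
      moreover have "(a * b) * y \<ge> 4 * y" using ab xy by (intro mult_right_mono) auto
      moreover have "0 \<le> b * x" using b xy by simp
      ultimately have "2 * (b * x - y) \<ge> b * x" "b * x - y \<ge> 0" by (simp_all add: algebra_simps)
      then show ?thesis using True xy
        by - (rule exI[of _ x], rule exI[of _ "- y - of_int (A $ j $ i) * x"],
          auto simp: rev_alt_word_Suc refl_comb b_def algebra_simps simp del: alt_word.simps)
    next
      case False
      have "a * (2 * y) \<ge> a * (b * x)" using False xy a by (intro mult_left_mono) auto
      moreover have "(a * b) * x \<ge> 4 * x" using ab xy by (intro mult_right_mono) auto
      moreover have "0 \<le> a * y" using a xy by simp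
      ultimately have "2 * (a * y - x) \<ge> a * y" "a * y - x \<ge> 0" by (simp_all add: algebra_simps)
      then show ?thesis using False xy
        by - (rule exI[of _ "- x - of_int (A $ i $ j) * y"], rule exI[of _ y],
          auto simp: rev_alt_word_Suc refl_comb a_def algebra_simps simp del: alt_word.simps)
    qed
  qed
  then show ?thesis by (auto simp: pos_comb_def)
qed

text \<open>The crystallographic dihedral groups of order 4, 6, 8 and 12.\<close>

lemma rank_two_finite_check:
  assumes "i \<noteq> j"
    and "(A $ i $ j, A $ j $ i, m) \<in>
      {(0, 0, 2), (-1, -1, 3), (-1, -2, 4), (-2, -1, 4), (-1, -3, 6), (-3, -1, 6)}"
  shows "refl_word (alt_word j i m) = refl_word (alt_word i j m)"
    and "\<And>n. n < m \<Longrightarrow> pos_comb i j (refl_word (rev (alt_word j i n)) (\<alpha> i))"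
proof -
  have cases: "A $ i $ j = 0 \<and> A $ j $ i = 0 \<and> m = 2 \<or>
    A $ i $ j = -1 \<and> A $ j $ i = -1 \<and> m = 3 \<or>
    A $ i $ j = -1 \<and> A $ j $ i = -2 \<and> m = 4 \<or> A $ i $ j = -2 \<and> A $ j $ i = -1 \<and> m = 4 \<or>
    A $ i $ j = -1 \<and> A $ j $ i = -3 \<and> m = 6 \<or> A $ i $ j = -3 \<and> A $ j $ i = -1 \<and> m = 6"
    using assms(2) by simp
  have "refl_word (alt_word j i m) (comb i j v 0 0) = refl_word (alt_word i j m) (comb i j v 0 0)" for v
    using cases
    by (elim disjE conjE) (simp_all add: eval_nat_numeral refl_comb)
  then show "refl_word (alt_word j i m) = refl_word (alt_word i j m)" by (simp add: fun_eq_iff comb_zero)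
  fix n assume "n < m"
  moreover have "m = 2 \<Longrightarrow> n < m \<Longrightarrow> n \<in> {0, 1}" "m = 3 \<Longrightarrow> n < m \<Longrightarrow> n \<in> {0, 1, 2}"
    "m = 4 \<Longrightarrow> n < m \<Longrightarrow> n \<in> {0, 1, 2, 3}" "m = 6 \<Longrightarrow> n < m \<Longrightarrow> n \<in> {0, 1, 2, 3, 4, 5}"
    by auto
  ultimately show "pos_comb i j (refl_word (rev (alt_word j i n)) (\<alpha> i))"
    using cases unfolding simple_root_comb[of i j]
    by (elim disjE conjE; simp)
      (elim disjE; simp add: eval_nat_numeral refl_comb)+
qed

lemma rank_two_finite:
  assumes "i \<noteq> j" "A $ i $ j * A $ j $ i < 4"
  obtains m where "m > 0" "refl_word (alt_word j i m) = refl_word (alt_word i j m)"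
    "\<And>n. n < m \<Longrightarrow> pos_comb i j (refl_word (rev (alt_word j i n)) (\<alpha> i))"
proof -
  define a b where "a = nat (- A $ i $ j)" and "b = nat (- A $ j $ i)"
  have A: "A $ i $ j = - int a" "A $ j $ i = - int b"
    using off_diag assms(1) by (auto simp: a_def b_def)
  have z: "a = 0 \<longleftrightarrow> b = 0" using zero_sym[of i j] A by simp
  have "a * b < 4" using assms(2) unfolding A by (simp flip: of_nat_mult)
  then have "(a, b) \<in> {(0,0),(1,1),(1,2),(2,1),(1,3),(3,1)}"
  proof -
    have "a < 4" "b < 4" using \<open>a * b < 4\<close> z by (cases a; cases b; auto)+
    then have "a \<in> {0,1,2,3}" "b \<in> {0,1,2,3}" by auto
    then show ?thesis using z \<open>a * b < 4\<close> by auto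
  qed
  then obtain m :: nat where m: "m > 0" "(A $ i $ j, A $ j $ i, m) \<in>
      {(0, 0, 2), (-1, -1, 3), (-1, -2, 4), (-2, -1, 4), (-1, -3, 6), (-3, -1, 6)}"
    unfolding A by fastforce
  show thesis using that[OF m(1) rank_two_finite_check[OF assms(1) m(2)]] by blast
qed

lemma alternating_word:
  "x \<in> lists {i, j} \<Longrightarrow> distinct_adj x \<Longrightarrow> x = [] \<or> hd x = j \<Longrightarrow> x = alt_word j i (length x)"
proof (induction x arbitrary: i j)
  case (Cons k x)
  then have k: "k = j" by simp
  have "x = alt_word i j (length x)"
  proof (rule Cons.IH)
    show "x \<in> lists {j, i}" using Cons.prems by (auto simp: insert_commute)
    show "distinct_adj x" using Cons.prems by (cases x) auto
    show "x = [] \<or> hd x = i" using Cons.prems k by (cases x) auto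
  qed
  then show ?case using k by simp
qed simp

lemma not_distinct_adj_split: "\<not> distinct_adj x \<Longrightarrow> \<exists>y k z. x = y @ k # k # z"
proof (induction x rule: induct_list012)
  case (3 a b x)
  show ?case
  proof (cases "a = b")
    case True
    then show ?thesis by (intro exI[of _ "[]"]) auto
  next
    case False
    then obtain y k z where "b # x = y @ k # k # z" using 3 by auto
    then show ?thesis by (intro exI[of _ "a # y"]) auto
  qed
qed auto

lemma reduced_distinct_adj:
  assumes "x \<in> lists Y" "length x = wlen Y (refl_word x)"
  shows "distinct_adj x"
proof (rule ccontr)
  assume "\<not> distinct_adj x"
  then obtain y k z where x: "x = y @ k # k # z" using not_distinct_adj_split by blast
  then have "refl_word x = refl_word (y @ z)" by (simp add: refl_word_append fun_eq_iff)
  then show False using par.len_word_prod_le[of "y @ z" Y] assms x by simp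
qed

text \<open>A reduced word in two letters alternates. In the finite case it is shorter than the braid relation,
  since otherwise it could be rewritten to end in \<open>i\<close>.\<close>

lemma rank_two_sign:
  assumes ij: "i \<noteq> j" and w: "w \<in> W {i, j}" "wlen {i, j} w \<le> wlen {i, j} (w \<circ> r i)"
  shows "pos_comb i j (w (\<alpha> i))"
proof -
  obtain x where x: "x \<in> lists {i, j}" "refl_word x = w" "length x = wlen {i, j} w"
    using w(1) by (rule par.obtain_reduced_word)
  have last: False if "refl_word (y @ [i]) = w" "y \<in> lists {i, j}" "Suc (length y) = length x" for y
  proof -
    have "w \<circ> r i = refl_word y" unfolding that(1)[symmetric] refl_word_append by (simp add: fun_eq_iff)
    then show False using par.len_word_prod_le[of y "{i, j}"] that w x by simp
  qed
  define n where "n = length x"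
  have "rev x = alt_word j i (length (rev x))"
  proof (rule alternating_word)
    show "rev x \<in> lists {i, j}" using x by simp
    show "distinct_adj (rev x)" using reduced_distinct_adj[of x "{i, j}"] x by simp
    show "rev x = [] \<or> hd (rev x) = j"
    proof (cases x rule: rev_cases)
      case (snoc y k)
      then have "k = i \<or> k = j" "y \<in> lists {i, j}" using x by auto
      then show ?thesis using last[of y] snoc x by auto
    qed simp
  qed
  then have xn: "x = rev (alt_word j i n)" by (metis length_rev n_def rev_rev_ident)
  show ?thesis
  proof (cases "A $ i $ j * A $ j $ i < 4")
    case False
    then show ?thesis using rank_two_hyperbolic[OF ij, of n] x(2) unfolding xn by simp
  next
    case True
    then obtain m where m: "m > 0" "refl_word (alt_word j i m) = refl_word (alt_word i j m)"
      "\<And>n. n < m \<Longrightarrow> pos_comb i j (refl_word (rev (alt_word j i n)) (\<alpha> i))"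
      using rank_two_finite ij by metis
    have "n < m"
    proof (rule ccontr)
      assume "\<not> n < m"
      then have nm: "n = m + (n - m)" by simp
      define t where "t = (if even m then alt_word j i (n - m) else alt_word i j (n - m))"
      have t: "t \<in> lists {i, j}" "length t = n - m" by (simp_all add: t_def)
      have "x = rev t @ rev (alt_word j i m)"
        unfolding xn by (subst nm) (simp add: alt_word_add t_def)
      moreover have "refl_word (rev (alt_word j i m)) = refl_word (rev (alt_word i j m))"
        using par.word_prod_rev[of "alt_word j i m" "{i, j}"]
          par.word_prod_rev[of "alt_word i j m" "{i, j}"] m(2) by simp
      moreover obtain m' where m': "m = Suc m'" using m(1) by (cases m) auto
      ultimately have "refl_word ((rev t @ rev (alt_word j i m')) @ [i]) = w"
        using x by (simp add: refl_word_append)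
      moreover have "Suc (length (rev t @ rev (alt_word j i m'))) = length x"
        using t(2) m' nm unfolding n_def[symmetric] by simp
      ultimately show False using last[of "rev t @ rev (alt_word j i m')"] t(1) by simp
    qed
    then show ?thesis using m(3)[of n] x(2) unfolding xn by simp
  qed
qed

text \<open>The general case reduces to rank two: split off from the right of \<open>w\<close> the part in a rank-two parabolic
  subgroup containing \<open>s\<^sub>i\<close> and a right descent of \<open>w\<close>, as long as the lengths add up.\<close>

theorem Pos_of_wlen_le:
  assumes "w \<in> W Y" "i \<in> Y" "wlen Y w \<le> wlen Y (w \<circ> r i)"
  shows "Pos (w (\<alpha> i))"
  using assms
proof (induction "wlen Y w" arbitrary: w i rule: less_induct)
  case less
  show ?case
  proof (cases "w = id")
    case False
    then obtain j h where h: "j \<in> Y" "h \<in> W Y" "w = h \<circ> r j" "wlen Y w = Suc (wlen Y h)"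
      using less.prems by (metis par.obtain_right_descent)
    have ij: "i \<noteq> j" using h less.prems by (auto simp: comp_assoc refl_comp_refl)
    let ?J = "{i, j}"
    have JY: "?J \<subseteq> Y" using h less.prems by simp
    define Q where "Q n \<longleftrightarrow> (\<exists>v\<in>W Y. \<exists>u\<in>W ?J. w = v \<circ> u \<and> wlen Y v + wlen ?J u \<le> wlen Y w \<and>
      wlen Y v = n)" for n
    have "wlen ?J (r j) \<le> 1" by (rule par.len_gen_le) simp
    then have Qh: "Q (wlen Y h)" using h unfolding Q_def
      by (intro bexI[of _ h] bexI[of _ "r j"]) auto
    define n where "n = (LEAST n. Q n)"
    have "Q n" using Qh unfolding n_def by (rule LeastI)
    then obtain v u where vu: "v \<in> W Y" "u \<in> W ?J" "w = v \<circ> u"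
      "wlen Y v + wlen ?J u \<le> wlen Y w" "wlen Y v = n" by (auto simp: Q_def)
    have min: "n \<le> n'" if "Q n'" for n' unfolding n_def using that by (rule Least_le)
    have v_less: "wlen Y v < wlen Y w" using min[OF Qh] vu h by simp
    have v_pos: "Pos (v (\<alpha> k))" if k: "k \<in> ?J" for k
    proof (rule less.hyps[OF v_less vu(1)])
      show "k \<in> Y" using k JY by auto
      show "wlen Y v \<le> wlen Y (v \<circ> r k)"
      proof (rule ccontr)
        assume *: "\<not> wlen Y v \<le> wlen Y (v \<circ> r k)"
        have "wlen ?J (r k \<circ> u) \<le> Suc (wlen ?J u)"
          using k vu(2) by (intro par.len_gen_mult_le)
        moreover have "w = (v \<circ> r k) \<circ> (r k \<circ> u)" using vu(3) by (simp add: fun_eq_iff)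
        moreover have "v \<circ> r k \<in> W Y" "r k \<circ> u \<in> W ?J"
          using k JY vu by (auto intro!: W_comp W_refl)
        ultimately have "Q (wlen Y (v \<circ> r k))" using vu(4) *
          unfolding Q_def by (intro bexI[of _ "v \<circ> r k"] bexI[of _ "r k \<circ> u"] conjI) auto
        then show False using min vu(5) * by fastforce
      qed
    qed
    have "wlen ?J u \<le> wlen ?J (u \<circ> r i)"
    proof (rule ccontr)
      assume *: "\<not> wlen ?J u \<le> wlen ?J (u \<circ> r i)"
      have ui: "u \<circ> r i \<in> W ?J" using vu by (intro W_comp W_refl) auto
      have "wlen Y (w \<circ> r i) \<le> wlen Y v + wlen Y (u \<circ> r i)"
        using par.len_mult_le[of v Y "u \<circ> r i"] vu ui JY W_mono by (auto simp: comp_assoc)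
      also have "\<dots> \<le> wlen Y v + wlen ?J (u \<circ> r i)" using wlen_mono[OF ui JY] by simp
      finally show False using * vu less.prems by simp
    qed
    then have "pos_comb i j (u (\<alpha> i))" using ij vu(2) by (intro rank_two_sign)
    then obtain x y where xy: "0 \<le> x" "0 \<le> y" "u (\<alpha> i) = x *s \<alpha> i + y *s \<alpha> j"
      by (auto simp: pos_comb_def comb_def)
    then have "w (\<alpha> i) = x *s v (\<alpha> i) + y *s v (\<alpha> j)"
      using W_lin[OF vu(1)] vu(3) by (simp add: lin_simps)
    then show ?thesis using xy v_pos by (auto intro!: Pos_add Pos_scale)
  qed simp
qed

end

section \<open>Integral vectors\<close>

definition integral_vec :: "rat^'i::finite \<Rightarrow> bool" where
  "integral_vec v \<longleftrightarrow> (\<forall>j. v $ j \<in> \<int>)"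

lemma integral_simple_root [simp]: "integral_vec (\<alpha> i)"
  by (simp add: integral_vec_def simple_root_nth)

lemma integral_uminus [simp]: "integral_vec (- v) \<longleftrightarrow> integral_vec v"
  by (simp add: integral_vec_def)

lemma Ints_mult_eq_1:
  assumes "(c::rat) \<in> \<int>" "d \<in> \<int>" "c \<ge> 0" "c * d = 1"
  shows "c = 1 \<and> d = 1"
proof -
  obtain m n where mn: "c = of_int m" "d = of_int n" using assms(1,2) by (auto elim!: Ints_cases)
  have "rat_of_int (m * n) = 1" using assms(4) mn by simp
  then have "m * n = 1" by linarith
  then have "m = 1 \<or> m = -1" by (rule pos_zmult_eq_1_iff_lemma)
  then show ?thesis using mn assms(3) \<open>m * n = 1\<close> by auto
qed

text \<open>A linear bijection that together with its inverse preserves the cones of nonnegative integral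
  vectors maps the extremal generators of one cone to those of the other.\<close>

lemma cone_generators:
  assumes u: "lin u" "lin u'" "\<And>v. u' (u v) = v" "\<And>v. u (u' v) = v"
    and Y1: "\<And>i. i \<in> Y1 \<Longrightarrow> Pos (u (\<alpha> i)) \<and> supported Y2 (u (\<alpha> i)) \<and> integral_vec (u (\<alpha> i))"
    and Y2: "\<And>k. k \<in> Y2 \<Longrightarrow> Pos (u' (\<alpha> k)) \<and> integral_vec (u' (\<alpha> k))"
    and i: "i \<in> Y1"
  shows "\<exists>k\<in>Y2. u (\<alpha> i) = \<alpha> k"
proof -
  define c where "c = u (\<alpha> i)"
  have c: "Pos c" "supported Y2 c" "integral_vec c" using Y1[OF i] by (auto simp: c_def)
  have "u' c = \<alpha> i" by (simp add: c_def u)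
  then have "c \<noteq> 0" using lin_zero[OF u(2)] simple_root_nth[of i i] by auto
  then obtain k where k: "c $ k \<noteq> 0" by (auto simp: vec_eq_iff)
  then have kY: "k \<in> Y2" using c(2) by (auto simp: supported_def)
  define d where "d = u' (\<alpha> k) $ i"
  have "u' (\<alpha> k) $ l = 0" if l: "l \<noteq> i" for l
  proof -
    have "(\<Sum>m\<in>UNIV. c $ m * u' (\<alpha> m) $ l) = 0"
      using lin_nth[OF u(2), of c l] \<open>u' c = \<alpha> i\<close> l by (simp add: simple_root_nth)
    moreover have "0 \<le> c $ m * u' (\<alpha> m) $ l" for m
      using c Y2[of m] by (cases "m \<in> Y2") (auto simp: Pos_def supported_def)
    ultimately have "c $ k * u' (\<alpha> k) $ l = 0" by (simp add: sum_nonneg_eq_0_iff)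
    then show ?thesis using k by simp
  qed
  then have uk: "u' (\<alpha> k) = d *s \<alpha> i"
    by (auto simp: vec_eq_iff simple_root_nth d_def)
  then have "\<alpha> k = d *s c" using u(4)[of "\<alpha> k"] lin_scale[OF u(1)] by (simp add: c_def)
  then have "\<alpha> k $ k = (d *s c) $ k" by simp
  then have 1: "d * c $ k = 1" by (simp add: simple_root_nth)
  have "d \<in> \<int>" "c $ k \<in> \<int>" "d \<ge> 0"
    using Y2[OF kY] c(3) by (auto simp: d_def integral_vec_def Pos_def)
  then have "d = 1" using Ints_mult_eq_1[OF _ _ _ 1] by blast
  then show ?thesis using \<open>\<alpha> k = d *s c\<close> kY by (auto simp: c_def intro!: bexI[of _ k])
qed

context gcm
begin

lemma coroot_integral: "integral_vec v \<Longrightarrow> coroot i v \<in> \<int>"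
  unfolding coroot_def integral_vec_def by (intro Ints_sum Ints_mult) auto

lemma refl_integral: "integral_vec v \<Longrightarrow> integral_vec (r i v)"
  using coroot_integral[of v i] by (auto simp: integral_vec_def refl_eq simple_root_nth)

lemma W_induct [consumes 1, case_names id refl]:
  assumes "w \<in> W Y" "Q id" "\<And>i w. i \<in> Y \<Longrightarrow> w \<in> W Y \<Longrightarrow> Q w \<Longrightarrow> Q (r i \<circ> w)"
  shows "Q w"
proof -
  obtain x where "x \<in> lists Y" "w = refl_word x" using assms(1) by (auto simp: W_eq)
  moreover have "x \<in> lists Y \<Longrightarrow> Q (refl_word x)" for x
    by (induction x) (auto intro!: assms(2,3) simp: W_eq)
  ultimately show ?thesis by simp
qed

lemma W_integral: "w \<in> W Y \<Longrightarrow> integral_vec v \<Longrightarrow> integral_vec (w v)"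
  by (induction w rule: W_induct) (auto simp: refl_integral)

lemma W_zero_iff: "w \<in> W Y \<Longrightarrow> w v = 0 \<longleftrightarrow> v = 0"
  using W_bij[of w Y] W_lin[of w Y] lin_zero[of w] by (metis bij_is_inj injD)

section \<open>Real roots\<close>

text \<open>The real roots.\<close>

definition \<Phi> :: "(rat^'i) set" where
  "\<Phi> = {w (\<alpha> i) |w i. w \<in> W UNIV}"

lemma simple_root_\<Phi> [simp]: "\<alpha> i \<in> \<Phi>"
  unfolding \<Phi>_def by (intro CollectI exI[of _ id] exI[of _ i]) simp

lemma W_\<Phi>: "w \<in> W Y \<Longrightarrow> v \<in> \<Phi> \<Longrightarrow> w v \<in> \<Phi>"
proof -
  assume "w \<in> W Y" "v \<in> \<Phi>"
  then obtain u i where u: "u \<in> W UNIV" "v = u (\<alpha> i)" by (auto simp: \<Phi>_def)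
  have "w \<circ> u \<in> W UNIV" using W_mono[OF \<open>w \<in> W Y\<close>] u by (intro W_comp) auto
  then show ?thesis using u(2) unfolding \<Phi>_def by (intro CollectI exI[of _ "w \<circ> u"]) auto
qed

lemma \<Phi>_uminus: "v \<in> \<Phi> \<Longrightarrow> - v \<in> \<Phi>"
proof -
  assume "v \<in> \<Phi>"
  then obtain w i where w: "w \<in> W UNIV" "v = w (\<alpha> i)" by (auto simp: \<Phi>_def)
  then have "- v = (w \<circ> r i) (\<alpha> i)" using lin_minus[OF W_lin] by simp
  then show ?thesis using w unfolding \<Phi>_def
    by (intro CollectI exI[of _ "w \<circ> r i"] exI[of _ i]) (auto intro!: W_comp)
qed

lemma \<Phi>_uminus_iff [simp]: "- v \<in> \<Phi> \<longleftrightarrow> v \<in> \<Phi>"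
  using \<Phi>_uminus by force

lemma \<Phi>_sign: "v \<in> \<Phi> \<Longrightarrow> Pos v \<or> Pos (- v)"
proof -
  assume "v \<in> \<Phi>"
  then obtain w i where w: "w \<in> W UNIV" "v = w (\<alpha> i)" by (auto simp: \<Phi>_def)
  show ?thesis
  proof (cases "wlen UNIV w \<le> wlen UNIV (w \<circ> r i)")
    case True
    then show ?thesis using Pos_of_wlen_le w by auto
  next
    case False
    then have "Pos ((w \<circ> r i) (\<alpha> i))"
      using w by (intro Pos_of_wlen_le[where w = "w \<circ> r i" and Y = UNIV] W_comp)
        (auto simp: comp_assoc refl_comp_refl)
    then show ?thesis using w lin_minus[OF W_lin] by simp
  qed
qed

lemma \<Phi>_nonzero: "v \<in> \<Phi> \<Longrightarrow> v \<noteq> 0"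
proof -
  assume "v \<in> \<Phi>"
  then obtain w i where w: "w \<in> W UNIV" "v = w (\<alpha> i)" by (auto simp: \<Phi>_def)
  have "\<alpha> i \<noteq> 0" using simple_root_nth[of i i] by (metis zero_index zero_neq_one)
  then show ?thesis using w W_zero_iff by simp
qed

lemma \<Phi>_integral: "v \<in> \<Phi> \<Longrightarrow> integral_vec v"
  by (auto simp: \<Phi>_def W_integral)

lemma \<Phi>_not_both: "v \<in> \<Phi> \<Longrightarrow> Pos v \<Longrightarrow> \<not> Pos (- v)"
  using Pos_uminus_zero \<Phi>_nonzero by blast

lemma \<Phi>_Pos_coord: "v \<in> \<Phi> \<Longrightarrow> v $ k > 0 \<Longrightarrow> Pos v"
  using \<Phi>_sign[of v] by (auto simp: Pos_def dest: spec[of _ k])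

text \<open>The coefficient and its inverse are both integral, the latter because some Weyl group element maps
  the root to a simple root.\<close>

lemma \<Phi>_multiple:
  assumes "v \<in> \<Phi>" "v = c *s \<alpha> i" "c \<ge> 0"
  shows "v = \<alpha> i"
proof -
  obtain w j where w: "w \<in> W UNIV" "v = w (\<alpha> j)" using assms(1) by (auto simp: \<Phi>_def)
  obtain w' where w': "w' \<in> W UNIV" "w' \<circ> w = id" using w(1) W_inverse by metis
  have "\<alpha> j = w' v" using w w' by (simp add: pointfree_idE)
  then have "\<alpha> j = c *s w' (\<alpha> i)" using assms(2) lin_scale[OF W_lin[OF w'(1)]] by simp
  then have "\<alpha> j $ j = (c *s w' (\<alpha> i)) $ j" by simp
  then have "c * w' (\<alpha> i) $ j = 1" by (simp add: simple_root_nth)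
  moreover have "c \<in> \<int>"
    using \<Phi>_integral[OF assms(1)] assms(2) by (auto simp: integral_vec_def simple_root_nth dest: spec[of _ i])
  moreover have "w' (\<alpha> i) $ j \<in> \<int>" using W_integral[OF w'(1) integral_simple_root[of i]] by (simp add: integral_vec_def)
  ultimately have "c = 1" using Ints_mult_eq_1 assms(3) by blast
  then show ?thesis using assms(2) by simp
qed

text \<open>A positive root other than \<open>\<alpha>\<^sub>i\<close> has a positive coordinate that \<open>s\<^sub>i\<close> leaves alone.\<close>

lemma refl_Pos:
  assumes "v \<in> \<Phi>" "Pos v" "v \<noteq> \<alpha> i"
  shows "Pos (r i v)"
proof (cases "\<exists>k. k \<noteq> i \<and> v $ k \<noteq> 0")
  case True
  then obtain k where k: "k \<noteq> i" "v $ k \<noteq> 0" by blast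
  then have "r i v $ k > 0" using Pos_nth[OF assms(2), of k] by (simp add: refl_nth)
  then show ?thesis using \<Phi>_Pos_coord W_\<Phi>[of "r i" UNIV] assms(1) by auto
next
  case False
  then have "v = (v $ i) *s \<alpha> i" by (auto simp: vec_eq_iff simple_root_nth)
  then show ?thesis using \<Phi>_multiple[OF assms(1)] Pos_nth[OF assms(2)] assms(3) by blast
qed

section \<open>Inversions and length\<close>

definition inversions :: "(rat^'i \<Rightarrow> rat^'i) \<Rightarrow> (rat^'i) set" where
  "inversions w = {v \<in> \<Phi>. Pos v \<and> Pos (- w v)}"

lemma inversions_id: "inversions id = {}"
  using \<Phi>_not_both by (auto simp: inversions_def)

lemma inversions_refl: "inversions (r i) = {\<alpha> i}"
proof -
  have "v = \<alpha> i" if "v \<in> inversions (r i)" for v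
  proof (rule ccontr)
    assume "v \<noteq> \<alpha> i"
    then have "Pos (r i v)" using that by (intro refl_Pos) (auto simp: inversions_def)
    then show False using that \<Phi>_not_both[of "r i v"] W_\<Phi>[of "r i" UNIV v]
      by (auto simp: inversions_def)
  qed
  then show ?thesis by (auto simp: inversions_def)
qed

lemma inversions_supported:
  assumes "w \<in> W Y" "v \<in> inversions w"
  shows "supported Y v"
  unfolding supported_def
proof (intro allI impI)
  fix j assume "j \<notin> Y"
  then have "w v $ j = v $ j" using W_nth assms(1) by blast
  moreover have "0 \<le> v $ j" "0 \<le> - w v $ j"
    using assms(2) by (auto simp: inversions_def Pos_def dest: spec[of _ j])
  ultimately show "v $ j = 0" by simp
qed

text \<open>If \<open>v\<close> is an involution none of whose inversions is sent to a negative root by \<open>u\<close>, then an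
  inversion of \<open>u v\<close> is either one of \<open>v\<close> or the preimage of one of \<open>u\<close>.\<close>

lemma inversions_comp:
  assumes u: "u \<in> W UNIV" and v: "v \<in> W UNIV" "v \<circ> v = id"
    and pos: "\<And>x. x \<in> inversions v \<Longrightarrow> Pos (u x)"
  shows "inversions (u \<circ> v) = inversions v \<union> v ` inversions u"
    and "inversions v \<inter> v ` inversions u = {}"
proof -
  have vv: "v (v x) = x" for x using v(2) by (simp add: pointfree_idE)
  have v\<Phi>: "x \<in> \<Phi> \<Longrightarrow> v x \<in> \<Phi>" and u\<Phi>: "x \<in> \<Phi> \<Longrightarrow> u x \<in> \<Phi>" for x using u v W_\<Phi> by auto
  note minus = lin_minus[OF W_lin[OF u]] lin_minus[OF W_lin[OF v(1)]]
  have A: "Pos (- u (v x))" if "x \<in> inversions v" for x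
  proof -
    have "- v x \<in> inversions v" using that v\<Phi>[of x]
      by (simp add: inversions_def minus vv)
    then show ?thesis using pos[of "- v x"] minus by simp
  qed
  have B: "Pos (v x)" if x: "x \<in> inversions u" for x
  proof (rule ccontr)
    assume "\<not> Pos (v x)"
    then have "x \<in> inversions v" using x \<Phi>_sign[of "v x"] v\<Phi>[of x] by (auto simp: inversions_def)
    then show False using pos[of x] x \<Phi>_not_both[of "u x"] u\<Phi>[of x] by (auto simp: inversions_def)
  qed
  show "inversions (u \<circ> v) = inversions v \<union> v ` inversions u"
  proof (intro equalityI subsetI)
    fix x assume x: "x \<in> inversions (u \<circ> v)"
    show "x \<in> inversions v \<union> v ` inversions u"
    proof (cases "Pos (v x)")
      case True
      then have "v x \<in> inversions u" using x v\<Phi> by (auto simp: inversions_def)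
      then show ?thesis using vv by (metis UnI2 imageI)
    next
      case False
      then show ?thesis using x \<Phi>_sign[of "v x"] v\<Phi>[of x] by (auto simp: inversions_def)
    qed
  next
    fix x assume "x \<in> inversions v \<union> v ` inversions u"
    then show "x \<in> inversions (u \<circ> v)"
      using A B v\<Phi> by (auto simp: inversions_def vv)
  qed
  show "inversions v \<inter> v ` inversions u = {}"
  proof -
    have False if "x \<in> inversions v" "y \<in> inversions u" "x = v y" for x y
      using that \<Phi>_not_both[of y] by (auto simp: inversions_def vv)
    then show ?thesis by blast
  qed
qed

lemma card_inversions_comp:
  assumes u: "u \<in> W UNIV" and v: "v \<in> W UNIV" "v \<circ> v = id"
    and pos: "\<And>x. x \<in> inversions v \<Longrightarrow> Pos (u x)"
    and fin: "finite (inversions u)" "finite (inversions v)"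
  shows "finite (inversions (u \<circ> v))"
    and "card (inversions (u \<circ> v)) = card (inversions u) + card (inversions v)"
proof -
  note * = inversions_comp[OF u v pos]
  have "inj_on v (inversions u)" using W_bij[OF v(1)] by (meson bij_is_inj inj_on_subset subset_UNIV)
  then show "card (inversions (u \<circ> v)) = card (inversions u) + card (inversions v)"
    using * fin by (simp add: card_Un_disjoint card_image)
  show "finite (inversions (u \<circ> v))" using * fin by simp
qed

text \<open>Each letter of a reduced word adds one inversion.\<close>

lemma wlen_inversions: "w \<in> W Y \<Longrightarrow> finite (inversions w) \<and> wlen Y w = card (inversions w)"
proof (induction "wlen Y w" arbitrary: w)
  case 0
  then have "w = id" by (metis par.obtain_right_descent nat.distinct(1))
  then show ?case using inversions_id par.len_one[of Y] by (metis card.empty finite.emptyI)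
next
  case (Suc n)
  then have "w \<noteq> id" by auto
  then obtain j h where h: "j \<in> Y" "h \<in> W Y" "w = h \<circ> r j" "wlen Y w = Suc (wlen Y h)"
    using Suc.prems by (metis par.obtain_right_descent)
  then have IH: "finite (inversions h)" "wlen Y h = card (inversions h)" using Suc by auto
  have "Pos (h (\<alpha> j))" using h by (intro Pos_of_wlen_le) auto
  then have "finite (inversions (h \<circ> r j))"
    "card (inversions (h \<circ> r j)) = card (inversions h) + card (inversions (r j))"
    using card_inversions_comp[of h "r j"] W_mono[OF h(2)] IH inversions_refl
    by (auto simp: refl_comp_refl)
  then show ?case using h IH by (simp add: inversions_refl)
qed

lemma wlen_UNIV: "w \<in> W Y \<Longrightarrow> wlen UNIV w = wlen Y w"
  using wlen_inversions[of w Y] wlen_inversions[of w UNIV] W_mono[of w Y UNIV] by simp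

lemma wlen_comp_involution:
  assumes "u \<in> W UNIV" "v \<in> W UNIV" "v \<circ> v = id" "\<And>x. x \<in> inversions v \<Longrightarrow> Pos (u x)"
  shows "wlen UNIV (u \<circ> v) = wlen UNIV u + wlen UNIV v"
  using card_inversions_comp[of u v] wlen_inversions[of u UNIV] wlen_inversions[of v UNIV]
    wlen_inversions[of "u \<circ> v" UNIV] assms by (auto simp: W_comp)

lemma wlen_comp_refl:
  assumes "w \<in> W Y" "i \<in> Y" "Pos (w (\<alpha> i))"
  shows "wlen Y (w \<circ> r i) = Suc (wlen Y w)"
  using wlen_comp_involution[of w "r i"] wlen_UNIV[of w Y] wlen_UNIV[of "w \<circ> r i" Y]
    wlen_inversions[of "r i" UNIV] W_mono[of w Y UNIV] assms
  by (auto simp: refl_comp_refl inversions_refl W_comp)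

lemma W_Pos_id:
  assumes "w \<in> W Y" "\<And>i. i \<in> Y \<Longrightarrow> Pos (w (\<alpha> i))"
  shows "w = id"
proof (rule ccontr)
  assume "w \<noteq> id"
  then obtain j h where h: "j \<in> Y" "h \<in> W Y" "w = h \<circ> r j" "wlen Y w = Suc (wlen Y h)"
    using assms(1) by (metis par.obtain_right_descent)
  have "wlen Y (w \<circ> r j) = Suc (wlen Y w)"
    using assms(1) h(1) assms(2)[OF h(1)] by (rule wlen_comp_refl)
  then show False using h by (simp add: comp_assoc refl_comp_refl)
qed

section \<open>Longest elements\<close>

abbreviation wl :: "'i set \<Rightarrow> rat^'i \<Rightarrow> rat^'i" where "wl \<equiv> longest_elt A"

lemma finite_type_W: "finite_type A Y \<longleftrightarrow> finite (W Y)"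
  by (simp add: finite_type_def W_def)

lemma finite_type_mono: "finite_type A Y \<Longrightarrow> X \<subseteq> Y \<Longrightarrow> finite_type A X"
  unfolding finite_type_W using W_mono by (meson finite_subset subsetI)

lemma maximal_negative:
  assumes "w \<in> W Y" "\<And>u. u \<in> W Y \<Longrightarrow> wlen Y u \<le> wlen Y w" "i \<in> Y"
  shows "Pos (- w (\<alpha> i))"
proof -
  have "\<not> Pos (w (\<alpha> i))"
    using wlen_comp_refl[of w Y i] assms(2)[of "w \<circ> r i"] assms(1,3) by (auto simp: W_comp)
  then show ?thesis using \<Phi>_sign[of "w (\<alpha> i)"] W_\<Phi>[OF assms(1)] by auto
qed

lemma negative_comp_Pos:
  assumes "lin w" "\<And>i. i \<in> Y \<Longrightarrow> Pos (- w (\<alpha> i))" "Pos (- v)" "supported Y v"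
  shows "Pos (w v)"
proof -
  have "Pos (- w (- v))"
  proof (rule lin_Pos[where f = "\<lambda>v. - w v"])
    show "lin (\<lambda>v. - w v)" using assms(1) by (rule lin_uminus)
    show "Pos (- v)" by (rule assms(3))
    fix j assume "(- v) $ j \<noteq> 0"
    then show "Pos (- w (\<alpha> j))" using assms(2,4) by (auto simp: supported_def)
  qed
  then show ?thesis using lin_minus[OF assms(1)] by simp
qed

text \<open>An element of maximal length makes all simple roots of \<open>Y\<close> negative, and so does its inverse. The
  product of this inverse with any other element that makes them negative preserves positivity, so it is
  the identity.\<close>

lemma longest_facts:
  assumes "finite_type A Y"
  shows longest_W: "wl Y \<in> W Y"
    and longest_negative: "\<And>i. i \<in> Y \<Longrightarrow> Pos (- wl Y (\<alpha> i))"
    and longest_unique: "\<And>u. u \<in> W Y \<Longrightarrow> (\<And>i. i \<in> Y \<Longrightarrow> Pos (- u (\<alpha> i))) \<Longrightarrow> u = wl Y"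
    and longest_involution: "wl Y \<circ> wl Y = id"
proof -
  define is_max where "is_max w \<longleftrightarrow> w \<in> W Y \<and> (\<forall>u\<in>W Y. wlen Y u \<le> wlen Y w)" for w
  have fin: "finite (wlen Y ` W Y)" and ne: "wlen Y ` W Y \<noteq> {}"
    using assms W_id by (auto simp: finite_type_W)
  obtain m where "m \<in> W Y" "wlen Y m = Max (wlen Y ` W Y)" using Max_in[OF fin ne] by auto
  then have m: "is_max m" using Max_ge[OF fin] by (simp add: is_max_def)
  have neg: "Pos (- w (\<alpha> i))" if "is_max w" "i \<in> Y" for w i
    using that by (intro maximal_negative) (auto simp: is_max_def)
  have inverse_max: "is_max w'" if "is_max w" "w' \<in> W Y" "wlen Y w' = wlen Y w" for w w'
    using that by (auto simp: is_max_def)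
  have uniq: "u = w" if u: "u \<in> W Y" "\<And>i. i \<in> Y \<Longrightarrow> Pos (- u (\<alpha> i))" and w: "is_max w" for u w
  proof -
    obtain w' where w': "w' \<in> W Y" "w \<circ> w' = id" "w' \<circ> w = id" "wlen Y w' = wlen Y w"
      using w W_inverse unfolding is_max_def by metis
    then have "is_max w'" using inverse_max w by blast
    have pos: "Pos ((w' \<circ> u) (\<alpha> i))" if i: "i \<in> Y" for i
    proof -
      have "supported Y (u (\<alpha> i))"
        using u(1) i by (intro W_supported[of u]) (simp_all add: supported_simple_root)
      then have "Pos (w' (u (\<alpha> i)))"
        using neg[OF \<open>is_max w'\<close>] u(2)[OF i]
        by (intro negative_comp_Pos[OF W_lin[OF w'(1)]]) auto
      then show ?thesis by simp
    qed
    have "w' \<circ> u = id" using W_comp[OF w'(1) u(1)] pos by (rule W_Pos_id)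
    then have "w \<circ> (w' \<circ> u) = w" by simp
    then show "u = w" using w'(2) by (simp add: comp_assoc[symmetric])
  qed
  have "wl Y = m"
    unfolding longest_elt_def
  proof (rule the_equality)
    show "m \<in> carrier (parabolic A Y) \<and> (\<forall>u\<in>carrier (parabolic A Y). wlen Y u \<le> wlen Y m)"
      using m by (simp add: is_max_def W_def)
    fix w assume "w \<in> carrier (parabolic A Y) \<and> (\<forall>u\<in>carrier (parabolic A Y). wlen Y u \<le> wlen Y w)"
    then have "is_max w" by (simp add: is_max_def W_def)
    then show "w = m" using uniq[of w m] m neg by (auto simp: is_max_def)
  qed
  then have max: "is_max (wl Y)" using m by simp
  then show W: "wl Y \<in> W Y" by (simp add: is_max_def)
  show "Pos (- wl Y (\<alpha> i))" if "i \<in> Y" for i using neg max that by blast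
  show "u = wl Y" if "u \<in> W Y" "\<And>i. i \<in> Y \<Longrightarrow> Pos (- u (\<alpha> i))" for u
    using uniq max that by blast
  obtain w' where w': "w' \<in> W Y" "wl Y \<circ> w' = id" "wlen Y w' = wlen Y (wl Y)"
    using W W_inverse by metis
  then have "w' = wl Y" using uniq[of w' "wl Y"] max inverse_max neg by blast
  then show "wl Y \<circ> wl Y = id" using w' by simp
qed

lemma longest_longest: "finite_type A Y \<Longrightarrow> wl Y (wl Y v) = v"
  using longest_involution[of Y] by (simp add: pointfree_idE)

text \<open>The map \<open>- w\<^sub>Y\<close> is an involution preserving the cone spanned by the simple roots of \<open>Y\<close>.\<close>

lemma longest_simple_root:
  assumes "finite_type A Y" "i \<in> Y"
  shows "\<exists>k\<in>Y. wl Y (\<alpha> i) = - \<alpha> k"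
proof -
  have W: "wl Y \<in> W Y" using assms(1) by (rule longest_W)
  let ?u = "\<lambda>v. - wl Y v"
  have "\<exists>k\<in>Y. ?u (\<alpha> i) = \<alpha> k"
  proof (rule cone_generators[where u = ?u and u' = ?u])
    show "lin ?u" using W by (intro lin_uminus W_lin)
    then show "lin ?u" .
    show "?u (?u v) = v" for v using longest_longest[OF assms(1)] lin_minus[OF W_lin[OF W]] by simp
    then show "?u (?u v) = v" for v .
    show "Pos (?u (\<alpha> k)) \<and> supported Y (?u (\<alpha> k)) \<and> integral_vec (?u (\<alpha> k))" if "k \<in> Y" for k
      using that longest_negative[OF assms(1)] W_supported[OF W, of "\<alpha> k"]
        W_integral[OF W, of "\<alpha> k"] by (simp add: supported_simple_root)
    then show "Pos (?u (\<alpha> k)) \<and> integral_vec (?u (\<alpha> k))" if "k \<in> Y" for k using that by blast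
  qed (rule assms(2))
  then show ?thesis by (metis minus_minus)
qed

lemma opp_inv_facts:
  assumes "finite_type A Y" "i \<in> Y"
  shows opp_inv_in: "opp_inv A Y i \<in> Y"
    and longest_opp_inv: "wl Y (\<alpha> i) = - \<alpha> (opp_inv A Y i)"
proof -
  have "\<exists>!j. j \<in> Y \<and> wl Y (\<alpha> i) = - \<alpha> j" using longest_simple_root[OF assms] by auto
  then have "opp_inv A Y i \<in> Y \<and> wl Y (\<alpha> i) = - \<alpha> (opp_inv A Y i)"
    unfolding opp_inv_def by (rule theI')
  then show "opp_inv A Y i \<in> Y" "wl Y (\<alpha> i) = - \<alpha> (opp_inv A Y i)" by auto
qed

lemma opp_inv_opp_inv:
  assumes "finite_type A Y" "i \<in> Y"
  shows "opp_inv A Y (opp_inv A Y i) = i"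
proof -
  have "wl Y (wl Y (\<alpha> i)) = \<alpha> (opp_inv A Y (opp_inv A Y i))"
    using assms opp_inv_in longest_opp_inv lin_minus[OF W_lin[OF longest_W[OF assms(1)]]] by simp
  then show ?thesis using longest_longest[OF assms(1)] by simp
qed

text \<open>A map that matches the simple reflections of two finite types matches their longest elements.\<close>

lemma longest_conj:
  assumes fin: "finite_type A P" "finite_type A Q"
    and u: "lin u" "\<And>v. u' (u v) = v" "\<And>v. u (u' v) = v"
    and P: "\<And>j. j \<in> P \<Longrightarrow> \<exists>k\<in>Q. u (\<alpha> j) = \<alpha> k \<and> (\<forall>v. u (r j v) = r k (u v))"
    and Q: "\<And>k. k \<in> Q \<Longrightarrow> \<exists>j\<in>P. u' (\<alpha> k) = \<alpha> j"
  shows "u (wl P v) = wl Q (u v)"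
proof -
  have conj: "u \<circ> w \<circ> u' \<in> W Q" if "w \<in> W P" for w
    using that
  proof (induction w rule: W_induct)
    case id
    have "u \<circ> id \<circ> u' = id" by (simp add: fun_eq_iff u)
    then show ?case by (simp only: W_id)
  next
    case (refl i w)
    obtain k where k: "k \<in> Q" "\<And>v. u (r i v) = r k (u v)" using P refl(1) by blast
    then have "u \<circ> (r i \<circ> w) \<circ> u' = r k \<circ> (u \<circ> w \<circ> u')" by (simp add: fun_eq_iff)
    then show ?case using W_comp[OF W_refl[OF k(1)] refl(3)] by metis
  qed
  have "u \<circ> wl P \<circ> u' = wl Q"
  proof (rule longest_unique[OF fin(2)])
    show "u \<circ> wl P \<circ> u' \<in> W Q" using conj[OF longest_W[OF fin(1)]] .
    fix k assume "k \<in> Q"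
    then obtain j where j: "j \<in> P" "u' (\<alpha> k) = \<alpha> j" using Q by blast
    obtain j' where j': "j' \<in> P" "wl P (\<alpha> j) = - \<alpha> j'" using longest_simple_root[OF fin(1) j(1)] by blast
    obtain k' where "u (\<alpha> j') = \<alpha> k'" using P[OF j'(1)] by blast
    then show "Pos (- (u \<circ> wl P \<circ> u') (\<alpha> k))" using j j' by (simp add: lin_minus[OF u(1)])
  qed
  then have "(u \<circ> wl P \<circ> u') (u v) = wl Q (u v)" by simp
  then show ?thesis by (simp add: u)
qed

section \<open>Invariant forms\<close>

definition invariant_form :: "'i set \<Rightarrow> (rat^'i \<Rightarrow> rat^'i \<Rightarrow> rat) \<Rightarrow> bool" where
  "invariant_form Y B \<longleftrightarrow> (\<forall>u v w. B (u + v) w = B u w + B v w) \<and> (\<forall>c v w. B (c *s v) w = c * B v w) \<and>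
     (\<forall>u v. B u v = B v u) \<and> (\<forall>j\<in>Y. \<forall>u v. B (r j u) (r j v) = B u v) \<and> (\<forall>j\<in>Y. B (\<alpha> j) (\<alpha> j) > 0)"

lemma invariant_formD:
  assumes "invariant_form Y B"
  shows form_add: "B (u + v) w = B u w + B v w" and form_scale: "B (c *s v) w = c * B v w"
    and form_sym: "B u v = B v u"
    and form_add2: "B w (u + v) = B w u + B w v" and form_scale2: "B w (c *s v) = c * B w v"
    and form_minus: "B (- v) w = - B v w" and form_minus2: "B w (- v) = - B w v"
    and form_diff: "B (u - v) w = B u w - B v w" and form_diff2: "B w (u - v) = B w u - B w v"
proof -
  show a: "B (u + v) w = B u w + B v w" and s: "B (c *s v) w = c * B v w" and y: "B u v = B v u"
    for u v w c using assms by (auto simp: invariant_form_def)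
  show a2: "B w (u + v) = B w u + B w v" for u v w using a y by metis
  show "B w (c *s v) = c * B w v" using s y by metis
  show m: "B (- v) w = - B v w" for v using s[of "-1" v w] by simp
  then show m2: "B w (- v) = - B w v" for v using y s[of "-1" v w] by (metis m y)
  show "B (u - v) w = B u w - B v w" using a[of u "-v" w] m by simp
  show "B w (u - v) = B w u - B w v" using a2[of w u "-v"] m2 by simp
qed

lemma form_W:
  assumes "invariant_form Y B" "w \<in> W Y"
  shows "B (w u) (w v) = B u v"
  using assms(2)
proof (induction w rule: W_induct)
  case (refl i w)
  then show ?case using assms(1) by (auto simp: invariant_form_def)
qed simp

lemma form_expansion:
  assumes "invariant_form Y B"
  shows "B w v = (\<Sum>j\<in>UNIV. v $ j * B w (\<alpha> j))"
proof -
  have zero: "B w 0 = 0" using form_scale2[OF assms, where c = 0 and v = 0 and w = w] by simp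
  have "B w (\<Sum>j\<in>S. v $ j *s \<alpha> j) = (\<Sum>j\<in>S. v $ j * B w (\<alpha> j))" for S
    by (induction S rule: infinite_finite_induct) (simp_all add: zero form_add2[OF assms] form_scale2[OF assms])
  from this[of UNIV] show ?thesis unfolding root_expansion[symmetric] .
qed

text \<open>Invariance under \<open>s\<^sub>j\<close> forces the value of the form on \<open>\<alpha>\<^sub>j\<close>.\<close>

lemma form_coroot:
  assumes "invariant_form Y B" "j \<in> Y"
  shows "2 * B v (\<alpha> j) = coroot j v * B (\<alpha> j) (\<alpha> j)"
proof -
  note form = invariant_formD[OF assms(1)]
  have "B (r j v) (r j (\<alpha> j)) = B v (\<alpha> j)"
    using assms unfolding invariant_form_def by blast
  moreover have "B (r j v) (r j (\<alpha> j)) = - B v (\<alpha> j) + coroot j v * B (\<alpha> j) (\<alpha> j)"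
    unfolding refl_self by (simp add: refl_eq form)
  ultimately show ?thesis by simp
qed

text \<open>The pairing with a coroot is determined by any invariant form, so isometries transport it.\<close>

lemma form_isometry_conj:
  assumes "invariant_form Y B" "lin f" "\<And>u v. B (f u) (f v) = B u v"
    and ik: "i \<in> Y" "k \<in> Y" "f (\<alpha> i) = \<alpha> k"
  shows "coroot k (f v) = coroot i v" and "f (r i v) = r k (f v)"
proof -
  have "B (\<alpha> k) (\<alpha> k) = B (\<alpha> i) (\<alpha> i)" using assms(3)[of "\<alpha> i" "\<alpha> i"] ik by simp
  moreover have "B (f v) (\<alpha> k) = B v (\<alpha> i)" using assms(3)[of v "\<alpha> i"] ik by simp
  moreover have "B (\<alpha> i) (\<alpha> i) > 0" using assms(1) ik(1) by (auto simp: invariant_form_def)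
  ultimately show "coroot k (f v) = coroot i v"
    using form_coroot[OF assms(1) ik(1), of v] form_coroot[OF assms(1) ik(2), of "f v"] by simp
  then show "f (r i v) = r k (f v)" using lin_diff[OF assms(2)] lin_scale[OF assms(2)] ik(3)
    by (simp add: refl_eq)
qed

text \<open>The form is given by the symmetrized Cartan matrix.\<close>

lemma symmetrizable_form:
  assumes "symmetrizable A"
  obtains B where "invariant_form UNIV B"
proof -
  obtain \<epsilon> :: "'i \<Rightarrow> int" where \<epsilon>: "\<And>i. \<epsilon> i > 0" "\<And>i j. \<epsilon> i * A $ i $ j = \<epsilon> j * A $ j $ i"
    using assms by (auto simp: symmetrizable_def)
  define B where "B u v = (\<Sum>i\<in>UNIV. u $ i * of_int (\<epsilon> i) * coroot i v)" for u v
  have add: "B (u + v) w = B u w + B v w" for u v w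
    by (simp add: B_def algebra_simps sum.distrib)
  have scale: "B (c *s v) w = c * B v w" for c v w
    by (simp add: B_def algebra_simps sum_distrib_left)
  have sym: "B u v = B v u" for u v
  proof -
    have e: "rat_of_int (\<epsilon> i) * of_int (A $ i $ j) = of_int (\<epsilon> j) * of_int (A $ j $ i)" for i j
      using \<epsilon>(2) by (metis of_int_mult)
    have "B u v = (\<Sum>i\<in>UNIV. \<Sum>j\<in>UNIV. u $ i * v $ j * (of_int (\<epsilon> i) * of_int (A $ i $ j)))"
      by (simp add: B_def coroot_def sum_distrib_left algebra_simps)
    also have "\<dots> = (\<Sum>j\<in>UNIV. \<Sum>i\<in>UNIV. u $ i * v $ j * (of_int (\<epsilon> i) * of_int (A $ i $ j)))"
      by (rule sum.swap)
    also have "\<dots> = B v u"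
      unfolding e by (simp add: B_def coroot_def sum_distrib_left algebra_simps)
    finally show ?thesis .
  qed
  have root: "B (\<alpha> i) v = of_int (\<epsilon> i) * coroot i v" for i v
  proof -
    have "B (\<alpha> i) v = (\<Sum>j\<in>UNIV. if i = j then of_int (\<epsilon> j) * coroot j v else 0)"
      unfolding B_def by (rule sum.cong) (auto simp: simple_root_nth)
    then show ?thesis by simp
  qed
  have root2: "B v (\<alpha> i) = of_int (\<epsilon> i) * coroot i v" for i v using root sym by metis
  have m: "B (u - c *s v) w = B u w - c * B v w" for u v w c
    using add[of u "(- c) *s v" w] scale[of "- c" v w] by simp
  have m2: "B w (u - c *s v) = B w u - c * B w v" for u v w c using m sym by metis
  have "B (r j u) (r j v) = B u v" for j u v
    unfolding refl_eq m m2 root root2 coroot_diff coroot_scale coroot_simple_root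
    by (simp add: algebra_simps)
  moreover have "B (\<alpha> j) (\<alpha> j) > 0" for j using \<epsilon>(1)[of j] by (simp add: root coroot_simple_root)
  ultimately have "invariant_form UNIV B" using add scale sym by (auto simp: invariant_form_def)
  then show thesis by (rule that)
qed

text \<open>For finite \<open>W\<^sub>Y\<close>, averaging the standard scalar product gives an invariant form that is positive
  definite and inherits the symmetries of the diagram.\<close>

definition averaged_form :: "'i set \<Rightarrow> rat^'i \<Rightarrow> rat^'i \<Rightarrow> rat" where
  "averaged_form Y u v = (\<Sum>w\<in>W Y. \<Sum>j\<in>UNIV. w u $ j * w v $ j)"

lemma averaged_form_positive:
  assumes "finite_type A Y" "v \<noteq> 0"
  shows "averaged_form Y v v > 0"
  unfolding averaged_form_def
proof (rule sum_pos2[of _ id])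
  show "finite (W Y)" using assms(1) by (simp add: finite_type_W)
  show "id \<in> W Y" by simp
  obtain k where "v $ k \<noteq> 0" using assms(2) by (auto simp: vec_eq_iff)
  then show "0 < (\<Sum>j\<in>UNIV. id v $ j * id v $ j)"
    by (intro sum_pos2[of _ k]) (auto simp: zero_less_mult_iff not_less)
qed (auto intro!: sum_nonneg)

lemma averaged_form_invariant:
  assumes "finite_type A Y"
  shows "invariant_form Y (averaged_form Y)"
  unfolding invariant_form_def
proof (intro conjI allI ballI)
  fix u v w :: "rat^'i" and c
  have lin: "x \<in> W Y \<Longrightarrow> lin x" for x by (rule W_lin)
  show "averaged_form Y (u + v) w = averaged_form Y u w + averaged_form Y v w"
    unfolding averaged_form_def sum.distrib[symmetric]
    by (intro sum.cong) (auto simp: lin lin_add algebra_simps)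
  show "averaged_form Y (c *s v) w = c * averaged_form Y v w"
    unfolding averaged_form_def sum_distrib_left
    by (intro sum.cong) (auto simp: lin lin_scale algebra_simps)
  show "averaged_form Y u v = averaged_form Y v u"
    by (simp add: averaged_form_def mult.commute)
next
  fix j u v assume j: "j \<in> Y"
  have "bij_betw (\<lambda>w. w \<circ> r j) (W Y) (W Y)"
    by (rule bij_betwI[of _ _ _ "\<lambda>w. w \<circ> r j"])
      (use j in \<open>auto intro!: W_comp simp: comp_assoc refl_comp_refl\<close>)
  from sum.reindex_bij_betw[OF this, of "\<lambda>w. \<Sum>j\<in>UNIV. w u $ j * w v $ j"]
  show "averaged_form Y (r j u) (r j v) = averaged_form Y u v"
    by (simp add: averaged_form_def)
next
  fix j assume "j \<in> Y"
  have "\<alpha> j \<noteq> (0 :: rat^'i)" using \<Phi>_nonzero by auto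
  then show "0 < averaged_form Y (\<alpha> j) (\<alpha> j)" using assms by (intro averaged_form_positive)
qed

section \<open>Diagram automorphisms\<close>

definition permute :: "('i \<Rightarrow> 'i) \<Rightarrow> rat^'i \<Rightarrow> rat^'i" where
  "permute \<tau> v = (\<chi> j. v $ (\<tau> j))"

lemma lin_permute: "lin (permute \<tau>)"
  by (simp add: lin_def permute_def vec_eq_iff)

lemma permute_nth: "permute \<tau> v $ j = v $ (\<tau> j)" by (simp add: permute_def)

lemma Pos_permute: "Pos v \<Longrightarrow> Pos (permute \<tau> v)" by (simp add: Pos_def permute_nth)

definition diagram_involution :: "('i \<Rightarrow> 'i) \<Rightarrow> bool" where
  "diagram_involution \<tau> \<longleftrightarrow> (\<forall>i. \<tau> (\<tau> i) = i) \<and> (\<forall>i j. A $ \<tau> i $ \<tau> j = A $ i $ j)"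

context
  fixes \<tau> :: "'i \<Rightarrow> 'i"
  assumes \<tau>: "diagram_involution \<tau>"
begin

lemma \<tau>_\<tau> [simp]: "\<tau> (\<tau> i) = i" and \<tau>_A [simp]: "A $ \<tau> i $ \<tau> j = A $ i $ j"
  using \<tau> by (auto simp: diagram_involution_def)

lemma \<tau>_eq_iff [simp]: "\<tau> i = \<tau> j \<longleftrightarrow> i = j" by (metis \<tau>_\<tau>)

lemma \<tau>_bij: "bij \<tau>" by (rule involuntory_imp_bij) simp

lemma permute_permute [simp]: "permute \<tau> (permute \<tau> v) = v"
  by (simp add: permute_def vec_eq_iff)

lemma permute_simple_root [simp]: "permute \<tau> (\<alpha> i) = \<alpha> (\<tau> i)"
  by (auto simp: vec_eq_iff permute_nth simple_root_nth)

lemma sum_\<tau>: "(\<Sum>j\<in>UNIV. f (\<tau> j)) = (\<Sum>j\<in>UNIV. f j)"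
  using sum.reindex_bij_betw[OF \<tau>_bij, of f] by simp

lemma coroot_permute: "coroot (\<tau> i) (permute \<tau> v) = coroot i v"
proof -
  have "coroot (\<tau> i) (permute \<tau> v) = (\<Sum>j\<in>UNIV. v $ \<tau> j * of_int (A $ \<tau> i $ \<tau> (\<tau> j)))"
    by (simp add: coroot_def permute_nth)
  also have "\<dots> = (\<Sum>j\<in>UNIV. v $ j * of_int (A $ \<tau> i $ \<tau> j))"
    by (rule sum_\<tau>)
  finally show ?thesis by (simp add: coroot_def)
qed

lemma permute_refl: "permute \<tau> (r i v) = r (\<tau> i) (permute \<tau> v)"
  by (simp add: refl_eq lin_diff[OF lin_permute] lin_scale[OF lin_permute] coroot_permute)

lemma permute_W_conj:
  assumes "w \<in> W Y" "\<tau> ` Y \<subseteq> Y"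
  shows "permute \<tau> \<circ> w \<circ> permute \<tau> \<in> W Y"
  using assms(1)
proof (induction w rule: W_induct)
  case id
  have "permute \<tau> \<circ> id \<circ> permute \<tau> = id" by (simp add: fun_eq_iff)
  then show ?case by (simp only: W_id)
next
  case (refl i w)
  have "permute \<tau> \<circ> (r i \<circ> w) \<circ> permute \<tau> = r (\<tau> i) \<circ> (permute \<tau> \<circ> w \<circ> permute \<tau>)"
    by (simp add: fun_eq_iff permute_refl)
  moreover have "r (\<tau> i) \<in> W Y" using refl assms(2) by (intro W_refl) auto
  ultimately show ?case using W_comp[OF _ refl(3)] by metis
qed

lemma permute_longest:
  assumes "finite_type A Y" "\<tau> ` Y \<subseteq> Y"
  shows "permute \<tau> (wl Y v) = wl Y (permute \<tau> v)"
proof -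
  have W: "wl Y \<in> W Y" using assms(1) by (rule longest_W)
  have "permute \<tau> \<circ> wl Y \<circ> permute \<tau> = wl Y"
  proof (rule longest_unique[OF assms(1)])
    show "permute \<tau> \<circ> wl Y \<circ> permute \<tau> \<in> W Y" using permute_W_conj[OF W assms(2)] .
    fix i assume "i \<in> Y"
    then have "Pos (- wl Y (\<alpha> (\<tau> i)))" using assms by (intro longest_negative) auto
    then have "Pos (permute \<tau> (- wl Y (\<alpha> (\<tau> i))))" by (rule Pos_permute)
    then show "Pos (- (permute \<tau> \<circ> wl Y \<circ> permute \<tau>) (\<alpha> i))"
      by (simp add: lin_minus[OF lin_permute])
  qed
  then have "(permute \<tau> \<circ> wl Y \<circ> permute \<tau>) (permute \<tau> v) = wl Y (permute \<tau> v)" by simp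
  then show ?thesis by simp
qed

lemma averaged_form_permute:
  assumes "\<tau> ` Y \<subseteq> Y"
  shows "averaged_form Y (permute \<tau> u) (permute \<tau> v) = averaged_form Y u v"
proof -
  let ?c = "\<lambda>w. permute \<tau> \<circ> w \<circ> permute \<tau>"
  have "bij_betw ?c (W Y) (W Y)"
    by (rule bij_betwI[of _ _ _ ?c]) (use assms permute_W_conj in \<open>auto simp: fun_eq_iff\<close>)
  from sum.reindex_bij_betw[OF this, of "\<lambda>w. \<Sum>j\<in>UNIV. w u $ j * w v $ j"]
  have "averaged_form Y u v =
      (\<Sum>w\<in>W Y. \<Sum>j\<in>UNIV. w (permute \<tau> u) $ \<tau> j * w (permute \<tau> v) $ \<tau> j)"
    by (simp add: averaged_form_def permute_nth)
  also have "\<dots> = averaged_form Y (permute \<tau> u) (permute \<tau> v)"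
    unfolding averaged_form_def
  proof (rule sum.cong[OF HOL.refl])
    fix w
    show "(\<Sum>j\<in>UNIV. w (permute \<tau> u) $ \<tau> j * w (permute \<tau> v) $ \<tau> j) =
        (\<Sum>j\<in>UNIV. w (permute \<tau> u) $ j * w (permute \<tau> v) $ j)"
      by (rule sum_\<tau>[of "\<lambda>j. w (permute \<tau> u) $ j * w (permute \<tau> v) $ j"])
  qed
  finally show ?thesis by simp
qed

end

section \<open>Components and weights\<close>

text \<open>A reflection in a vertex outside \<open>D\<close> fixes the simple roots of \<open>D\<close> if the vertex has no neighbour
  in \<open>D\<close>.\<close>

lemma W_supported_components:
  assumes "w \<in> W Y" "\<And>i j. i \<in> Y - D \<Longrightarrow> j \<in> D \<Longrightarrow> A $ i $ j = 0" "supported D v"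
  shows "supported D (w v)"
  using assms(1)
proof (induction w rule: W_induct)
  case (refl i w)
  show ?case
  proof (cases "i \<in> D")
    case True
    then show ?thesis using refl(3) unfolding supported_def by (metis comp_apply refl_nth)
  next
    case False
    have "coroot i (w v) = 0" unfolding coroot_def
    proof (rule sum.neutral, rule ballI)
      fix j
      show "w v $ j * rat_of_int (A $ i $ j) = 0"
        using assms(2)[of i j] refl False by (cases "j \<in> D") (auto simp: supported_def)
    qed
    then show ?thesis using refl(3) by (simp add: refl_eq)
  qed
qed (simp add: assms(3))

text \<open>The Weyl group acts trivially on the weight lattice modulo the root lattice.\<close>

lemma W_weight:
  assumes "w \<in> W Y" "\<And>j. j \<in> Y \<Longrightarrow> coroot j v \<in> \<int>"
  shows "integral_vec (w v - v)"
  using assms(1)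
proof (induction w rule: W_induct)
  case (refl i w)
  have "coroot i (w v) = coroot i (w v - v) + coroot i v" by (simp add: coroot_diff)
  then have "coroot i (w v) \<in> \<int>" using coroot_integral[OF refl(3)] assms(2)[OF refl(1)] by simp
  moreover have eq: "(r i \<circ> w) v - v = (w v - v) - coroot i (w v) *s \<alpha> i" by (simp add: refl_eq)
  ultimately show ?case using refl(3) unfolding eq
    by (auto simp: integral_vec_def simple_root_nth intro: Ints_diff)
qed (simp add: integral_vec_def)

end

section \<open>Compatible decorations\<close>

locale decoration = gcm A for A :: "int^'i^'i::finite" +
  fixes X :: "'i set" and \<tau> :: "'i \<Rightarrow> 'i"
  assumes decoration: "compatible_decoration A X \<tau>"
begin

abbreviation T :: "rat^'i \<Rightarrow> rat^'i" where "T \<equiv> permute \<tau>"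

lemma finite_X: "finite_type A X" and \<tau>_X: "\<tau> ` X \<subseteq> X"
  using decoration by (auto simp: compatible_decoration_def)

lemma \<tau>_involution: "diagram_involution \<tau>"
proof -
  have "\<tau> \<circ> \<tau> = id" "\<forall>i j. A $ \<tau> i $ \<tau> j = A $ i $ j"
    using decoration by (simp_all add: compatible_decoration_def diagram_auts_def)
  then show ?thesis unfolding diagram_involution_def by (metis comp_apply id_apply)
qed

lemmas \<tau>_simps [simp] = \<tau>_\<tau>[OF \<tau>_involution] \<tau>_A[OF \<tau>_involution] \<tau>_eq_iff[OF \<tau>_involution]
  permute_permute[OF \<tau>_involution] permute_simple_root[OF \<tau>_involution]

lemma \<tau>_in_X [simp]: "\<tau> j \<in> X \<longleftrightarrow> j \<in> X"
  using \<tau>_X \<tau>_simps(1) by (metis image_subset_iff)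

lemma longest_X: "j \<in> X \<Longrightarrow> wl X (\<alpha> j) = - \<alpha> (\<tau> j)"
  using longest_opp_inv[OF finite_X] decoration by (auto simp: compatible_decoration_def)

lemmas wX_W = longest_W[OF finite_X]
lemmas wX_lin = W_lin[OF wX_W]
lemmas wX_wX = longest_longest[OF finite_X]
lemmas T_lin = lin_permute[of \<tau>]
lemmas T_wX = permute_longest[OF \<tau>_involution finite_X \<tau>_X]

section \<open>The opposition involution of a rank one diagram\<close>

context
  fixes i :: 'i and Y :: "'i set"
  assumes i: "i \<notin> X" and Y: "Y = insert i (insert (\<tau> i) X)" and finite_Y: "finite_type A Y"
begin

abbreviation \<mu> :: "'i \<Rightarrow> 'i" where "\<mu> \<equiv> opp_inv A Y"
abbreviation \<beta> :: "rat^'i \<Rightarrow> rat^'i \<Rightarrow> rat" where "\<beta> \<equiv> averaged_form Y"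

definition opp :: "rat^'i \<Rightarrow> rat^'i" where "opp v = - wl Y v"

text \<open>This vector spans the eigenspace of \<open>- w\<^sub>X \<tau>\<close> for the eigenvalue \<open>-1\<close> on the span of the roots of
  \<open>Y\<close>.\<close>

definition \<omega> :: "rat^'i" where "\<omega> = \<alpha> i + wl X (\<alpha> (\<tau> i))"

text \<open>With this functional, \<open>- w\<^sub>X \<tau>\<close> is the reflection \<open>v \<mapsto> v - \<phi> v \<omega>\<close> on the span of the roots of \<open>Y\<close>.\<close>

definition \<phi> :: "rat^'i \<Rightarrow> rat" where "\<phi> v = (if \<tau> i = i then v $ i else v $ i + v $ \<tau> i)"

lemma \<tau>_Y: "\<tau> ` Y \<subseteq> Y" using Y \<tau>_X by auto

lemmas wY_W = longest_W[OF finite_Y]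
lemmas form_inv = averaged_form_invariant[OF finite_Y]
lemmas form = invariant_formD[OF form_inv]
lemmas form_T = averaged_form_permute[OF \<tau>_involution \<tau>_Y]

lemma X_Y: "X \<subseteq> Y" using Y by auto

lemma opp_lin: "lin opp" using lin_uminus[OF W_lin[OF wY_W]] by (simp add: opp_def[abs_def])

lemma opp_opp: "opp (opp v) = v"
  using longest_longest[OF finite_Y] lin_minus[OF W_lin[OF wY_W]] by (simp add: opp_def)

lemma opp_isometry: "\<beta> (opp u) (opp v) = \<beta> u v"
  using form_W[OF form_inv wY_W] by (simp add: opp_def form)

lemma opp_simple_root: "j \<in> Y \<Longrightarrow> opp (\<alpha> j) = \<alpha> (\<mu> j)"
  using longest_opp_inv[OF finite_Y] by (simp add: opp_def)

lemma wY_opp: "wl Y v = - opp v" by (simp add: opp_def)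

lemma T_opp: "T (opp v) = opp (T v)"
  using permute_longest[OF \<tau>_involution finite_Y \<tau>_Y] by (simp add: opp_def lin_minus[OF T_lin])

lemma \<mu>_Y: "j \<in> Y \<Longrightarrow> \<mu> j \<in> Y" and \<mu>_\<mu>: "j \<in> Y \<Longrightarrow> \<mu> (\<mu> j) = j"
  using opp_inv_in[OF finite_Y] opp_inv_opp_inv[OF finite_Y] by auto

lemma \<mu>_\<tau>: "j \<in> Y \<Longrightarrow> \<mu> (\<tau> j) = \<tau> (\<mu> j)"
proof -
  assume j: "j \<in> Y"
  then have "\<tau> j \<in> Y" using \<tau>_Y by auto
  then have "\<alpha> (\<mu> (\<tau> j)) = \<alpha> (\<tau> (\<mu> j))"
    using T_opp[of "\<alpha> j"] j by (simp add: opp_simple_root)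
  then show ?thesis by simp
qed

lemma \<mu>_A: "p \<in> Y \<Longrightarrow> q \<in> Y \<Longrightarrow> A $ \<mu> p $ \<mu> q = A $ p $ q"
proof -
  assume pq: "p \<in> Y" "q \<in> Y"
  have "coroot (\<mu> p) (opp (\<alpha> q)) = coroot p (\<alpha> q)"
    using form_isometry_conj(1)[OF form_inv opp_lin opp_isometry pq(1) \<mu>_Y[OF pq(1)] opp_simple_root[OF pq(1)]] .
  then show ?thesis using pq by (simp add: opp_simple_root coroot_simple_root)
qed

lemma opp_nth:
  assumes "supported Y v" "j \<in> Y"
  shows "opp v $ (\<mu> j) = v $ j"
proof -
  have "v $ l * opp (\<alpha> l) $ (\<mu> j) = (if l = j then v $ l else 0)" for l
  proof (cases "l \<in> Y")
    case True
    then have "\<mu> l = \<mu> j \<longleftrightarrow> l = j" using \<mu>_\<mu> assms(2) by metis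
    then show ?thesis using True by (auto simp: opp_simple_root simple_root_nth)
  next
    case False
    then show ?thesis using assms by (auto simp: supported_def)
  qed
  then show ?thesis by (subst lin_nth[OF opp_lin]) simp
qed

lemma opp_Pos: "supported Y v \<Longrightarrow> Pos v \<Longrightarrow> Pos (opp v)"
proof (rule lin_Pos[OF opp_lin])
  fix j assume "supported Y v" "v $ j \<noteq> 0"
  then have "j \<in> Y" by (auto simp: supported_def)
  then show "Pos (opp (\<alpha> j))" by (simp add: opp_simple_root)
qed

lemma opp_supported: "supported Y v \<Longrightarrow> supported Y (opp v)"
  using W_supported[OF wY_W] by (simp add: opp_def)

lemma \<omega>_nth: "l \<notin> X \<Longrightarrow> \<omega> $ l = \<alpha> i $ l + \<alpha> (\<tau> i) $ l"
  by (simp add: \<omega>_def W_nth[OF wX_W])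

lemma \<omega>_root: "wl X (\<alpha> (\<tau> i)) \<in> \<Phi>" "Pos (wl X (\<alpha> (\<tau> i)))"
proof -
  show 1: "wl X (\<alpha> (\<tau> i)) \<in> \<Phi>" using W_\<Phi>[OF wX_W] by simp
  have "wl X (\<alpha> (\<tau> i)) $ \<tau> i = 1" using i by (simp add: W_nth[OF wX_W] simple_root_nth)
  then show "Pos (wl X (\<alpha> (\<tau> i)))" using \<Phi>_Pos_coord[OF 1, of "\<tau> i"] by simp
qed

lemma \<omega>_Pos: "Pos \<omega>" using \<omega>_root(2) by (simp add: \<omega>_def Pos_add)

lemma \<omega>_integral: "integral_vec \<omega>"
  using \<Phi>_integral[OF \<omega>_root(1)] integral_simple_root[of i] by (simp add: \<omega>_def integral_vec_def)

lemma \<omega>_supported: "supported Y \<omega>"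
  using Y by (auto simp: supported_def \<omega>_nth simple_root_nth)

lemma \<phi>_\<omega>: "\<phi> \<omega> = 2"
  using i by (auto simp: \<phi>_def \<omega>_nth simple_root_nth)

text \<open>Moving \<open>w\<^sub>X\<close> to the other side turns \<open>\<alpha>\<^sub>j\<close> into \<open>- \<alpha>\<^bsub>\<tau> j\<^esub>\<close>, and the form is invariant under
  \<open>\<tau>\<close>.\<close>

lemma \<omega>_perp: "j \<in> X \<Longrightarrow> \<beta> \<omega> (\<alpha> j) = 0"
proof -
  assume j: "j \<in> X"
  have wXY: "wl X \<in> W Y" using wX_W X_Y by (rule W_mono)
  have "\<beta> (wl X (\<alpha> (\<tau> i))) (\<alpha> j) = \<beta> (wl X (wl X (\<alpha> (\<tau> i)))) (wl X (\<alpha> j))"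
    using form_W[OF form_inv wXY] by simp
  also have "\<dots> = - \<beta> (\<alpha> (\<tau> i)) (\<alpha> (\<tau> j))" using j by (simp add: wX_wX longest_X form)
  also have "\<dots> = - \<beta> (\<alpha> i) (\<alpha> j)" using form_T[of "\<alpha> i" "\<alpha> j"] by simp
  finally show ?thesis by (simp add: \<omega>_def form)
qed

lemma coroot_zero_iff: "j \<in> Y \<Longrightarrow> coroot j v = 0 \<longleftrightarrow> \<beta> v (\<alpha> j) = 0"
  using form_coroot[OF form_inv, of j v] form_inv by (auto simp: invariant_form_def)

lemma coroot_\<omega>: "j \<in> X \<Longrightarrow> coroot j \<omega> = 0"
  using \<omega>_perp X_Y by (subst coroot_zero_iff) auto

lemma W_X_\<omega>: "w \<in> W X \<Longrightarrow> w \<omega> = \<omega>"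
  by (induction w rule: W_induct) (simp_all add: refl_eq coroot_\<omega>)

lemma T_\<omega>: "T \<omega> = \<omega>"
proof -
  have "wl X \<omega> = \<alpha> (\<tau> i) + wl X (\<alpha> i)" by (simp add: \<omega>_def lin_add[OF wX_lin] wX_wX)
  then have "T \<omega> = wl X \<omega>" by (simp add: \<omega>_def lin_add[OF T_lin] T_wX)
  then show ?thesis using W_X_\<omega>[OF wX_W] by simp
qed

lemma form_\<omega>:
  assumes "supported Y v"
  shows "\<beta> \<omega> v = \<phi> v * \<beta> \<omega> (\<alpha> i)"
proof -
  have \<tau>i: "\<beta> \<omega> (\<alpha> (\<tau> i)) = \<beta> \<omega> (\<alpha> i)" using form_T[of \<omega> "\<alpha> i"] T_\<omega> by simp
  have "\<beta> \<omega> v = (\<Sum>j\<in>{i, \<tau> i}. v $ j * \<beta> \<omega> (\<alpha> j))"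
    unfolding form_expansion[OF form_inv, of \<omega> v]
  proof (rule sum.mono_neutral_right)
    show "\<forall>j\<in>UNIV - {i, \<tau> i}. v $ j * \<beta> \<omega> (\<alpha> j) = 0"
      using assms \<omega>_perp Y by (auto simp: supported_def)
  qed auto
  also have "\<dots> = \<phi> v * \<beta> \<omega> (\<alpha> i)"
    by (cases "\<tau> i = i") (auto simp: \<phi>_def \<tau>i algebra_simps)
  finally show ?thesis .
qed

lemma form_\<omega>_\<omega>: "\<beta> \<omega> \<omega> = 2 * \<beta> \<omega> (\<alpha> i)" and form_\<omega>_\<omega>_pos: "\<beta> \<omega> \<omega> > 0"
proof -
  show "\<beta> \<omega> \<omega> = 2 * \<beta> \<omega> (\<alpha> i)" using form_\<omega>[OF \<omega>_supported] \<phi>_\<omega> by simp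
  have "\<omega> \<noteq> 0" using \<phi>_\<omega> by (auto simp: \<phi>_def split: if_splits)
  then show "\<beta> \<omega> \<omega> > 0" by (rule averaged_form_positive[OF finite_Y])
qed

text \<open>From here on the opposition involution is assumed to move \<open>i\<close> into \<open>X\<close>; the aim is type
  \<open>A\<^sub>2\<close>.\<close>

context
  fixes k :: 'i
  assumes k: "\<mu> i = k" "k \<in> X"
begin

lemma i_Y: "i \<in> Y" and k_Y: "k \<in> Y" and \<mu>_k: "\<mu> k = i"
  using Y k \<mu>_\<mu>[of i] by auto

definition \<omega>' :: "rat^'i" where "\<omega>' = opp \<omega>"

lemma \<omega>'_supported: "supported Y \<omega>'" using opp_supported[OF \<omega>_supported] by (simp add: \<omega>'_def)

lemma \<omega>'_nth: "j \<in> Y \<Longrightarrow> \<omega>' $ (\<mu> j) = \<omega> $ j"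
  using opp_nth[OF \<omega>_supported] by (simp add: \<omega>'_def)

lemma \<omega>'_perp: "j \<in> X \<Longrightarrow> \<beta> \<omega>' (\<alpha> (\<mu> j)) = 0"
  using opp_isometry[of \<omega> "\<alpha> j"] opp_simple_root[of j] \<omega>_perp[of j] X_Y by (auto simp: \<omega>'_def)

lemma \<phi>_\<omega>': "\<phi> \<omega>' = (if \<tau> i = i then \<omega> $ k else 2 * \<omega> $ k)"
proof -
  have 1: "\<omega>' $ i = \<omega> $ k" using \<omega>'_nth[OF k_Y] \<mu>_k by simp
  have "\<tau> k \<in> Y" using k_Y \<tau>_Y by auto
  then have "\<omega>' $ (\<tau> i) = \<omega> $ (\<tau> k)" using \<omega>'_nth[of "\<tau> k"] \<mu>_\<tau>[OF k_Y] \<mu>_k by simp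
  moreover have "\<omega> $ (\<tau> k) = \<omega> $ k" using T_\<omega> permute_nth[of \<tau> \<omega> k] by simp
  ultimately show ?thesis using 1 by (simp add: \<phi>_def)
qed

text \<open>The vector \<open>\<omega>\<close> cannot vanish on a neighbour of a vertex of its support, because it is
  nonnegative and orthogonal to the roots of \<open>X\<close>.\<close>

lemma \<omega>_zero_not_adjacent:
  assumes "\<omega> $ j = 0" "j \<in> Y" "\<omega> $ l \<noteq> 0"
  shows "A $ j $ l = 0"
proof -
  have jX: "j \<in> X" using assms(1,2) Y \<omega>_nth[of j] i by (auto simp: simple_root_nth split: if_splits)
  have le: "\<omega> $ m * rat_of_int (A $ j $ m) \<le> 0" for m
    using assms(1) off_diag[of j m] Pos_nth[OF \<omega>_Pos, of m] by (cases "m = j") (auto simp: mult_nonneg_nonpos)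
  have "(\<Sum>m\<in>UNIV. - (\<omega> $ m * rat_of_int (A $ j $ m))) = 0"
    using coroot_\<omega>[OF jX] by (simp add: coroot_def sum_negf)
  then have "- (\<omega> $ l * rat_of_int (A $ j $ l)) = 0"
    using le by (subst (asm) sum_nonneg_eq_0_iff) auto
  then show ?thesis using assms(3) by simp
qed

text \<open>Otherwise the zero set of \<open>\<omega>\<close> in \<open>Y\<close> would be a union of components containing \<open>k\<close> but not
  \<open>i\<close>, although \<open>w\<^sub>Y\<close> maps \<open>\<alpha>\<^sub>k\<close> to \<open>- \<alpha>\<^sub>i\<close>.\<close>

lemma \<omega>_k: "\<omega> $ k \<noteq> 0"
proof
  assume 0: "\<omega> $ k = 0"
  define D where "D = {j \<in> Y. \<omega> $ j = 0}"
  have "supported D (wl Y (\<alpha> k))"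
  proof (rule W_supported_components[OF wY_W])
    show "supported D (\<alpha> k)" using 0 k_Y by (simp add: D_def supported_simple_root)
    fix p q assume "p \<in> Y - D" "q \<in> D"
    then show "A $ p $ q = 0" using \<omega>_zero_not_adjacent[of q p] zero_sym[of p q] by (auto simp: D_def)
  qed
  then have "supported D (\<alpha> i)" using longest_opp_inv[OF finite_Y k_Y] \<mu>_k by simp
  then have "\<omega> $ i = 0" by (simp add: D_def supported_simple_root)
  then show False using \<omega>_nth[OF i] by (auto simp: simple_root_nth split: if_splits)
qed

lemma \<omega>_neq_\<omega>': "\<omega> \<noteq> \<omega>'"
proof
  assume "\<omega> = \<omega>'"
  then have "\<beta> \<omega> (\<alpha> i) = 0" using \<omega>'_perp[OF k(2)] \<mu>_k by simp
  then show False using form_\<omega>_\<omega> form_\<omega>_\<omega>_pos by simp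
qed

text \<open>By the Cauchy-Schwarz inequality the integer \<open>\<phi> \<omega>' = 2 (\<omega>, \<omega>') / (\<omega>, \<omega>)\<close> is less than 2. If \<open>\<tau>\<close>
  moved \<open>i\<close>, it would be even and positive.\<close>

lemma \<tau>_i: "\<tau> i = i" and \<omega>_k_1: "\<omega> $ k = 1"
proof -
  have "\<beta> \<omega> \<omega>' = \<phi> \<omega>' * \<beta> \<omega> (\<alpha> i)" by (rule form_\<omega>[OF \<omega>'_supported])
  then have "2 * \<beta> \<omega> \<omega>' = \<phi> \<omega>' * \<beta> \<omega> \<omega>" using form_\<omega>_\<omega> by simp
  moreover have "\<beta> \<omega>' \<omega>' = \<beta> \<omega> \<omega>" by (simp add: \<omega>'_def opp_isometry)
  moreover have "\<beta> (\<omega> - \<omega>') (\<omega> - \<omega>') > 0"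
    using averaged_form_positive[OF finite_Y, of "\<omega> - \<omega>'"] \<omega>_neq_\<omega>' by simp
  moreover have "\<beta> (\<omega> - \<omega>') (\<omega> - \<omega>') = \<beta> \<omega> \<omega> - 2 * \<beta> \<omega> \<omega>' + \<beta> \<omega>' \<omega>'"
    using form(3)[of \<omega> \<omega>'] by (simp add: form(8,9))
  ultimately have "(2 - \<phi> \<omega>') * \<beta> \<omega> \<omega> > 0" by (simp add: algebra_simps)
  then have less: "\<phi> \<omega>' < 2" using form_\<omega>_\<omega>_pos by (simp add: zero_less_mult_iff)
  obtain n where n: "\<omega> $ k = of_int n"
    using \<omega>_integral by (auto simp: integral_vec_def elim: Ints_cases)
  have "n > 0" using n \<omega>_k Pos_nth[OF \<omega>_Pos, of k] by simp
  moreover have "2 * \<omega> $ k < 2 \<longrightarrow> n < 1" "\<omega> $ k < 2 \<longrightarrow> n < 2" unfolding n by auto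
  ultimately show "\<tau> i = i" "\<omega> $ k = 1" using less \<phi>_\<omega>' n by (auto split: if_splits)
qed

lemma \<tau>_k: "\<tau> k = k" using \<mu>_\<tau>[OF i_Y] \<tau>_i k(1) by simp

lemma k_neq_i: "k \<noteq> i" using i k(2) by auto

lemma Y_eq: "Y = insert i X" using Y \<tau>_i by simp

lemma \<omega>_i: "\<omega> $ i = 2" using \<omega>_nth[OF i] \<tau>_i by (simp add: simple_root_nth)

lemma \<omega>'_i: "\<omega>' $ i = 1" using \<omega>'_nth[OF k_Y] \<mu>_k \<omega>_k_1 by simp
lemma \<omega>'_k: "\<omega>' $ k = 2" using \<omega>'_nth[OF i_Y] k(1) \<omega>_i by simp

lemma wX_Y: "supported Y v \<Longrightarrow> wl X v = (v $ i) *s \<omega> - T v"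
proof (rule lin_eqI[OF wX_lin])
  show "lin (\<lambda>v. (v $ i) *s \<omega> - T v)"
    using T_lin by (simp add: lin_def vec_eq_iff algebra_simps)
  fix j assume "supported Y v" "v $ j \<noteq> 0"
  then have "j \<in> Y" by (auto simp: supported_def)
  then show "wl X (\<alpha> j) = (\<alpha> j $ i) *s \<omega> - T (\<alpha> j)"
    using \<tau>_i i by (cases "j = i") (auto simp: Y_eq longest_X simple_root_nth \<omega>_def)
qed

text \<open>On the span of the roots of \<open>Y\<close> this is the product of the reflections in \<open>\<omega>\<close> and \<open>\<omega>'\<close>, a rotation of
  order 3.\<close>

definition \<rho> :: "rat^'i \<Rightarrow> rat^'i" where "\<rho> = wl X \<circ> wl Y \<circ> wl X \<circ> wl Y"

lemma \<rho>_W: "\<rho> \<in> W Y"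
  unfolding \<rho>_def using wY_W W_mono[OF wX_W X_Y] by (intro W_comp)

lemma \<rho>_i: "\<rho> (\<alpha> i) = \<alpha> i - \<omega>"
proof -
  have 1: "wl Y (\<alpha> i) = - \<alpha> k" "wl Y (\<alpha> k) = - \<alpha> i" "wl X (\<alpha> k) = - \<alpha> k"
    using longest_opp_inv[OF finite_Y] i_Y k_Y k \<mu>_k longest_X \<tau>_k by auto
  have 2: "wl X (\<alpha> i) = \<omega> - \<alpha> i" using \<tau>_i by (simp add: \<omega>_def)
  have "\<rho> (\<alpha> i) = wl X (wl Y (wl X (- \<alpha> k)))" by (simp add: \<rho>_def 1)
  also have "\<dots> = wl X (wl Y (\<alpha> k))" by (simp add: lin_minus[OF wX_lin] 1)
  also have "\<dots> = \<alpha> i - \<omega>" by (simp add: 1 2 lin_minus[OF wX_lin])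
  finally show ?thesis .
qed

lemma T_\<omega>': "T \<omega>' = \<omega>'" by (simp add: \<omega>'_def T_opp T_\<omega>)

lemma \<rho>_k: "\<rho> (\<alpha> k) = \<omega> - \<omega>' + \<alpha> k"
proof -
  have 1: "wl Y (\<alpha> i) = - \<alpha> k" "wl Y (\<alpha> k) = - \<alpha> i"
    using longest_opp_inv[OF finite_Y] i_Y k_Y k \<mu>_k by auto
  have 2: "wl X (\<alpha> i) = \<omega> - \<alpha> i" using \<tau>_i by (simp add: \<omega>_def)
  have sup: "supported Y (\<omega>' - \<alpha> k)"
    using \<omega>'_supported k_Y by (auto simp: supported_def simple_root_nth)
  have "\<rho> (\<alpha> k) = wl X (wl Y (wl X (- \<alpha> i)))" by (simp add: \<rho>_def 1)
  also have "wl X (- \<alpha> i) = \<alpha> i - \<omega>" by (simp add: lin_minus[OF wX_lin] 2)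
  also have "wl Y (\<alpha> i - \<omega>) = \<omega>' - \<alpha> k"
    by (simp add: lin_diff[OF W_lin[OF wY_W]] 1 \<omega>'_def wY_opp[of \<omega>])
  also have "wl X (\<omega>' - \<alpha> k) = \<omega> - \<omega>' + \<alpha> k"
    unfolding wX_Y[OF sup]
    by (simp add: lin_diff[OF T_lin] T_\<omega>' \<tau>_k \<omega>'_i simple_root_nth k_neq_i)
  finally show ?thesis .
qed

text \<open>The root \<open>\<rho> \<alpha>\<^sub>k\<close> and its image under \<open>- w\<^sub>Y\<close> are nonnegative vectors with sum \<open>\<alpha>\<^sub>i + \<alpha>\<^sub>k\<close>.\<close>

lemma \<rho>_k_eq: "\<rho> (\<alpha> k) = \<alpha> i"
proof -
  define v where "v = \<rho> (\<alpha> k)"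
  have v: "v = \<omega> - \<omega>' + \<alpha> k" by (simp add: v_def \<rho>_k)
  have v_i: "v $ i = 1" and v_k: "v $ k = 0"
    unfolding v using k_neq_i by (auto simp: \<omega>_i \<omega>'_i \<omega>_k_1 \<omega>'_k simple_root_nth)
  have "v \<in> \<Phi>" using W_\<Phi>[OF \<rho>_W] by (simp add: v_def)
  then have pos: "Pos v" using \<Phi>_Pos_coord[of v i] v_i by simp
  have "supported Y v"
    unfolding v using \<omega>_supported \<omega>'_supported k_Y by (auto simp: supported_def simple_root_nth)
  then have posM: "Pos (opp v)" using pos by (rule opp_Pos)
  have "opp v = \<omega>' - \<omega> + \<alpha> i"
    unfolding v using opp_simple_root[OF k_Y] \<mu>_k
    by (simp add: lin_add[OF opp_lin] lin_diff[OF opp_lin] opp_opp \<omega>'_def)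
  then have sum: "v + opp v = \<alpha> i + \<alpha> k" unfolding v by simp
  have "v $ j = \<alpha> i $ j" for j
  proof (cases "j = i \<or> j = k")
    case True
    then show ?thesis using v_i v_k k_neq_i by (auto simp: simple_root_nth)
  next
    case False
    have "v $ j + opp v $ j = (\<alpha> i + \<alpha> k) $ j" using sum by (metis vector_add_component)
    then have "v $ j + opp v $ j = 0" using False by (auto simp: simple_root_nth)
    then show ?thesis using Pos_nth[OF pos, of j] Pos_nth[OF posM, of j] False
      by (auto simp: simple_root_nth)
  qed
  then show ?thesis by (simp add: v_def vec_eq_iff)
qed

lemma \<omega>_minus_\<omega>': "\<omega> - \<omega>' = \<alpha> i - \<alpha> k"
  using \<rho>_k \<rho>_k_eq by (simp add: algebra_simps)

text \<open>The roots \<open>\<alpha>\<^sub>j\<close> considered are orthogonal to both \<open>\<omega>\<close> and \<open>\<omega>'\<close>, whose difference is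
  \<open>\<alpha>\<^sub>i - \<alpha>\<^sub>k\<close>.\<close>

lemma same_neighbours: "j \<in> Y \<Longrightarrow> j \<noteq> i \<Longrightarrow> j \<noteq> k \<Longrightarrow> A $ j $ i = A $ j $ k"
proof -
  assume j: "j \<in> Y" "j \<noteq> i" "j \<noteq> k"
  then have jX: "j \<in> X" using Y_eq by auto
  have "\<mu> j \<noteq> i" using j k \<mu>_\<mu>[OF j(1)] by auto
  then have "\<mu> j \<in> X" using \<mu>_Y[OF j(1)] Y_eq by auto
  then have "coroot j \<omega>' = 0" using \<omega>'_perp[of "\<mu> j"] \<mu>_\<mu>[OF j(1)] coroot_zero_iff[OF j(1)] by simp
  then have "coroot j (\<omega> - \<omega>') = 0" using coroot_\<omega>[OF jX] by (simp add: coroot_diff)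
  then show ?thesis unfolding \<omega>_minus_\<omega>' by (simp add: coroot_simps)
qed

text \<open>If \<open>i\<close> and \<open>k\<close> were not adjacent, then \<open>(\<alpha>\<^sub>i + \<alpha>\<^sub>k) / 2\<close> would be a weight on which \<open>\<rho>\<close> acts
  nontrivially modulo the root lattice.\<close>

lemma adjacent: "A $ k $ i \<noteq> 0"
proof
  assume ki: "A $ k $ i = 0"
  then have ik: "A $ i $ k = 0" using zero_sym by blast
  define l where "l = (1/2) *s (\<alpha> i + \<alpha> k)"
  have "coroot j l \<in> \<int>" if "j \<in> Y" for j
  proof -
    have eq: "coroot j l = (of_int (A $ j $ i) + of_int (A $ j $ k)) / 2"
      by (simp add: l_def coroot_simps)
    show ?thesis
      using same_neighbours[OF that] ki ik unfolding eq by (cases "j = i"; cases "j = k") auto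
  qed
  then have "integral_vec (\<rho> l - l)" by (intro W_weight[OF \<rho>_W])
  moreover have "\<rho> l = (1/2) *s (\<alpha> i - \<omega> + \<alpha> i)"
    by (simp only: l_def lin_scale[OF W_lin[OF \<rho>_W]] lin_add[OF W_lin[OF \<rho>_W]] \<rho>_i \<rho>_k_eq)
  then have "(\<rho> l - l) $ i = - (1/2)"
    using k_neq_i by (simp add: l_def \<omega>_i simple_root_nth)
  ultimately have "(- (1/2) :: rat) \<in> \<int>" by (metis integral_vec_def)
  then obtain n where "(- (1/2) :: rat) = of_int n" by (rule Ints_cases)
  then have "rat_of_int (2 * n) = of_int (-1)" by simp
  then have "2 * n = -1" by (simp only: of_int_eq_iff)
  then show False by presburger
qed

lemma coroot_k_\<omega>: "0 = 2 * rat_of_int (A $ k $ i) + 2 + (\<Sum>l\<in>UNIV - {i, k}. \<omega> $ l * of_int (A $ k $ l))"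
proof -
  have "0 = (\<Sum>l\<in>UNIV. \<omega> $ l * of_int (A $ k $ l))" using coroot_\<omega>[OF k(2)] by (simp add: coroot_def)
  also have "\<dots> = (\<Sum>l\<in>{i, k}. \<omega> $ l * of_int (A $ k $ l)) + (\<Sum>l\<in>UNIV - {i, k}. \<omega> $ l * of_int (A $ k $ l))"
    by (subst sum.subset_diff[of "{i, k}"]) auto
  also have "(\<Sum>l\<in>{i, k}. \<omega> $ l * of_int (A $ k $ l)) = 2 * rat_of_int (A $ k $ i) + 2"
    using k_neq_i by (simp add: \<omega>_i \<omega>_k_1)
  finally show ?thesis .
qed

text \<open>The remaining terms in the orthogonality relation of \<open>\<omega>\<close> and \<open>\<alpha>\<^sub>k\<close> are nonpositive, which bounds
  \<open>a\<^sub>k\<^sub>i\<close> below by \<open>-1\<close>; equality makes all of them vanish.\<close>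

lemma \<omega>_A_k: "l \<noteq> k \<Longrightarrow> \<omega> $ l * rat_of_int (A $ k $ l) \<le> 0"
  using off_diag[of k l] Pos_nth[OF \<omega>_Pos, of l] by (simp add: mult_nonneg_nonpos)

lemma A_k_i: "A $ k $ i = -1"
proof -
  have "(\<Sum>l\<in>UNIV - {i, k}. \<omega> $ l * rat_of_int (A $ k $ l)) \<le> 0"
    using \<omega>_A_k by (intro sum_nonpos) auto
  then have "rat_of_int (A $ k $ i) \<ge> -1" using coroot_k_\<omega> by linarith
  then have "A $ k $ i \<ge> -1" by linarith
  then show ?thesis using adjacent off_diag[OF k_neq_i] by linarith
qed

lemma A_k_other: "l \<in> Y \<Longrightarrow> l \<noteq> i \<Longrightarrow> l \<noteq> k \<Longrightarrow> A $ k $ l = 0"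
proof -
  assume l: "l \<in> Y" "l \<noteq> i" "l \<noteq> k"
  have "(\<Sum>l\<in>UNIV - {i, k}. - (\<omega> $ l * rat_of_int (A $ k $ l))) = 0"
    using coroot_k_\<omega> A_k_i by (simp add: sum_negf)
  then have "- (\<omega> $ l * rat_of_int (A $ k $ l)) = 0"
    using \<omega>_A_k l by (subst (asm) sum_nonneg_eq_0_iff) auto
  then have "\<omega> $ l = 0 \<or> A $ k $ l = 0" by simp
  then show "A $ k $ l = 0"
    using \<omega>_zero_not_adjacent[of l k] l \<omega>_k_1 zero_sym[of k l] by auto
qed

lemma A_i_k: "A $ i $ k = -1" using \<mu>_A[OF k_Y i_Y] k \<mu>_k A_k_i by simp

lemma A_i_other: "l \<in> Y \<Longrightarrow> l \<noteq> i \<Longrightarrow> l \<noteq> k \<Longrightarrow> A $ i $ l = 0"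
proof -
  assume l: "l \<in> Y" "l \<noteq> i" "l \<noteq> k"
  then have "\<mu> l \<noteq> i" "\<mu> l \<noteq> k" using k \<mu>_\<mu>[of l] \<mu>_\<mu>[OF i_Y] \<mu>_k by auto
  then have "A $ k $ \<mu> l = 0" using A_k_other \<mu>_Y l by blast
  then show ?thesis using \<mu>_A[OF i_Y l(1)] k by simp
qed

lemma component_A2: "type_A2 A (diagram_component A Y i)"
proof -
  let ?E = "{(k, l). k \<in> Y \<and> l \<in> Y \<and> k \<noteq> l \<and> A $ k $ l \<noteq> 0}"
  have "j \<in> {i, k}" if "(i, j) \<in> ?E\<^sup>*" for j
    using that
  proof (induction rule: rtrancl_induct)
    case (step y z)
    then show ?case using A_k_other[of z] A_i_other[of z] by auto
  qed simp
  moreover have "(i, k) \<in> ?E\<^sup>*"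
    using i_Y k_Y k_neq_i A_i_k by (intro r_into_rtrancl) auto
  ultimately have "diagram_component A Y i = {i, k}" by (auto simp: diagram_component_def)
  then show ?thesis using k_neq_i A_i_k A_k_i by (auto simp: type_A2_def)
qed

end

lemma rank_one_opposition:
  "\<mu> i \<in> {i, \<tau> i} \<or> \<tau> i = i \<and> type_A2 A (diagram_component A Y i)"
proof (cases "\<mu> i \<in> X")
  case True
  then show ?thesis using \<tau>_i[OF HOL.refl] component_A2[OF HOL.refl] by blast
next
  case False
  then show ?thesis using \<mu>_Y[of i] Y by auto
qed

end

end

section \<open>The excluded diagrams\<close>

context gcm
begin

lemma refl_commute:
  assumes "A $ i $ j = 0" "i \<noteq> j"
  shows "r i (r j v) = r j (r i v)"
  using assms zero_sym[of i j] by (simp add: refl_eq coroot_simps)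

lemma W_commute:
  assumes "w \<in> W Y" "\<And>j. j \<in> Y \<Longrightarrow> A $ i $ j = 0"
  shows "r i (w v) = w (r i v)"
  using assms(1)
proof (induction w arbitrary: v rule: W_induct)
  case (refl j w)
  have "i \<noteq> j" using assms(2)[OF refl(1)] by auto
  then have "r i (r j (w v)) = r j (r i (w v))" using assms(2)[OF refl(1)] by (intro refl_commute)
  then show ?case using refl(3) by simp
qed simp

lemma finite_W_A2:
  assumes "i \<noteq> k" "A $ i $ k = -1" "A $ k $ i = -1"
  shows "finite (W {i, k})"
proof -
  let ?S = "{id, r i, r k, r i \<circ> r k, r k \<circ> r i, r i \<circ> r k \<circ> r i}"
  have "refl_word (alt_word k i 3) = refl_word (alt_word i k 3)"
    using assms by (intro rank_two_finite_check(1)[of i k]) auto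
  then have braid: "r k (r i (r k v)) = r i (r k (r i v))" for v
    by (simp add: eval_nat_numeral fun_eq_iff)
  have "w \<in> ?S" if "w \<in> W {i, k}" for w
    using that
  proof (induction w rule: W_induct)
    case (refl j w)
    then have w: "w = id \<or> w = r i \<or> w = r k \<or> w = r i \<circ> r k \<or> w = r k \<circ> r i \<or>
        w = r i \<circ> r k \<circ> r i" by blast
    have "r j \<circ> w \<in> ?S" if "j = i"
    proof -
      have "r i \<circ> id = r i" "r i \<circ> r i = id" "r i \<circ> (r i \<circ> r k) = r k"
        "r i \<circ> (r k \<circ> r i) = r i \<circ> r k \<circ> r i" "r i \<circ> (r i \<circ> r k \<circ> r i) = r k \<circ> r i"
        by (simp_all add: fun_eq_iff)
      then show ?thesis using w unfolding that
        by (elim disjE) (simp_all only: insert_iff simp_thms)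
    qed
    moreover have "r j \<circ> w \<in> ?S" if "j = k"
    proof -
      have "r k \<circ> id = r k" "r k \<circ> r k = id" "r k \<circ> (r i \<circ> r k) = r i \<circ> r k \<circ> r i"
        "r k \<circ> (r k \<circ> r i) = r i" "r k \<circ> (r i \<circ> r k \<circ> r i) = r i \<circ> r k"
        by (simp_all add: fun_eq_iff braid)
      then show ?thesis using w unfolding that
        by (elim disjE) (simp_all only: insert_iff simp_thms)
    qed
    ultimately show ?case using refl(1) by blast
  qed simp
  then have "W {i, k} \<subseteq> ?S" by blast
  then show ?thesis by (rule finite_subset) simp
qed

end

context decoration
begin

abbreviation st :: "'i \<Rightarrow> rat^'i \<Rightarrow> rat^'i" where "st \<equiv> s_tilde A X \<tau>"
abbreviation ext :: "'i \<Rightarrow> 'i set" where "ext \<equiv> dec_ext X \<tau>"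

lemma ext_eq: "ext i = insert i (insert (\<tau> i) X)"
  by (auto simp: dec_ext_def)

lemma st_apply: "st i v = wl X (wl (ext i) v)"
  by (simp add: s_tilde_def)

text \<open>The longest elements of the other components cancel, so \<open>st i\<close> is \<open>s\<^sub>i s\<^sub>k\<close> for the second vertex
  \<open>k\<close> of the component. It suffices to know that it maps \<open>\<alpha>\<^sub>i\<close> to \<open>\<alpha>\<^sub>k\<close> and \<open>\<alpha>\<^sub>k\<close> to
  \<open>- w\<^sub>X \<alpha>\<^sub>i\<close>.\<close>

lemma A2_not_involution:
  assumes i: "i \<notin> X" "\<tau> i = i" and A2: "type_A2 A (diagram_component A (ext i) i)"
  shows "finite_type A (ext i)" and "st i \<circ> st i \<noteq> id"
proof -
  have Y: "ext i = insert i X" using i(2) by (simp add: ext_eq)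
  let ?C = "diagram_component A (ext i) i"
  let ?E = "{(k, l). k \<in> ext i \<and> l \<in> ext i \<and> k \<noteq> l \<and> A $ k $ l \<noteq> 0}"
  have C: "?C = {j. (i, j) \<in> ?E\<^sup>*}" by (simp add: diagram_component_def)
  then have "i \<in> ?C" by simp
  obtain p q where pq: "p \<noteq> q" "?C = {p, q}" "A $ p $ q = -1" "A $ q $ p = -1"
    using A2 unfolding type_A2_def by blast
  obtain k where k: "i \<noteq> k" "?C = {i, k}" "A $ i $ k = -1" "A $ k $ i = -1"
  proof (cases "p = i")
    case True
    then show thesis using that[of q] pq by blast
  next
    case False
    then have "q = i" using \<open>i \<in> ?C\<close> unfolding pq(2) by auto
    then show thesis using that[of p] pq by blast
  qed
  have "(i, k) \<in> ?E\<^sup>*" using k(2) C by blast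
  then have "k \<in> ext i" using k(1) by (cases rule: rtranclE) auto
  then have kX: "k \<in> X" using Y k(1) by simp
  have i_other: "A $ i $ l = 0" if l: "l \<in> X" "l \<noteq> k" for l
  proof (rule ccontr)
    assume "A $ i $ l \<noteq> 0"
    then have "(i, l) \<in> ?E" using l i Y by auto
    then have "l \<in> ?C" unfolding C by blast
    then show False using k(2) l i by auto
  qed
  have k_other: "A $ k $ l = 0" if l: "l \<in> X" "l \<noteq> k" for l
  proof (rule ccontr)
    assume "A $ k $ l \<noteq> 0"
    then have "(k, l) \<in> ?E" using l i Y kX by auto
    then have "l \<in> ?C" using \<open>(i, k) \<in> ?E\<^sup>*\<close> unfolding C by (auto intro: rtrancl_into_rtrancl)
    then show False using k(2) l i by auto
  qed
  have fin: "finite ((\<lambda>(u, v). u \<circ> v) ` (W (X - {k}) \<times> W {i, k}))" (is "finite ?F")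
    using finite_W_A2[of i k] k finite_type_mono[OF finite_X, of "X - {k}"]
    by (simp add: finite_type_W)
  have "w \<in> ?F" if "w \<in> W (ext i)" for w
    using that
  proof (induction w rule: W_induct)
    case id
    have "id = id \<circ> (id :: rat^'i \<Rightarrow> rat^'i)" by simp
    then show ?case by (metis (no_types, lifting) SigmaI W_id case_prod_conv image_eqI)
  next
    case (refl j w)
    from refl(3) obtain p where p: "p \<in> W (X - {k}) \<times> W {i, k}" "w = (\<lambda>(u, v). u \<circ> v) p"
      by (rule imageE)
    obtain u v where "p = (u, v)" by (cases p)
    then have uv: "u \<in> W (X - {k})" "v \<in> W {i, k}" "w = u \<circ> v"
      using p by simp_all
    show ?case
    proof (cases "j \<in> {i, k}")
      case True
      then have "r j (u x) = u (r j x)" for x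
        using i_other k_other by (intro W_commute[OF uv(1)]) auto
      then have "r j \<circ> w = u \<circ> (r j \<circ> v)" using uv(3) by (simp add: fun_eq_iff)
      moreover have "r j \<circ> v \<in> W {i, k}" using True uv(2) by (intro W_comp W_refl)
      ultimately show ?thesis using uv(1) by (intro image_eqI[of _ _ "(u, r j \<circ> v)"]) auto
    next
      case False
      then have "r j \<circ> u \<in> W (X - {k})" using refl(1) uv(1) Y by (intro W_comp W_refl) auto
      then show ?thesis using uv(2,3) by (intro image_eqI[of _ _ "(r j \<circ> u, v)"]) (auto simp: comp_assoc)
    qed
  qed
  then have "W (ext i) \<subseteq> ?F" by blast
  then show finY: "finite_type A (ext i)" unfolding finite_type_W using fin by (rule finite_subset)
  have iY: "i \<in> ext i" and kY: "k \<in> ext i" using Y kX by auto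
  let ?\<mu> = "opp_inv A (ext i)"
  note wY_W = longest_W[OF finY]
  have "supported {k} (wl X (\<alpha> k))"
    using k_other zero_sym by (intro W_supported_components[OF wX_W]) (auto simp: supported_simple_root)
  then have "\<tau> k = k" using longest_X[OF kX] by (simp add: supported_simple_root)
  then have wXk: "wl X (\<alpha> k) = - \<alpha> k" using longest_X[OF kX] by simp
  have \<mu>: "?\<mu> j \<in> {i, k}" if j: "j \<in> {i, k}" for j
  proof -
    have "supported {i, k} (wl (ext i) (\<alpha> j))"
    proof (rule W_supported_components[OF wY_W])
      fix p q assume "p \<in> ext i - {i, k}" "q \<in> {i, k}"
      then show "A $ p $ q = 0"
        using i_other[of p] k_other[of p] zero_sym[of p q] Y by auto
    qed (use j in \<open>simp add: supported_simple_root\<close>)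
    moreover have "j \<in> ext i" using j iY kY by auto
    ultimately show ?thesis
      using longest_opp_inv[OF finY, of j] by (simp add: supported_simple_root)
  qed
  have \<mu>i: "?\<mu> i = k"
  proof (rule ccontr)
    \<comment> \<open>Otherwise the longest element acts by \<open>-1\<close> on the fundamental weight of \<open>k\<close>, which has order 3
      modulo the root lattice.\<close>
    assume "?\<mu> i \<noteq> k"
    then have i': "?\<mu> i = i" using \<mu>[of i] by auto
    then have "?\<mu> k \<noteq> i" using opp_inv_opp_inv[OF finY kY] k(1) by auto
    then have k': "?\<mu> k = k" using \<mu>[of k] by auto
    define l where "l = (1/3) *s (\<alpha> i + 2 *s \<alpha> k)"
    have "coroot j l \<in> \<int>" if j: "j \<in> ext i" for j
    proof -
      have eq: "coroot j l = (of_int (A $ j $ i) + 2 * of_int (A $ j $ k)) / 3"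
        by (simp add: l_def coroot_simps)
      consider "j = i" | "j = k" | "j \<in> X" "j \<noteq> k" using j unfolding Y by blast
      then show ?thesis
      proof cases
        case 3
        then have "A $ j $ i = 0" "A $ j $ k = 0" using 3 i_other[of j] k_other[of j] zero_sym[of j i] zero_sym[of j k] by auto
        then show ?thesis by (simp add: eq)
      qed (unfold eq, simp_all add: k)
    qed
    then have "integral_vec (wl (ext i) l - l)" by (intro W_weight[OF wY_W])
    moreover have "wl (ext i) l = (1/3) *s (- \<alpha> i + 2 *s (- \<alpha> k))"
      using longest_opp_inv[OF finY iY] longest_opp_inv[OF finY kY] i' k'
      by (simp only: l_def lin_scale[OF W_lin[OF wY_W]] lin_add[OF W_lin[OF wY_W]])
    then have "(wl (ext i) l - l) $ i = - (2/3)"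
      using k(1) by (simp add: l_def simple_root_nth)
    ultimately have "(- (2/3) :: rat) \<in> \<int>" by (metis integral_vec_def)
    then obtain n where "(- (2/3) :: rat) = of_int n" by (rule Ints_cases)
    then have "rat_of_int (3 * n) = of_int (-2)" by simp
    then have "3 * n = -2" by (simp only: of_int_eq_iff)
    then show False by presburger
  qed
  then have \<mu>k: "?\<mu> k = i" using opp_inv_opp_inv[OF finY iY] by simp
  have "st i (\<alpha> i) = \<alpha> k"
    using longest_opp_inv[OF finY iY] \<mu>i wXk lin_minus[OF wX_lin] by (simp add: st_apply)
  moreover have "st i (\<alpha> k) = - wl X (\<alpha> i)"
    using longest_opp_inv[OF finY kY] \<mu>k lin_minus[OF wX_lin] by (simp add: st_apply)
  ultimately have neg: "st i (st i (\<alpha> i)) $ i = -1"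
    using W_nth[OF wX_W i(1), of "\<alpha> i"] by (simp add: simple_root_nth)
  show "st i \<circ> st i \<noteq> id"
  proof
    assume "st i \<circ> st i = id"
    then have "st i (st i (\<alpha> i)) = \<alpha> i" by (metis comp_apply id_apply)
    then show False using neg by (simp add: simple_root_nth)
  qed
qed

end

section \<open>The restricted Weyl group\<close>

locale satake = decoration A X \<tau> for A :: "int^'i^'i::finite" and X \<tau> +
  fixes Istar :: "'i set"
  assumes symmetrizable: "symmetrizable A"
    and orbit_reps: "orbit_reps X \<tau> Istar"
    and satake: "gen_satake_diagram A X \<tau>"
begin

abbreviation It :: "'i set" where "It \<equiv> I_tilde A X \<tau> Istar"
abbreviation G :: "(rat^'i \<Rightarrow> rat^'i) monoid" where "G \<equiv> W_tilde A X \<tau> Istar"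

text \<open>The inversions of \<open>st i\<close>, by \<open>st_outer\<close> and \<open>inversions_st\<close> below.\<close>

definition outer_roots :: "'i \<Rightarrow> (rat^'i) set" where
  "outer_roots i = {v \<in> \<Phi>. Pos v \<and> supported (ext i) v \<and> \<not> supported X v}"

lemma It_facts:
  assumes "i \<in> It"
  shows It_Istar: "i \<in> Istar" and It_X: "i \<notin> X" and It_finite: "finite_type A (ext i)"
  using assms orbit_reps by (auto simp: I_tilde_def orbit_reps_def)

context
  fixes i :: 'i
  assumes i: "i \<in> It"
begin

abbreviation \<nu> :: "'i \<Rightarrow> 'i" where "\<nu> \<equiv> opp_inv A (ext i)"

lemmas i_X = It_X[OF i]
lemmas finite_ext = It_finite[OF i]
lemmas rank_one = i_X ext_eq finite_ext
lemmas ext_W = longest_W[OF finite_ext]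
lemmas ext_lin = W_lin[OF ext_W]
lemmas ext_ext = longest_longest[OF finite_ext]

lemma \<tau>i_X: "\<tau> i \<notin> X" using i_X by simp

lemma ext_X: "X \<subseteq> ext i" by (auto simp: ext_eq)

lemma ext_simple_root: "j \<in> ext i \<Longrightarrow> wl (ext i) (\<alpha> j) = - \<alpha> (\<nu> j)"
  by (rule longest_opp_inv[OF finite_ext])

lemma \<nu>_outer: "\<nu> i \<in> {i, \<tau> i}"
proof -
  have "\<not> (\<tau> i = i \<and> type_A2 A (diagram_component A (ext i) i))"
    using satake i_X by (auto simp: gen_satake_diagram_def)
  then show ?thesis using rank_one_opposition[OF rank_one] by blast
qed

lemma \<nu>_\<tau>i: "\<nu> (\<tau> i) \<in> {i, \<tau> i}"
  using \<mu>_\<tau>[OF rank_one, of i] \<nu>_outer by (auto simp: ext_eq)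

lemma \<nu>_X: "j \<in> X \<Longrightarrow> \<nu> j \<in> X"
proof (rule ccontr)
  assume j: "j \<in> X" "\<nu> j \<notin> X"
  then have jY: "j \<in> ext i" by (simp add: ext_eq)
  then have "\<nu> j = i \<or> \<nu> j = \<tau> i" using opp_inv_in[OF finite_ext jY] j by (auto simp: ext_eq)
  then have "j = \<nu> i \<or> j = \<nu> (\<tau> i)" using opp_inv_opp_inv[OF finite_ext jY] by auto
  then show False using \<nu>_outer \<nu>_\<tau>i j i_X \<tau>i_X by auto
qed

text \<open>Conjugation by \<open>w\<^bsub>X[i]\<^esub>\<close> permutes the simple reflections of \<open>X\<close>.\<close>

lemma longest_commute: "wl (ext i) (wl X v) = wl X (wl (ext i) v)"
proof -
  let ?u = "\<lambda>v. - wl (ext i) v"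
  have inverse: "?u (?u v) = v" for v by (simp add: lin_minus[OF ext_lin] ext_ext)
  have lin: "lin ?u" by (rule lin_uminus[OF ext_lin])
  have root: "?u (\<alpha> j) = \<alpha> (\<nu> j)" if "j \<in> X" for j
    using ext_simple_root that ext_X by auto
  note B = averaged_form_invariant[OF finite_ext]
  have iso: "averaged_form (ext i) (?u x) (?u y) = averaged_form (ext i) x y" for x y
    using form_W[OF B ext_W] by (simp add: invariant_formD[OF B])
  have "?u (wl X v) = wl X (?u v)"
  proof (rule longest_conj[OF finite_X finite_X, where u' = ?u])
    fix j assume j: "j \<in> X"
    have "\<forall>v. ?u (r j v) = r (\<nu> j) (?u v)"
      using form_isometry_conj(2)[OF B lin iso, of j "\<nu> j"] j \<nu>_X[OF j] ext_X root[OF j] by blast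
    then show "\<exists>k\<in>X. ?u (\<alpha> j) = \<alpha> k \<and> (\<forall>v. ?u (r j v) = r k (?u v))"
      using \<nu>_X[OF j] root[OF j] by blast
    show "\<exists>k\<in>X. ?u (\<alpha> j) = \<alpha> k" using \<nu>_X[OF j] root[OF j] by blast
  qed (rule lin inverse)+
  then show ?thesis by (simp add: lin_minus[OF wX_lin])
qed

lemma st_st: "st i (st i v) = v"
  by (simp add: st_apply longest_commute wX_wX ext_ext)

lemma st_comp_st: "st i \<circ> st i = id" by (simp add: fun_eq_iff st_st)

lemma st_W_ext: "st i \<in> W (ext i)"
  unfolding s_tilde_def using W_mono[OF wX_W ext_X] ext_W by (rule W_comp)

lemma st_W: "st i \<in> W UNIV" using st_W_ext by (rule W_mono) simp

lemmas st_lin = W_lin[OF st_W]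

lemma st_X: "j \<in> X \<Longrightarrow> \<exists>k\<in>X. st i (\<alpha> j) = \<alpha> k"
  using ext_simple_root[of j] \<nu>_X[of j] longest_X[of "\<nu> j"] ext_X lin_minus[OF wX_lin]
  by (intro bexI[of _ "\<tau> (\<nu> j)"]) (auto simp: st_apply)

lemma st_T: "T (st i v) = st i (T v)"
proof -
  have "\<tau> ` ext i \<subseteq> ext i" using \<tau>_X by (auto simp: ext_eq)
  then show ?thesis
    using T_wX permute_longest[OF \<tau>_involution finite_ext] by (simp add: st_apply)
qed

lemma st_wX: "st i (wl X v) = wl X (st i v)"
  by (simp add: st_apply longest_commute)

lemma st_i: "st i (\<alpha> i) = - wl X (\<alpha> (\<nu> i))"
  using ext_simple_root[of i] by (simp add: st_apply ext_eq lin_minus[OF wX_lin])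

lemma simple_root_outer: "\<alpha> i \<in> outer_roots i" "\<alpha> (\<tau> i) \<in> outer_roots i"
  using i_X \<tau>i_X by (auto simp: outer_roots_def supported_simple_root ext_eq)

end

text \<open>Coordinates outside \<open>X\<close> decide the sign of a root not supported on \<open>X\<close>, and \<open>w\<^sub>X\<close> fixes them.\<close>

lemma wX_Pos:
  assumes "v \<in> \<Phi>" "Pos v" "\<not> supported X v"
  shows "Pos (wl X v)"
proof -
  obtain l where l: "l \<notin> X" "v $ l \<noteq> 0" using assms(3) by (auto simp: supported_def)
  then have "wl X v $ l > 0" using W_nth[OF wX_W l(1)] Pos_nth[OF assms(2), of l] by simp
  then show ?thesis using \<Phi>_Pos_coord W_\<Phi>[OF wX_W assms(1)] by blast
qed

lemma st_outer:
  assumes i: "i \<in> It" and v: "v \<in> outer_roots i"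
  shows "- st i v \<in> outer_roots i"
proof -
  note W = ext_W[OF i] and lin = ext_lin[OF i]
  let ?w = "wl (ext i)"
  have v': "v \<in> \<Phi>" "Pos v" "supported (ext i) v" "\<not> supported X v"
    using v by (auto simp: outer_roots_def)
  have root: "- ?w v \<in> \<Phi>" using W_\<Phi>[OF W v'(1)] by simp
  have "Pos (?w (- v))"
  proof (rule negative_comp_Pos[OF lin])
    fix j assume "j \<in> ext i"
    then show "Pos (- ?w (\<alpha> j))" by (rule longest_negative[OF It_finite[OF i]])
  next
    show "Pos (- (- v))" using v' by simp
    show "supported (ext i) (- v)" using v' by simp
  qed
  then have pos: "Pos (- ?w v)" by (simp add: lin_minus[OF lin])
  have nsup: "\<not> supported X (?w v)"
  proof
    assume *: "supported X (?w v)"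
    have "supported X (?w (?w v))"
    proof (rule lin_supported[OF lin])
      fix j assume "?w v $ j \<noteq> 0"
      then have "j \<in> X" using * by (auto simp: supported_def)
      then show "supported X (?w (\<alpha> j))"
        using ext_simple_root[OF i, of j] \<nu>_X[OF i] ext_X[OF i] by (auto simp: supported_simple_root)
    qed
    then show False using v' ext_ext[OF i] by simp
  qed
  have eq: "- st i v = wl X (- ?w v)" by (simp add: st_apply lin_minus[OF wX_lin])
  have "\<not> supported X (- st i v)"
    using nsup by (auto simp: supported_def st_apply W_nth[OF wX_W])
  moreover have "supported (ext i) (- st i v)"
    using W_supported[OF st_W_ext[OF i] v'(3)] by simp
  moreover have "Pos (- st i v)" unfolding eq using root pos nsup by (intro wX_Pos) auto
  moreover have "- st i v \<in> \<Phi>" using W_\<Phi>[OF st_W[OF i] v'(1)] by simp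
  ultimately show ?thesis by (simp add: outer_roots_def)
qed

lemma inversions_st: "i \<in> It \<Longrightarrow> x \<in> inversions (st i) \<Longrightarrow> x \<in> outer_roots i"
proof -
  assume i: "i \<in> It" and x: "x \<in> inversions (st i)"
  have "\<not> supported X x"
  proof
    assume sup: "supported X x"
    have "Pos (st i x)"
    proof (rule lin_Pos[OF st_lin[OF i]])
      show "Pos x" using x by (simp add: inversions_def)
      fix j assume "x $ j \<noteq> 0"
      then have "j \<in> X" using sup by (auto simp: supported_def)
      then show "Pos (st i (\<alpha> j))" using st_X[OF i] by fastforce
    qed
    then show False using x \<Phi>_not_both[of "st i x"] W_\<Phi>[OF st_W[OF i]] by (auto simp: inversions_def)
  qed
  moreover have "supported (ext i) x" using inversions_supported[OF st_W_ext[OF i] x] .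
  ultimately show "x \<in> outer_roots i" using x by (auto simp: inversions_def outer_roots_def)
qed

text \<open>The properties of the \<open>st i\<close> that are stable under composition and determine the signs below.\<close>

definition K :: "(rat^'i \<Rightarrow> rat^'i) set" where
  "K = {u \<in> W UNIV. (\<forall>v. T (u v) = u (T v)) \<and> (\<forall>v. u (wl X v) = wl X (u v)) \<and>
     (\<forall>j\<in>X. \<exists>k\<in>X. u (\<alpha> j) = \<alpha> k)}"

lemma K_W: "u \<in> K \<Longrightarrow> u \<in> W UNIV" by (simp add: K_def)
lemma K_lin: "u \<in> K \<Longrightarrow> lin u" using K_W W_lin by blast
lemma K_T: "u \<in> K \<Longrightarrow> T (u v) = u (T v)" by (simp add: K_def)
lemma K_wX: "u \<in> K \<Longrightarrow> u (wl X v) = wl X (u v)" by (simp add: K_def)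
lemma K_X: "u \<in> K \<Longrightarrow> j \<in> X \<Longrightarrow> \<exists>k\<in>X. u (\<alpha> j) = \<alpha> k" by (simp add: K_def)

lemma K_comp: "u \<in> K \<Longrightarrow> v \<in> K \<Longrightarrow> u \<circ> v \<in> K"
proof -
  assume uv: "u \<in> K" "v \<in> K"
  have "\<exists>k\<in>X. u (v (\<alpha> j)) = \<alpha> k" if "j \<in> X" for j
    using K_X[OF uv(2) that] K_X[OF uv(1)] by fastforce
  then show ?thesis using uv W_comp[of u UNIV v] unfolding K_def by simp
qed

lemma K_id: "id \<in> K" using W_id[of UNIV] by (auto simp: K_def simp del: W_id)

lemma K_st: "i \<in> It \<Longrightarrow> st i \<in> K"
  using st_W st_T st_wX st_X by (simp add: K_def)

lemma K_supported: "u \<in> K \<Longrightarrow> supported X v \<Longrightarrow> supported X (u v)"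
proof -
  assume u: "u \<in> K" and v: "supported X v"
  show ?thesis
  proof (rule lin_supported[OF K_lin[OF u]])
    fix j assume "v $ j \<noteq> 0"
    then have "j \<in> X" using v by (auto simp: supported_def)
    then show "supported X (u (\<alpha> j))" using K_X[OF u] by (force simp: supported_simple_root)
  qed
qed

text \<open>Commuting with \<open>\<tau>\<close>, \<open>u\<close> is also positive on \<open>\<alpha>\<^bsub>\<tau> i\<^esub>\<close>, and on \<open>X\<close> it permutes the simple
  roots.\<close>

lemma K_Pos:
  assumes "u \<in> K" "Pos (u (\<alpha> i))" "Pos v" "supported (ext i) v"
  shows "Pos (u v)"
proof (rule lin_Pos[OF K_lin[OF assms(1)] assms(3)])
  fix j assume "v $ j \<noteq> 0"
  then have "j \<in> ext i" using assms(4) by (auto simp: supported_def)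
  then consider "j = i" | "j = \<tau> i" | "j \<in> X" by (auto simp: ext_eq)
  then show "Pos (u (\<alpha> j))"
  proof cases
    case 2
    then have "u (\<alpha> j) = T (u (\<alpha> i))" using K_T[OF assms(1), of "\<alpha> i"] by simp
    then show ?thesis using Pos_permute[OF assms(2)] by simp
  next
    case 3
    then show ?thesis using K_X[OF assms(1)] by fastforce
  qed (use assms in simp)
qed

lemma involution_generated_G: "involution_generated G It st"
  unfolding W_tilde_def
  by (rule involution_generated_GL_V) (use W_GL_V st_W st_comp_st in auto)

lemma mult_G: "mult G = (\<circ>)" and one_G: "one G = id"
  by (simp_all add: W_tilde_def GL_V_def)

sublocale restricted: involution_generated G It st
  rewrites "mult G = (\<circ>)" and "one G = id"
  by (rule involution_generated_G) (simp_all only: mult_G one_G)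

abbreviation Wt :: "(rat^'i \<Rightarrow> rat^'i) set" where "Wt \<equiv> carrier G"

lemma Wt_K: "u \<in> Wt \<Longrightarrow> u \<in> K"
proof -
  have "x \<in> lists It \<Longrightarrow> restricted.word_prod x \<in> K" for x
    by (induction x) (auto simp: K_id intro!: K_comp K_st)
  then show "u \<in> Wt \<Longrightarrow> u \<in> K" using restricted.carrier_word_prod by auto
qed

lemma Wt_comp: "u \<in> Wt \<Longrightarrow> v \<in> Wt \<Longrightarrow> u \<circ> v \<in> Wt" by (rule restricted.m_closed)

lemma Wt_st: "i \<in> It \<Longrightarrow> st i \<in> Wt" by (rule restricted.gen_closed)

lemma Wt_finv:
  assumes "u \<in> Wt"
  shows "finv u \<in> Wt" and "finv u (u v) = v" and "u (finv u v) = v" and "finv (finv u) = u"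
proof -
  have 1: "u \<circ> m_inv G u = id" "m_inv G u \<circ> u = id" using restricted.r_inv[OF assms] restricted.l_inv[OF assms] by auto
  then have 2: "finv u = m_inv G u" by (intro inv_unique_comp)
  then show "finv u \<in> Wt" using restricted.inv_closed[OF assms] by simp
  show "finv u (u v) = v" "u (finv u v) = v" using 1 unfolding 2 by (metis comp_apply id_apply)+
  show "finv (finv u) = u" using 1 unfolding 2 by (intro inv_unique_comp)
qed

lemma finv_comp: "u \<in> Wt \<Longrightarrow> v \<in> Wt \<Longrightarrow> finv (u \<circ> v) = finv v \<circ> finv u"
  using W_bij[OF K_W[OF Wt_K]] by (intro o_inv_distrib) auto

lemma finv_st: "i \<in> It \<Longrightarrow> finv (st i) = st i"
  using st_comp_st by (intro inv_unique_comp)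

text \<open>Up to sign \<open>st i \<alpha>\<^sub>i\<close> is \<open>w\<^sub>X \<alpha>\<^sub>i\<close> or \<open>w\<^sub>X \<alpha>\<^bsub>\<tau> i\<^esub>\<close>, and \<open>w\<^sub>X\<close> commutes with \<open>u\<close> and preserves the
  sign of roots outside the span of \<open>X\<close>.\<close>

lemma sign_change:
  assumes u: "u \<in> Wt" and i: "i \<in> It" and neg: "\<not> Pos (u (\<alpha> i))"
  shows "Pos (u (st i (\<alpha> i)))"
proof -
  note uK = Wt_K[OF u]
  let ?m = "opp_inv A (ext i) i"
  have "Pos (- u (\<alpha> i))" using neg \<Phi>_sign[of "u (\<alpha> i)"] W_\<Phi>[OF K_W[OF uK]] by auto
  moreover have "u (\<alpha> (\<tau> i)) = T (u (\<alpha> i))" using K_T[OF uK, of "\<alpha> i"] by simp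
  ultimately have "Pos (- u (\<alpha> (\<tau> i)))"
    using Pos_permute[of "- u (\<alpha> i)" \<tau>] by (simp add: lin_minus[OF T_lin])
  then have pos: "Pos (- u (\<alpha> ?m))" using \<nu>_outer[OF i] \<open>Pos (- u (\<alpha> i))\<close> by auto
  have nsup: "\<not> supported X (- u (\<alpha> ?m))"
  proof
    assume "supported X (- u (\<alpha> ?m))"
    then have "supported X (finv u (u (\<alpha> ?m)))"
      using K_supported[OF Wt_K[OF Wt_finv(1)[OF u]], of "u (\<alpha> ?m)"] by simp
    then have "?m \<in> X" using Wt_finv(2)[OF u] by (simp add: supported_simple_root)
    then show False using \<nu>_outer[OF i] It_X[OF i] by auto
  qed
  have "- u (\<alpha> ?m) \<in> \<Phi>" using W_\<Phi>[OF K_W[OF uK]] by simp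
  then have "Pos (wl X (- u (\<alpha> ?m)))" using pos nsup by (rule wX_Pos)
  then show ?thesis
    using K_wX[OF uK] by (simp add: st_i[OF i] lin_minus[OF K_lin[OF uK]] lin_minus[OF wX_lin])
qed

lemma outer_Pos: "u \<in> Wt \<Longrightarrow> Pos (u (\<alpha> i)) \<Longrightarrow> v \<in> outer_roots i \<Longrightarrow> Pos (u v)"
  using K_Pos[OF Wt_K] by (simp add: outer_roots_def)

lemma outer_root: "v \<in> outer_roots i \<Longrightarrow> u \<in> Wt \<Longrightarrow> u v \<in> \<Phi>"
  using W_\<Phi>[OF K_W[OF Wt_K]] by (simp add: outer_roots_def)

lemma st_negative: "i \<in> It \<Longrightarrow> \<not> Pos (st i (\<alpha> i))"
  using st_outer[OF _ simple_root_outer(1)] \<Phi>_not_both[of "- st i (\<alpha> i)"]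
  by (auto simp: outer_roots_def)

text \<open>As \<open>u\<close> is positive and \<open>st k \<circ> u\<close> is negative on the inversions of \<open>st i\<close>, \<open>u\<close> maps them to inversions
  of \<open>st k\<close>.\<close>

lemma half_space_crossing:
  assumes u: "u \<in> Wt" and ik: "i \<in> It" "k \<in> It"
    and pos: "Pos (u (\<alpha> i))" and neg: "\<not> Pos (st k (u (\<alpha> i)))"
    and v: "v \<in> outer_roots i"
  shows "u v \<in> outer_roots k"
proof -
  have ku: "st k \<circ> u \<in> Wt" using Wt_comp Wt_st ik u by blast
  then have "Pos ((st k \<circ> u) (st i (\<alpha> i)))" using sign_change[OF ku ik(1)] neg by simp
  then have pos': "Pos ((st k \<circ> u \<circ> st i) (\<alpha> i))" by simp
  have kui: "st k \<circ> u \<circ> st i \<in> Wt" using Wt_comp[OF ku Wt_st[OF ik(1)]] .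
  have "Pos ((st k \<circ> u \<circ> st i) (- st i v))"
    using outer_Pos[OF kui pos'] st_outer[OF ik(1) v] by blast
  then have "Pos (- st k (u v))"
    by (simp add: lin_minus[OF st_lin[OF ik(1)]] lin_minus[OF st_lin[OF ik(2)]]
        lin_minus[OF K_lin[OF Wt_K[OF u]]] st_st[OF ik(1)])
  moreover have "Pos (u v)" using outer_Pos[OF u pos v] .
  ultimately have "u v \<in> inversions (st k)"
    using outer_root[OF v u] by (simp add: inversions_def)
  then show ?thesis by (rule inversions_st[OF ik(2)])
qed

text \<open>The inverse of \<open>u\<close> satisfies the same hypotheses with \<open>i\<close> and \<open>k\<close> interchanged, so \<open>u\<close> matches the
  positive cones, hence the simple roots and the longest elements, of \<open>X[i]\<close> and \<open>X[k]\<close>.\<close>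

lemma wall:
  assumes u: "u \<in> Wt" and ik: "i \<in> It" "k \<in> It"
    and pos: "Pos (u (\<alpha> i))" and neg: "\<not> Pos (st k (u (\<alpha> i)))"
  shows "u \<circ> st i = st k \<circ> u"
proof -
  define u' where "u' = finv u"
  have u': "u' \<in> Wt" "u' (u v) = v" "u (u' v) = v" for v using Wt_finv[OF u] by (auto simp: u'_def)
  note fwd = half_space_crossing[OF u ik pos neg]
  have ui: "u (\<alpha> i) \<in> outer_roots k" using fwd simple_root_outer(1)[OF ik(1)] by blast
  have pos': "Pos (u' (\<alpha> k))"
  proof (rule ccontr)
    assume "\<not> Pos (u' (\<alpha> k))"
    then have "Pos ((u' \<circ> st k) (\<alpha> k))" using sign_change[OF u'(1) ik(2)] by simp
    moreover have "u' \<circ> st k \<in> Wt" using Wt_comp[OF u'(1) Wt_st[OF ik(2)]] .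
    ultimately have "Pos ((u' \<circ> st k) (- st k (u (\<alpha> i))))"
      using outer_Pos st_outer[OF ik(2) ui] by blast
    then have "Pos (- \<alpha> i)"
      by (simp add: lin_minus[OF st_lin[OF ik(2)]] lin_minus[OF K_lin[OF Wt_K[OF u'(1)]]]
          st_st[OF ik(2)] u')
    then show False by simp
  qed
  have neg': "\<not> Pos (st i (u' (\<alpha> k)))"
  proof
    assume "Pos (st i (u' (\<alpha> k)))"
    then have "Pos ((st i \<circ> u') (\<alpha> k))" by simp
    moreover have "st i \<circ> u' \<in> Wt" using Wt_comp[OF Wt_st[OF ik(1)] u'(1)] .
    ultimately have "Pos ((st i \<circ> u') (u (\<alpha> i)))" using outer_Pos ui by blast
    then show False using st_negative[OF ik(1)] u' by simp
  qed
  note bwd = half_space_crossing[OF u'(1) ik(2,1) pos' neg']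
  note lin = K_lin[OF Wt_K[OF u]] K_lin[OF Wt_K[OF u'(1)]]
  have cone: "Pos (x (\<alpha> j)) \<and> supported (ext q) (x (\<alpha> j)) \<and> integral_vec (x (\<alpha> j))"
    if x: "x \<in> Wt" "\<And>v. v \<in> outer_roots p \<Longrightarrow> x v \<in> outer_roots q" and p: "p \<in> It" "j \<in> ext p"
    for x p q j
  proof -
    have int: "integral_vec (x (\<alpha> j))" using W_integral[OF K_W[OF Wt_K[OF x(1)]]] by simp
    show ?thesis
    proof (cases "j \<in> X")
      case True
      then obtain l where "l \<in> X" "x (\<alpha> j) = \<alpha> l" using K_X[OF Wt_K[OF x(1)]] by blast
      then show ?thesis by (auto simp: supported_simple_root ext_eq)
    next
      case False
      then have "\<alpha> j \<in> outer_roots p" using p simple_root_outer[OF p(1)] by (auto simp: ext_eq)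
      then show ?thesis using x(2)[of "\<alpha> j"] int by (auto simp: outer_roots_def)
    qed
  qed
  have fwd_root: "\<exists>p\<in>ext k. u (\<alpha> j) = \<alpha> p" if "j \<in> ext i" for j
    using that by (intro cone_generators[OF lin u'(2,3) _ _ that])
      (use cone[OF u fwd ik(1)] cone[OF u'(1) bwd ik(2)] in blast)+
  have bwd_root: "\<exists>j\<in>ext i. u' (\<alpha> p) = \<alpha> j" if "p \<in> ext k" for p
    using that by (intro cone_generators[OF lin(2,1) u'(3,2) _ _ that])
      (use cone[OF u fwd ik(1)] cone[OF u'(1) bwd ik(2)] in blast)+
  obtain B where B: "invariant_form UNIV B" using symmetrizable_form[OF symmetrizable] .
  have iso: "B (u x) (u y) = B x y" for x y using form_W[OF B K_W[OF Wt_K[OF u]]] .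
  have "u (wl (ext i) v) = wl (ext k) (u v)" for v
  proof (rule longest_conj[OF It_finite[OF ik(1)] It_finite[OF ik(2)] lin(1) u'(2,3)])
    fix j assume "j \<in> ext i"
    then obtain p where "p \<in> ext k" "u (\<alpha> j) = \<alpha> p" using fwd_root by blast
    moreover from this(2) have "u (r j v) = r p (u v)" for v
      using form_isometry_conj(2)[OF B lin(1) iso, of j p] by simp
    ultimately show "\<exists>p\<in>ext k. u (\<alpha> j) = \<alpha> p \<and> (\<forall>v. u (r j v) = r p (u v))" by blast
  qed (rule bwd_root)
  then show ?thesis
    using K_wX[OF Wt_K[OF u]] by (simp add: fun_eq_iff st_apply)
qed

lemma st_inj: "inj_on st It"
proof (rule inj_onI, rule ccontr)
  fix i k assume ik: "i \<in> It" "k \<in> It" "st i = st k" "i \<noteq> k"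
  have "\<exists>!j. j \<in> Istar \<and> j \<in> {k, \<tau> k}"
    using orbit_reps It_X[OF ik(2)] by (auto simp: orbit_reps_def)
  then have "i \<notin> {k, \<tau> k}" using It_Istar ik by (metis insertI1)
  then have "i \<notin> ext k" using It_X[OF ik(1)] by (auto simp: ext_eq)
  then have "st k (\<alpha> i) $ i = 1" using W_nth[OF st_W_ext[OF ik(2)]] by (simp add: simple_root_nth)
  moreover have "Pos (- st i (\<alpha> i))"
    using st_outer[OF ik(1) simple_root_outer(1)[OF ik(1)]] by (simp add: outer_roots_def)
  ultimately show False using ik(3) Pos_nth[of "- st i (\<alpha> i)" i] by simp
qed

abbreviation half_space :: "'i \<Rightarrow> (rat^'i \<Rightarrow> rat^'i) \<Rightarrow> bool" where
  "half_space i w \<equiv> Pos (finv w (\<alpha> i))"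

lemma half_space_system_G: "half_space_system G It st half_space"
proof (rule half_space_system.intro[OF involution_generated_G], unfold_locales)
  show "inj_on st It" by (rule st_inj)
  fix i assume i: "i \<in> It"
  have "finv (id :: rat^'i \<Rightarrow> rat^'i) = id" by (rule inv_id)
  then show "half_space i \<one>\<^bsub>G\<^esub>" by (simp add: one_G)
  fix w assume w: "w \<in> Wt"
  have u: "finv w \<in> Wt" using Wt_finv(1)[OF w] .
  {
    assume pos: "half_space i w"
    have "Pos (finv w (- st i (\<alpha> i)))"
      using outer_Pos[OF u pos st_outer[OF i simple_root_outer(1)[OF i]]] .
    then have "Pos (- finv w (st i (\<alpha> i)))" by (simp add: lin_minus[OF K_lin[OF Wt_K[OF u]]])
    moreover have "finv w (st i (\<alpha> i)) \<in> \<Phi>"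
      using W_\<Phi>[OF K_W[OF Wt_K[OF u]]] W_\<Phi>[OF st_W[OF i]] by simp
    ultimately have "\<not> Pos (finv w (st i (\<alpha> i)))" using \<Phi>_not_both by blast
    then show "\<not> half_space i (st i \<otimes>\<^bsub>G\<^esub> w)"
      unfolding mult_G finv_comp[OF Wt_st[OF i] w] finv_st[OF i] by simp
  }
  fix k assume k: "k \<in> It" and pos: "half_space i w" and neg: "\<not> half_space i (w \<otimes>\<^bsub>G\<^esub> st k)"
  have "\<not> Pos (st k (finv w (\<alpha> i)))"
    using neg unfolding mult_G finv_comp[OF w Wt_st[OF k]] finv_st[OF k] by simp
  then have *: "finv w \<circ> st i = st k \<circ> finv w" using wall[OF u i k pos] by blast
  have "st i (w v) = w (st k v)" for v
  proof -
    have "finv w (st i (w v)) = st k v"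
      using fun_cong[OF *, of "w v"] Wt_finv(2)[OF w] by simp
    then show ?thesis using Wt_finv(3)[OF w] by metis
  qed
  then show "st i \<otimes>\<^bsub>G\<^esub> w = w \<otimes>\<^bsub>G\<^esub> st k" by (simp add: mult_G fun_eq_iff)
qed

lemma coxeter_G: "coxeter_system G It st"
  using half_space_system_G by (rule half_space_system.coxeter_system_half_spaces)

lemma wlen_finv: "u \<in> Wt \<Longrightarrow> wlen UNIV (finv u) = wlen UNIV u"
  using K_W[OF Wt_K] by (metis W_inverse)

text \<open>If the inverse of \<open>w\<close> is positive on the inversions of \<open>st i\<close>, the numbers of inversions add up.
  Otherwise this applies to \<open>st i \<circ> w\<close>, and \<open>w\<close> is the longer of the two.\<close>

lemma wlen_st:
  assumes i: "i \<in> It" and w: "w \<in> Wt"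
  shows "wlen UNIV (st i \<circ> w) = wlen UNIV (st i) + wlen UNIV w \<longleftrightarrow> half_space i w"
proof -
  have add: "wlen UNIV (u \<circ> st i) = wlen UNIV u + wlen UNIV (st i)"
    if "u \<in> Wt" "Pos (u (\<alpha> i))" for u
    using K_W[OF Wt_K[OF that(1)]] st_W[OF i] st_comp_st[OF i] outer_Pos[OF that] inversions_st[OF i]
    by (intro wlen_comp_involution) auto
  define u where "u = finv w"
  have u: "u \<in> Wt" "finv u = w" using Wt_finv[OF w] by (auto simp: u_def)
  have us: "u \<circ> st i \<in> Wt" using Wt_comp[OF u(1) Wt_st[OF i]] .
  have "finv (u \<circ> st i) = st i \<circ> w" using finv_comp[OF u(1) Wt_st[OF i]] finv_st[OF i] u(2) by simp
  then have eq: "wlen UNIV (st i \<circ> w) = wlen UNIV (u \<circ> st i)" using wlen_finv[OF us] by simp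
  have eq': "wlen UNIV w = wlen UNIV u" using wlen_finv[OF u(1)] u(2) by simp
  have "\<alpha> i \<in> inversions (st i)"
    using st_outer[OF i simple_root_outer(1)[OF i]] by (simp add: inversions_def outer_roots_def)
  then have st_pos: "wlen UNIV (st i) > 0"
    using wlen_inversions[OF st_W[OF i]] by (metis card_gt_0_iff empty_iff)
  show ?thesis
  proof (cases "Pos (u (\<alpha> i))")
    case True
    then show ?thesis using add[OF u(1)] eq eq' by (simp add: u_def)
  next
    case False
    then have "Pos ((u \<circ> st i) (\<alpha> i))" using sign_change[OF u(1) i] by simp
    then have "wlen UNIV (u \<circ> st i \<circ> st i) = wlen UNIV (u \<circ> st i) + wlen UNIV (st i)"
      by (rule add[OF us])
    moreover have "u \<circ> st i \<circ> st i = u" by (simp add: fun_eq_iff st_st[OF i])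
    ultimately have "wlen UNIV u = wlen UNIV (u \<circ> st i) + wlen UNIV (st i)" by metis
    then show ?thesis using False eq eq' st_pos by (simp add: u_def)
  qed
qed

lemma lengths_additive:
  assumes "w \<in> Wt" "w' \<in> Wt"
  shows "length_tilde A X \<tau> Istar (w \<circ> w') = length_tilde A X \<tau> Istar w + length_tilde A X \<tau> Istar w' \<longleftrightarrow>
    weyl_length A (w \<circ> w') = weyl_length A w + weyl_length A w'"
proof -
  interpret hs: half_space_system G It st half_space by (rule half_space_system_G)
  have "restricted.len (w \<circ> w') = restricted.len w + restricted.len w' \<longleftrightarrow>
      wlen UNIV (w \<circ> w') = wlen UNIV w + wlen UNIV w'"
  proof (rule restricted.additive_iff_len_additive)
    show "wlen UNIV (g \<circ> h) \<le> wlen UNIV g + wlen UNIV h" if "g \<in> Wt" "h \<in> Wt" for g h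
      using par.len_mult_le[of g UNIV h] K_W[OF Wt_K[OF that(1)]] K_W[OF Wt_K[OF that(2)]] by blast
    show "wlen UNIV id = 0" by (rule par.len_one)
    show "wlen UNIV (st j \<circ> g) = wlen UNIV (st j) + wlen UNIV g \<longleftrightarrow> restricted.len (st j \<circ> g) = Suc (restricted.len g)"
      if "j \<in> It" "g \<in> Wt" for j g
      using wlen_st[OF that] hs.half_space_iff_len[OF that] by (simp only: mult_G)
  qed (use assms in auto)
  then show ?thesis by (simp add: length_tilde_def weyl_length_def)
qed

end

section \<open>Coxeter systems from generalized Satake diagrams\<close>

theorem theorem4p29:
  fixes A :: "int^'i^'i::finite" and X Istar :: "'i set" and \<tau> :: "'i \<Rightarrow> 'i"
  assumes "gen_cartan_matrix A" and "indecomposable A" and "symmetrizable A"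
    and "compatible_decoration A X \<tau>"
    and "orbit_reps X \<tau> Istar"
  shows "(coxeter_system (W_tilde A X \<tau> Istar) (I_tilde A X \<tau> Istar) (s_tilde A X \<tau>)
            \<longleftrightarrow> gen_satake_diagram A X \<tau>) \<and>
         (gen_satake_diagram A X \<tau> \<longrightarrow>
            (\<forall>w \<in> carrier (W_tilde A X \<tau> Istar). \<forall>w' \<in> carrier (W_tilde A X \<tau> Istar).
               length_tilde A X \<tau> Istar (w \<circ> w')
                   = length_tilde A X \<tau> Istar w + length_tilde A X \<tau> Istar w'
               \<longleftrightarrow> weyl_length A (w \<circ> w') = weyl_length A w + weyl_length A w'))"
proof -
  interpret decoration A X \<tau>
    using assms by (simp add: decoration_def gcm_def decoration_axioms_def)
  have satake_if: "satake A X \<tau> Istar" if "gen_satake_diagram A X \<tau>"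
    using that assms decoration_axioms by (simp add: satake_def satake_axioms_def)
  have "gen_satake_diagram A X \<tau>"
    if cox: "coxeter_system (W_tilde A X \<tau> Istar) (I_tilde A X \<tau> Istar) (s_tilde A X \<tau>)"
  proof (rule ccontr)
    assume "\<not> gen_satake_diagram A X \<tau>"
    then obtain i where i: "i \<notin> X" "\<tau> i = i" "type_A2 A (diagram_component A (dec_ext X \<tau> i) i)"
      using assms(4) by (auto simp: gen_satake_diagram_def)
    note A2 = A2_not_involution[OF i]
    have "\<exists>!j. j \<in> Istar \<and> j \<in> {i, \<tau> i}" using assms(5) i(1) by (auto simp: orbit_reps_def)
    then have "i \<in> Istar" using i(2) by auto
    then have "i \<in> I_tilde A X \<tau> Istar" using A2(1) by (simp add: I_tilde_def)
    then have "s_tilde A X \<tau> i \<circ> s_tilde A X \<tau> i = id"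
      using coxeter_system_square[OF cox] by (simp add: W_tilde_def GL_V_def)
    then show False using A2(2) by blast
  qed
  then show ?thesis
    using satake.coxeter_G[OF satake_if] satake.lengths_additive[OF satake_if] by blast
qed

end
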